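(* Let $\mathbb{U}^{\triangle}_{2n}$ be the uniform distribution on the set $\triangle_{2n}$ of rooted stack-triangulations with $2n$ faces, and let $\mathbb{P}^{\triangle}_\infty$ be the distribution of the random infinite rooted map $m_\infty=\mathcal{G}_{\mathbf{t}_\infty}$, where $\mathbf{t}_\infty$ is a random infinite ternary tree with law $P^{\rm ter}_\infty$. When $n\to\infty$, $\mathbb{U}^{\triangle}_{2n}$ converges weakly to $\mathbb{P}^{\triangle}_\infty$ for the topology of local convergence, i.e. the topology induced by the metric $d_L$ on the space of locally finite rooted planar maps.
   Context: Rooted planar maps: connected graphs properly embedded in the plane with a distinguished oriented edge $(E_0,E_1)$ (the root; $E_0$ is the root vertex) having the infinite face on its right, considered up to homeomorphisms preserving orientation and root; $d_m$ is the graph distance. Stack-triangulations: $\triangle_2=\{\Theta\}$, $\Theta$ the rooted triangle with vertices $E_0,E_1,E_2$ and root $(E_0,E_1)$. For a rooted triangulation $m$ and a finite face $f$ of $m$, $\Phi(m,f)$ is obtained by adding a vertex $x$ inside $f$ and three non-crossing edges from $x$ to the vertices of $f$. $\triangle_{2(k+1)}=\{\Phi(m,f): m\in\triangle_{2k},\ f \text{ finite face of } m\}$. Ternary trees: (finite or infinite) sets $t$ of finite words on $\{1,2,3\}$, containing the empty word $\varnothing$, stable under taking prefixes, such that each $u\in t$ has either no child or the three children $u1,u2,u3$ in $t$; $t^\circ$ is the set of internal nodes (those with three children). Canonical drawing: to each word $u$ on $\{1,2,3\}$ associate an ordered geometric triangle: $\Delta_\varnothing=(E_0,E_1,E_2)$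 with $E_0=0$, $E_1=1$, $E_2=e^{i\pi/3}$; if $\Delta_u=(A,B,C)$ has center of mass $x$, then $\Delta_{u1}=(x,B,C)$, $\Delta_{u2}=(A,x,C)$, $\Delta_{u3}=(A,B,x)$. For a ternary tree $t$, $\mathcal{G}_t$ is the map, rooted at $(E_0,E_1)$, consisting of the vertices and sides of $\Delta_\varnothing$ and, for every $u\in t^\circ$, of the center of mass $x$ of $\Delta_u$ and the three straight segments joining $x$ to the vertices of $\Delta_u$. (For finite $t$ this gives a bijection between ternary trees with $3K-2$ nodes and $\triangle_{2K}$.) Law $P^{\rm ter}_\infty$: let $(X_i)_{i\ge1}$ be i.i.d. uniform on $\{1,2,3\}$ and consider the infinite path ("spine") of words $\varnothing, X_1, X_1X_2,\dots$ in the complete ternary tree; on each node of the complete ternary tree at distance 1 from the spine (and not on it) graft an independent Galton–Watson tree with offspring distribution $\frac23\delta_0+\frac13\delta_3$. The resulting tree $\mathbf{t}_\infty$ has law $P^{\rm ter}_\infty$. Almost surely $\mathcal{G}_{\mathbf{t}_\infty}$ is locally finite. Local metric: for a locally finite rooted map $m$ with root vertex $e_0$ and $r\ge0$, $B_m(r)$ is the rooted map with vertex set $\{u: d_m(u,e_0)\le r\}$ and edges all edges of $m$ between these vertices. $d_L(m,m')=1/(1+k)$, where $k$ is the supremum of the radii $r$ such that $B_m(r)$ and $B_{m'}(r)$ are equal as rooted maps (distance $0$ if $k=\infty$). *)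

theory Defs
  imports "HOL-Probability.Probability" "HOL-Complex_Analysis.Complex_Analysis"
begin

section \<open>Rooted planar maps\<close>

text \<open>A drawing consists of a set of points of the plane, a set of curves (an edge is the point set
  of the curve, loops and multiple edges being possible), and a root edge oriented by a
  parametrisation: \<open>pathstart (root D)\<close> is the root vertex.\<close>

record drawing =
  verts :: "complex set"
  edges :: "complex set set"
  root :: "real \<Rightarrow> complex"

definition root_vertex :: "drawing \<Rightarrow> complex" where
  "root_vertex D = pathstart (root D)"

definition adj :: "drawing \<Rightarrow> complex \<Rightarrow> complex \<Rightarrow> bool" where
  "adj D u v \<longleftrightarrow> (\<exists>e\<in>edges D. e \<inter> verts D = {u, v})"

definition graph_dist :: "drawing \<Rightarrow> complex \<Rightarrow> complex \<Rightarrow> nat" where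
  "graph_dist D u v = (LEAST n. (adj D ^^ n) u v)"

definition faces :: "drawing \<Rightarrow> complex set set" where
  "faces D = components (- (verts D \<union> \<Union>(edges D)))"

text \<open>A homeomorphism of the plane preserves the orientation iff the image of every positively
  oriented circle winds once, positively, around the image of its centre.\<close>

definition oriented_homeo :: "(complex \<Rightarrow> complex) \<Rightarrow> bool" where
  "oriented_homeo h \<longleftrightarrow> (\<exists>h'. homeomorphism UNIV UNIV h h') \<and>
     (\<forall>z r. 0 < r \<longrightarrow> winding_number (h \<circ> circlepath z r) (h z) = 1)"

text \<open>The infinite face is on the right of the root: after straightening the middle part of the root
  edge onto the real axis, directed to the right, the points just below it are in an unbounded
  face.\<close>

definition infinite_face_on_right :: "drawing \<Rightarrow> bool" where
  "infinite_face_on_right D \<longleftrightarrow> (\<exists>h F \<epsilon>. oriented_homeo h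
     \<and> (\<forall>s\<in>{1/3..2/3}. h (root D s) = complex_of_real s)
     \<and> F \<in> faces D \<and> \<not> bounded F
     \<and> 0 < \<epsilon> \<and> (\<forall>s\<in>{0<..<\<epsilon>}. Complex (1/2) (- s) \<in> h ` F))"

text \<open>The third condition says that vertices have finite degree and that the drawing is an embedding
  of the graph as a topological space, i.e. edges do not accumulate at a point of the drawing.
  Accumulation at other points of the plane has to be allowed: the canonical drawing of an infinite
  tree is contained in a triangle.\<close>

definition locally_finite_map :: "drawing \<Rightarrow> bool" where
  "locally_finite_map D \<longleftrightarrow>
     (\<forall>e\<in>edges D. \<exists>g. simple_path g \<and> path_image g = e \<and> e \<inter> verts D = {pathstart g, pathfinish g})
   \<and> (\<forall>e\<in>edges D. \<forall>e'\<in>edges D. e \<noteq> e' \<longrightarrow> e \<inter> e' \<subseteq> verts D)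
   \<and> (\<forall>p \<in> verts D \<union> \<Union>(edges D). \<exists>U. open U \<and> p \<in> U \<and> finite {e \<in> edges D. e \<inter> U \<noteq> {}})
   \<and> (\<forall>u\<in>verts D. \<forall>v\<in>verts D. (adj D)\<^sup>*\<^sup>* u v)
   \<and> simple_path (root D) \<and> path_image (root D) \<in> edges D
   \<and> path_image (root D) \<inter> verts D = {pathstart (root D), pathfinish (root D)}
   \<and> infinite_face_on_right D"

text \<open>Equality of rooted maps. The ball of radius 0 need not contain the root edge, so root edges are
  compared only when present; the root vertices are always compared. Comparing the root edges up to an
  increasing change of parameter also fixes the orientation of a loop.\<close>

definition same_map :: "drawing \<Rightarrow> drawing \<Rightarrow> bool" where
  "same_map D D' \<longleftrightarrow> (\<exists>h. oriented_homeo h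
     \<and> h ` verts D = verts D' \<and> (\<lambda>e. h ` e) ` edges D = edges D'
     \<and> h (root_vertex D) = root_vertex D'
     \<and> (path_image (root D) \<in> edges D \<longleftrightarrow> path_image (root D') \<in> edges D')
     \<and> (path_image (root D) \<in> edges D \<longrightarrow>
         (\<exists>\<phi> \<phi>'. homeomorphism {0..1} {0..1} \<phi> \<phi>' \<and> \<phi> 0 = 0 \<and> \<phi> 1 = (1::real)
            \<and> (\<forall>s\<in>{0..1}. h (root D s) = root D' (\<phi> s)))))"

type_synonym rooted_map = "drawing set"

definition map_of_drawing :: "drawing \<Rightarrow> rooted_map" where
  "map_of_drawing D = {D'. same_map D D'}"

definition locally_finite_maps :: "rooted_map set" where
  "locally_finite_maps = {map_of_drawing D |D. locally_finite_map D}"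


section \<open>Local topology\<close>

definition map_ball :: "drawing \<Rightarrow> nat \<Rightarrow> drawing" where
  "map_ball D r =
     (let V = {v \<in> verts D. graph_dist D (root_vertex D) v \<le> r}
      in D\<lparr>verts := V, edges := {e \<in> edges D. e \<inter> verts D \<subseteq> V}\<rparr>)"

definition balls_agree :: "nat \<Rightarrow> rooted_map \<Rightarrow> rooted_map \<Rightarrow> bool" where
  "balls_agree r m m' \<longleftrightarrow> (\<exists>D\<in>m. \<exists>D'\<in>m'. same_map (map_ball D r) (map_ball D' r))"

definition d_L :: "rooted_map \<Rightarrow> rooted_map \<Rightarrow> real" where
  "d_L m m' = (case (SUP r\<in>{r. balls_agree r m m'}. enat r) of
                 enat k \<Rightarrow> 1 / (1 + real k)
               | \<infinity> \<Rightarrow> 0)"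

definition local_topology :: "rooted_map topology" where
  "local_topology = topology (\<lambda>U. U \<subseteq> locally_finite_maps \<and>
     (\<forall>m\<in>U. \<exists>\<epsilon>>0. \<forall>m'\<in>locally_finite_maps. d_L m m' < \<epsilon> \<longrightarrow> m' \<in> U))"

lemma openin_local_topology:
  "openin local_topology U \<longleftrightarrow> U \<subseteq> locally_finite_maps \<and>
     (\<forall>m\<in>U. \<exists>\<epsilon>>0. \<forall>m'\<in>locally_finite_maps. d_L m m' < \<epsilon> \<longrightarrow> m' \<in> U)"
proof -
  define P where "P = (\<lambda>U. U \<subseteq> locally_finite_maps \<and>
     (\<forall>m\<in>U. \<exists>\<epsilon>>0. \<forall>m'\<in>locally_finite_maps. d_L m m' < \<epsilon> \<longrightarrow> m' \<in> U))"
  have "P (S \<inter> T)" if S: "P S" and T: "P T" for S T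
    unfolding P_def
  proof (intro conjI ballI)
    show "S \<inter> T \<subseteq> locally_finite_maps" using S unfolding P_def by (simp add: le_infI1)
    fix m assume m: "m \<in> S \<inter> T"
    from m S obtain a where a: "a > 0" "\<forall>m'\<in>locally_finite_maps. d_L m m' < a \<longrightarrow> m' \<in> S"
      unfolding P_def by (meson IntD1)
    from m T obtain b where b: "b > 0" "\<forall>m'\<in>locally_finite_maps. d_L m m' < b \<longrightarrow> m' \<in> T"
      unfolding P_def by (meson IntD2)
    show "\<exists>\<epsilon>>0. \<forall>m'\<in>locally_finite_maps. d_L m m' < \<epsilon> \<longrightarrow> m' \<in> S \<inter> T"
      using a b by (intro exI[of _ "min a b"]) simp
  qed
  moreover have "P (\<Union>K)" if K: "\<forall>S\<in>K. P S" for K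
    unfolding P_def
  proof (intro conjI ballI)
    show "\<Union>K \<subseteq> locally_finite_maps" using K unfolding P_def by (simp add: Sup_le_iff)
    fix m assume "m \<in> \<Union>K"
    then obtain S where S: "S \<in> K" "m \<in> S" by (rule UnionE)
    with K obtain a where "a > 0" "\<forall>m'\<in>locally_finite_maps. d_L m m' < a \<longrightarrow> m' \<in> S"
      unfolding P_def by meson
    with S show "\<exists>\<epsilon>>0. \<forall>m'\<in>locally_finite_maps. d_L m m' < \<epsilon> \<longrightarrow> m' \<in> \<Union>K"
      by (intro exI[of _ a]) auto
  qed
  ultimately have "istopology P" by (simp add: istopology_def)
  then have "openin (topology P) = P" by (rule topology_inverse')
  then show ?thesis unfolding local_topology_def P_def by (rule fun_cong)
qed

lemma topspace_local_topology: "topspace local_topology = locally_finite_maps"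
proof (rule antisym)
  show "topspace local_topology \<subseteq> locally_finite_maps"
    using openin_topspace[of local_topology] unfolding openin_local_topology by (rule conjunct1)
  show "locally_finite_maps \<subseteq> topspace local_topology"
    by (rule openin_subset) (simp add: openin_local_topology gt_ex)
qed

definition borel_sets_of :: "'a topology \<Rightarrow> 'a measure" where
  "borel_sets_of X = sigma (topspace X) {U. openin X U}"

definition converges_weakly :: "'a topology \<Rightarrow> (nat \<Rightarrow> 'a measure) \<Rightarrow> 'a measure \<Rightarrow> bool" where
  "converges_weakly X \<mu>s \<mu> \<longleftrightarrow>
     (\<forall>f :: 'a \<Rightarrow> real. continuous_map X euclideanreal f \<and> bounded (f ` topspace X) \<longrightarrow>
        (\<lambda>n. \<integral>m. f m \<partial>(\<mu>s n)) \<longlonglongrightarrow> (\<integral>m. f m \<partial>\<mu>))"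


section \<open>Stack-triangulations\<close>

type_synonym triangle = "complex \<times> complex \<times> complex"

fun corners :: "triangle \<Rightarrow> complex set" where
  "corners (A, B, C) = {A, B, C}"

fun sides :: "triangle \<Rightarrow> complex set set" where
  "sides (A, B, C) = {closed_segment A B, closed_segment B C, closed_segment C A}"

definition root_triangle :: triangle where
  "root_triangle = (0, 1, cis (pi / 3))"

definition Theta :: drawing where
  "Theta = \<lparr>verts = corners root_triangle, edges = sides root_triangle, root = linepath 0 1\<rparr>"

text \<open>Insertion of a vertex in a finite face, performed in a drawing of the map where this face is
  a straight triangle, with straight new edges. Since maps are identified up to homeomorphism, and
  the drawing is an arbitrary one with this property, this is an operation on rooted maps.\<close>

definition triangular_face :: "drawing \<Rightarrow> complex set \<Rightarrow> bool" where
  "triangular_face D F \<longleftrightarrow> F \<in> faces D \<and>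
     (\<exists>A B C. F = interior (convex hull {A, B, C}) \<and> verts D \<inter> frontier F = {A, B, C})"

definition insert_vertex :: "drawing \<Rightarrow> complex set \<Rightarrow> complex \<Rightarrow> drawing" where
  "insert_vertex D F x =
     D\<lparr>verts := insert x (verts D),
       edges := edges D \<union> closed_segment x ` (verts D \<inter> frontier F)\<rparr>"

text \<open>\<open>stack_triangulations n\<close> is the set of the rooted stack-triangulations with \<open>2 n\<close> faces.\<close>

fun stack_triangulations :: "nat \<Rightarrow> rooted_map set" where
  "stack_triangulations 0 = {}"
| "stack_triangulations (Suc 0) = {map_of_drawing Theta}"
| "stack_triangulations (Suc (Suc k)) =
     {map_of_drawing (insert_vertex D F x) |D F x.
        map_of_drawing D \<in> stack_triangulations (Suc k) \<and> triangular_face D F \<and> x \<in> F}"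

definition uniform_stack :: "nat \<Rightarrow> rooted_map measure" where
  "uniform_stack n =
     distr (uniform_count_measure (stack_triangulations n)) (borel_sets_of local_topology) (\<lambda>m. m)"


section \<open>Ternary trees and their canonical drawing\<close>

type_synonym word = "nat list"

definition ternary_tree :: "word set \<Rightarrow> bool" where
  "ternary_tree t \<longleftrightarrow> [] \<in> t \<and> t \<subseteq> lists {1, 2, 3} \<and> (\<forall>u i. u @ [i] \<in> t \<longrightarrow> u \<in> t) \<and>
     (\<forall>u\<in>t. (\<forall>i\<in>{1, 2, 3}. u @ [i] \<notin> t) \<or> (\<forall>i\<in>{1, 2, 3}. u @ [i] \<in> t))"

definition internal_nodes :: "word set \<Rightarrow> word set" where
  "internal_nodes t = {u \<in> t. \<forall>i\<in>{1, 2, 3}. u @ [i] \<in> t}"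

fun centre :: "triangle \<Rightarrow> complex" where
  "centre (A, B, C) = (A + B + C) / 3"

fun subtriangle :: "triangle \<Rightarrow> nat \<Rightarrow> triangle" where
  "subtriangle (A, B, C) i =
     (let x = centre (A, B, C)
      in if i = 1 then (x, B, C) else if i = 2 then (A, x, C) else (A, B, x))"

definition word_triangle :: "word \<Rightarrow> triangle" where
  "word_triangle u = foldl subtriangle root_triangle u"

definition tree_drawing :: "word set \<Rightarrow> drawing" where
  "tree_drawing t = \<lparr>
     verts = corners root_triangle \<union> (\<lambda>u. centre (word_triangle u)) ` internal_nodes t,
     edges = sides root_triangle \<union>
       (\<Union>u\<in>internal_nodes t. closed_segment (centre (word_triangle u)) ` corners (word_triangle u)),
     root = linepath 0 1\<rparr>"


section \<open>The infinite random tree and map\<close>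

definition tree_space :: "word set measure" where
  "tree_space = sigma {t. ternary_tree t} (range (\<lambda>u. {t. ternary_tree t \<and> u \<in> t}))"

text \<open>Galton-Watson tree in which the node \<open>u\<close>, if present, has \<open>\<nu> u\<close> children.\<close>

definition offspring_tree :: "(word \<Rightarrow> nat) \<Rightarrow> word set" where
  "offspring_tree \<nu> = {u. \<forall>i<length u. 1 \<le> u ! i \<and> u ! i \<le> \<nu> (take i u)}"

definition offspring_law :: "nat measure" where
  "offspring_law = point_measure {0, 3} (\<lambda>k. if k = 0 then 2/3 else 1/3)"

definition galton_watson :: "word set measure" where
  "galton_watson = distr (\<Pi>\<^sub>M u\<in>UNIV. offspring_law) tree_space offspring_tree"

text \<open>\<open>X k\<close> is the letter chosen at the node of height \<open>k\<close> of the spine, and \<open>\<tau> v\<close> is the tree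
  grafted at the node \<open>v\<close>.\<close>

definition spine :: "(nat \<Rightarrow> nat) \<Rightarrow> nat \<Rightarrow> word" where
  "spine X k = map X [0..<k]"

definition grafted_tree :: "(nat \<Rightarrow> nat) \<Rightarrow> (word \<Rightarrow> word set) \<Rightarrow> word set" where
  "grafted_tree X \<tau> = range (spine X) \<union>
     {spine X k @ [j] @ w |k j w. j \<in> {1, 2, 3} - {X k} \<and> w \<in> \<tau> (spine X k @ [j])}"

definition P_ter_inf :: "word set measure" where
  "P_ter_inf =
     distr ((\<Pi>\<^sub>M k\<in>(UNIV :: nat set). uniform_count_measure {1, 2, 3}) \<Otimes>\<^sub>M (\<Pi>\<^sub>M v\<in>UNIV. galton_watson))
       tree_space (\<lambda>(X, \<tau>). grafted_tree X \<tau>)"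

text \<open>The canonical drawing is locally finite only almost surely; the law of the tree is restricted
  to this event.\<close>

definition P_stack_inf :: "rooted_map measure" where
  "P_stack_inf =
     distr (restrict_space P_ter_inf {t. locally_finite_map (tree_drawing t)})
       (borel_sets_of local_topology) (\<lambda>t. map_of_drawing (tree_drawing t))"

end

theory Submission
  imports Defs "HOL-Real_Asymp.Real_Asymp"
begin

text \<open>The map of a tree is determined by, and determines, the tree: a homeomorphism between two
  canonical drawings preserves the unbounded face, hence fixes the root triangle, and then every
  further vertex, because a vertex inserted in a triangle is the only common neighbour of its corners
  besides the corner that the triangle replaced. Conversely the insertion of a vertex in a face is the
  growth of the tree at a leaf, since a homeomorphism can be modified inside the face by coning. So the
  uniform law on stack-triangulations is the image of the uniform law on finite ternary trees.

  A ball of the map of a locally finite tree depends only on the top of the tree, up to some height. It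
  remains to compare the laws of the tops. If \<open>T\<close> is the generating function of ternary trees, the
  trees with a given top with \<open>k\<close> internal nodes and \<open>l\<close> nodes at the truncation height have
  generating function \<open>X\<^sup>k T\<^sup>l\<close>, and the recurrence \<open>T\<^sup>l\<^sup>+\<^sup>1 = T\<^sup>l + X T\<^sup>l\<^sup>+\<^sup>3\<close> gives
  its coefficients, hence the limits of their ratios. For the infinite tree one sums over the \<open>l\<close>
  possible positions of the spine. Finally the infinite tree is locally finite by Borel-Cantelli: a vertex
  is a corner of at most \<open>4 \<cdot> 2\<^sup>n\<close> triangles of words of length \<open>n\<close>, each of which belongs to the
  tree with probability of order \<open>n 3\<^sup>-\<^sup>n\<close>.\<close>

section \<open>Barycentric coordinates\<close>

text \<open>All geometry is reduced to inequalities between barycentric coordinates. Subdivision at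
  the centre turns (x_1, x_2, x_3) into 3 x_i at place i and x_j - x_i elsewhere, so child i is
  where x_i is least. Where the least coordinate is 0, the coordinates never change again; this
  rigidity settles the incidences at every depth. The obstacle is that an infinite drawing
  accumulates inside the root triangle: bounded faces are determined for finite trees only, and an
  infinite tree is handled through its unbounded face, its adjacencies and its degrees. As for the
  constants, 4/27 is the radius of convergence of T and 3/2 its value there. A top with k internal
  nodes and l nodes at the truncation height has 2k + 1 - l leaves of smaller height, so its
  Galton-Watson weight (1/3)^k (2/3)^(2k+1-l) is (4/27)^k (3/2)^(l-1). The ratio [X^M] T^l / [X^M] T
  tends to l (3/2)^(l-1), and the extra l is the number of possible ends of the spine. The passage
  from tops to continuous functions uses that a truncated tree is itself a finite tree and can
  represent its cylinder.\<close>

definition letters :: "nat set" where "letters = {1, 2, 3}"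

lemma letters_cases:
  assumes "i \<in> letters" obtains "i = 1" | "i = 2" | "i = 3"
  using assms by (auto simp: letters_def)

lemma ball_letters: "(\<forall>i\<in>letters. P i) \<longleftrightarrow> P 1 \<and> P 2 \<and> P 3"
  and bex_letters: "(\<exists>i\<in>letters. P i) \<longleftrightarrow> P 1 \<or> P 2 \<or> P 3"
  by (auto simp: letters_def)

lemma letters_mem [simp]: "Suc 0 \<in> letters" "1 \<in> letters" "2 \<in> letters" "3 \<in> letters"
  by (auto simp: letters_def)

lemma finite_letters [simp]: "finite letters"
  by (simp add: letters_def)

lemma third_letter: "\<exists>j\<in>letters. j \<noteq> i \<and> j \<noteq> k"
  unfolding bex_letters by arith

text \<open>Twice the signed area of the triangle; it is affine in each argument separately.\<close>

definition area :: "complex \<Rightarrow> complex \<Rightarrow> complex \<Rightarrow> real" where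
  "area A B C = (Re B - Re A) * (Im C - Im A) - (Im B - Im A) * (Re C - Re A)"

text \<open>Every index other than 1 and 2 is read as 3, here, in \<open>bary\<close> and in
  \<open>subtriangle\<close>; because of this default many lemmas restrict indices to
  \<open>letters\<close>.\<close>

fun vtx :: "triangle \<Rightarrow> nat \<Rightarrow> complex" where
  "vtx (A, B, C) i = (if i = 1 then A else if i = 2 then B else C)"

text \<open>Barycentric coordinates by Cramer's rule. In a degenerate triangle the division by 0
  makes all of them 0.\<close>

fun bary :: "triangle \<Rightarrow> nat \<Rightarrow> complex \<Rightarrow> real" where
  "bary (A, B, C) i p = (if i = 1 then area p B C else if i = 2 then area A p C else area A B p) / area A B C"

fun nondegenerate :: "triangle \<Rightarrow> bool" where
  "nondegenerate (A, B, C) \<longleftrightarrow> area A B C \<noteq> 0"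

definition ctri :: "triangle \<Rightarrow> complex set" where
  "ctri T = {p. \<forall>i\<in>letters. 0 \<le> bary T i p}"

definition otri :: "triangle \<Rightarrow> complex set" where
  "otri T = {p. \<forall>i\<in>letters. 0 < bary T i p}"

definition spoke :: "triangle \<Rightarrow> nat \<Rightarrow> complex set" where
  "spoke T i = closed_segment (centre T) (vtx T i)"

lemma corners_vtx: "corners T = vtx T ` letters"
  by (cases T) (auto simp: letters_def)

lemma vtx_in_corners [simp]: "i \<in> letters \<Longrightarrow> vtx T i \<in> corners T"
  by (simp add: corners_vtx)

lemma bary_sum: "nondegenerate T \<Longrightarrow> bary T 1 p + bary T 2 p + bary T 3 p = 1"
  by (cases T) (simp add: area_def add_divide_distrib[symmetric] algebra_simps)

text \<open>\<open>area\<close> is affine in each of its arguments. The parameter s is an arbitrary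
  real, so the formula also covers points beyond the ends of a segment.\<close>

lemma bary_affine: "bary T i (p + of_real s * (q - p)) = bary T i p + s * (bary T i q - bary T i p)"
proof (cases T)
  case (fields A B C)
  have "area (p + of_real s * (q - p)) B C = area p B C + s * (area q B C - area p B C)"
    "area A (p + of_real s * (q - p)) C = area A p C + s * (area A q C - area A p C)"
    "area A B (p + of_real s * (q - p)) = area A B p + s * (area A B q - area A B p)"
    by (auto simp: area_def algebra_simps)
  then show ?thesis
    unfolding fields by (simp add: add_divide_distrib diff_divide_distrib right_diff_distrib)
qed

lemma continuous_on_bary [continuous_intros]:
  assumes "continuous_on S f" shows "continuous_on S (\<lambda>x. bary T i (f x))"
  using assms by (cases T; cases "i = 1"; cases "i = 2") (auto simp: area_def divide_inverse intro!: continuous_intros)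

lemma bary_vtx: "nondegenerate T \<Longrightarrow> i \<in> letters \<Longrightarrow> j \<in> letters \<Longrightarrow> bary T j (vtx T i) = (if i = j then 1 else 0)"
  by (cases T) (auto simp: letters_def area_def)

lemma area_centre:
  "area ((A + B + C) / 3) B C = area A B C / 3" "area A ((A + B + C) / 3) C = area A B C / 3"
  "area A B ((A + B + C) / 3) = area A B C / 3"
  by (auto simp: area_def field_simps)

lemma bary_centre: "nondegenerate T \<Longrightarrow> i \<in> letters \<Longrightarrow> bary T i (centre T) = 1 / 3"
proof (cases T)
  case (fields A B C)
  assume n: "nondegenerate T" and i: "i \<in> letters"
  from n i show ?thesis unfolding fields by (auto simp: letters_def area_centre)
qed

text \<open>After multiplication by the area of the triangle this is a polynomial identity in real
  and imaginary parts.\<close>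

lemma bary_decomp:
  assumes "nondegenerate T"
  shows "p = of_real (bary T 1 p) * vtx T 1 + of_real (bary T 2 p) * vtx T 2 + of_real (bary T 3 p) * vtx T 3"
proof (cases T)
  case (fields A B C)
  have n: "area A B C \<noteq> 0" using assms fields by simp
  have "area A B C * Re p = area p B C * Re A + area A p C * Re B + area A B p * Re C"
    "area A B C * Im p = area p B C * Im A + area A p C * Im B + area A B p * Im C"
    by (auto simp: area_def algebra_simps)
  then have "Re p = (area p B C * Re A + area A p C * Re B + area A B p * Re C) / area A B C"
    "Im p = (area p B C * Im A + area A p C * Im B + area A B p * Im C) / area A B C"
    using n by (auto simp: nonzero_eq_divide_eq mult.commute)
  then show ?thesis
    unfolding fields by (simp add: complex_eq_iff add_divide_distrib)
qed

lemma bary_inject: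
  assumes "nondegenerate T" and "\<And>i. i \<in> letters \<Longrightarrow> bary T i p = bary T i q"
  shows "p = q"
  using bary_decomp[OF assms(1), of p] bary_decomp[OF assms(1), of q] assms(2) by simp

lemma bary_zero_vtx:
  assumes "nondegenerate T" "i \<in> letters" and "\<And>j. j \<in> letters \<Longrightarrow> j \<noteq> i \<Longrightarrow> bary T j p = 0"
  shows "p = vtx T i"
proof (rule bary_inject[OF assms(1)])
  have "bary T i p = 1"
    using bary_sum[OF assms(1), of p] assms(2,3) by (auto simp: letters_def)
  then show "bary T j p = bary T j (vtx T i)" if "j \<in> letters" for j
    using assms that by (auto simp: bary_vtx)
qed

lemma nondegenerate_subtriangle: "nondegenerate T \<Longrightarrow> nondegenerate (subtriangle T i)"
proof (cases T)
  case (fields A B C)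
  assume n: "nondegenerate T"
  from n show ?thesis unfolding fields by (auto simp: Let_def area_centre)
qed

lemma vtx_subtriangle: "i \<in> letters \<Longrightarrow> j \<in> letters \<Longrightarrow>
    vtx (subtriangle T i) j = (if j = i then centre T else vtx T j)"
  by (cases T) (auto simp: letters_def Let_def)

text \<open>With g the centre, corner i equals 3 g minus the other two corners. Substituted in the
  barycentric expression of p, this gives g the coefficient 3 x_i and lowers each other coefficient
  by x_i.\<close>

lemma bary_subtriangle:
  assumes "nondegenerate T" "i \<in> letters" "j \<in> letters"
  shows "bary (subtriangle T i) j p = (if j = i then 3 * bary T i p else bary T j p - bary T i p)"
proof -
  let ?T = "subtriangle T i"
  define b where "b = (\<lambda>j. if j = i then 3 * bary T i p else bary T j p - bary T i p)"
  obtain A B C where T: "T = (A, B, C)" by (cases T)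
  have n: "area A B C \<noteq> 0" using assms T by simp
  let ?x = "(A + B + C) / 3"
  have b: "area ?x p C = (area A p C - area p B C) / 3" "area ?x B p = (area A B p - area p B C) / 3"
    "area p ?x C = (area p B C - area A p C) / 3" "area A ?x p = (area A B p - area A p C) / 3"
    "area p B ?x = (area p B C - area A B p) / 3" "area A p ?x = (area A p C - area A B p) / 3"
    by (auto simp: area_def field_simps)
  show ?thesis
    using assms(2,3) n unfolding T by (auto simp: letters_def Let_def area_centre b diff_divide_distrib)
qed

declare bary.simps [simp del] nondegenerate.simps [simp del]

section \<open>Coordinates along the segments from the centre to the corners\<close>

lemma bary_spoke:
  assumes "nondegenerate T" "i \<in> letters" "p \<in> spoke T i"
  obtains s where "0 \<le> s" "s \<le> 1" "bary T i p = 1/3 + 2 * s / 3"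
    "\<And>j. j \<in> letters \<Longrightarrow> j \<noteq> i \<Longrightarrow> bary T j p = (1 - s) / 3"
proof -
  obtain s where s: "0 \<le> s" "s \<le> 1" "p = centre T + of_real s * (vtx T i - centre T)"
    using assms(3) unfolding spoke_def closed_segment_image_interval
    by (auto simp: scaleR_conv_of_real algebra_simps)
  show ?thesis
  proof (rule that[OF s(1,2)])
    show "bary T i p = 1/3 + 2 * s / 3"
      unfolding s(3) bary_affine using assms by (simp add: bary_centre bary_vtx)
    show "bary T j p = (1 - s) / 3" if "j \<in> letters" "j \<noteq> i" for j
      unfolding s(3) bary_affine using assms that by (auto simp: bary_centre bary_vtx field_simps)
  qed
qed

lemma spokeI:
  assumes T: "nondegenerate T" and i: "i \<in> letters"
    and j: "\<And>j. j \<in> letters \<Longrightarrow> j \<noteq> i \<Longrightarrow> bary T j p = a" and a: "0 \<le> a" "a \<le> 1/3"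
  shows "p \<in> spoke T i"
proof -
  \<comment> \<open>Solves a = (1 - s) / 3, the common value of the two coordinates in
    \<open>bary_spoke\<close>.\<close>
  define s where "s = 1 - 3 * a"
  have "bary T 1 p + bary T 2 p + bary T 3 p = 1" using T by (rule bary_sum)
  then have i': "bary T i p = 1 - 2 * a" using i j by (elim letters_cases) (auto simp: j)
  have "p = centre T + of_real s * (vtx T i - centre T)"
  proof (rule bary_inject[OF T])
    fix k assume "k \<in> letters"
    then show "bary T k p = bary T k (centre T + of_real s * (vtx T i - centre T))"
      unfolding bary_affine using T i j i' by (cases "k = i") (auto simp: bary_centre bary_vtx s_def field_simps)
  qed
  moreover have "0 \<le> s" "s \<le> 1" using a by (auto simp: s_def)
  ultimately show ?thesis
    unfolding spoke_def closed_segment_image_interval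
    by (auto simp: scaleR_conv_of_real algebra_simps intro!: image_eqI[of _ _ s])
qed

lemma spoke_subset_ctri: "nondegenerate T \<Longrightarrow> i \<in> letters \<Longrightarrow> spoke T i \<subseteq> ctri T"
proof
  fix p assume *: "nondegenerate T" "i \<in> letters" "p \<in> spoke T i"
  obtain s where s: "0 \<le> s" "s \<le> 1" "bary T i p = 1/3 + 2 * s / 3"
    "\<And>j. j \<in> letters \<Longrightarrow> j \<noteq> i \<Longrightarrow> bary T j p = (1 - s) / 3"
    using bary_spoke[OF *] by blast
  have "0 \<le> bary T j p" if "j \<in> letters" for j
    using s(1-3) s(4)[OF that] by (cases "j = i") auto
  then show "p \<in> ctri T" by (simp add: ctri_def)
qed

text \<open>On spoke i the two other coordinates are both (1 - s) / 3. The coordinate i is at least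
  as large, with equality only at the centre, so the least coordinate is never least alone.\<close>

lemma spoke_tie:
  assumes "nondegenerate T" "i \<in> letters" "p \<in> spoke T i" "k \<in> letters"
    and min: "\<And>j. j \<in> letters \<Longrightarrow> bary T k p \<le> bary T j p"
  shows "\<exists>j\<in>letters. j \<noteq> k \<and> bary T j p = bary T k p"
proof -
  obtain s where s: "0 \<le> s" "s \<le> 1" "bary T i p = 1/3 + 2 * s / 3"
    "\<And>j. j \<in> letters \<Longrightarrow> j \<noteq> i \<Longrightarrow> bary T j p = (1 - s) / 3"
    using bary_spoke[OF assms(1-3)] by blast
  show ?thesis
  proof (cases "k = i")
    case True
    obtain j where j: "j \<in> letters" "j \<noteq> k" using third_letter[of k k] by blast
    then have "bary T j p = (1 - s) / 3" using s(4) True by simp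
    moreover from this have "bary T j p = bary T k p" using min[OF j(1)] s(1,3) True by simp
    ultimately show ?thesis using j by blast
  next
    case False
    obtain j where j: "j \<in> letters" "j \<noteq> k" "j \<noteq> i"
      using third_letter[of k i] by blast
    have "bary T j p = bary T k p" using s(4)[OF j(1) j(3)] s(4)[OF assms(4) False] by simp
    then show ?thesis using j by blast
  qed
qed

section \<open>Closed and open triangles as convex sets\<close>

lemma convex_hull_ctri:
  assumes "nondegenerate (A, B, C)"
  shows "convex hull {A, B, C} = ctri (A, B, C)"
proof (intro equalityI subsetI)
  let ?T = "(A, B, C)"
  fix p assume "p \<in> ctri ?T"
  then have "0 \<le> bary ?T 1 p \<and> 0 \<le> bary ?T 2 p \<and> 0 \<le> bary ?T 3 p" by (simp add: ctri_def)
  moreover have "p = bary ?T 1 p *\<^sub>R A + bary ?T 2 p *\<^sub>R B + bary ?T 3 p *\<^sub>R C"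
    using bary_decomp[OF assms, of p] by (simp add: scaleR_conv_of_real)
  ultimately show "p \<in> convex hull {A, B, C}"
    unfolding convex_hull_3 using bary_sum[OF assms, of p] by blast
next
  let ?T = "(A, B, C)"
  have "convex (ctri ?T)"
    unfolding convex_alt
  proof (intro ballI allI impI)
    fix x y u assume *: "x \<in> ctri ?T" "y \<in> ctri ?T" "0 \<le> u \<and> u \<le> (1::real)"
    have "(1 - u) *\<^sub>R x + u *\<^sub>R y = x + of_real u * (y - x)"
      by (simp add: scaleR_conv_of_real algebra_simps)
    moreover have "0 \<le> bary ?T i x + u * (bary ?T i y - bary ?T i x)" if "i \<in> letters" for i
    proof -
      have "0 \<le> (1 - u) * bary ?T i x + u * bary ?T i y" using * that by (auto simp: ctri_def)
      then show ?thesis by (simp add: algebra_simps)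
    qed
    ultimately show "(1 - u) *\<^sub>R x + u *\<^sub>R y \<in> ctri ?T"
      by (simp add: ctri_def bary_affine)
  qed
  moreover have "{A, B, C} \<subseteq> ctri ?T"
  proof -
    have "vtx ?T i \<in> ctri ?T" if "i \<in> letters" for i
      unfolding ctri_def using assms that by (auto simp: bary_vtx simp del: vtx.simps)
    from this[of 1] this[of 2] this[of 3] show ?thesis by simp
  qed
  moreover fix p assume "p \<in> convex hull {A, B, C}"
  ultimately show "p \<in> ctri ?T" using hull_minimal by blast
qed

lemma compact_ctri: "nondegenerate T \<Longrightarrow> compact (ctri T)"
  by (cases T) (simp add: convex_hull_ctri[symmetric] finite_imp_compact_convex_hull)

lemma convex_ctri: "nondegenerate T \<Longrightarrow> convex (ctri T)"
  by (cases T) (simp add: convex_hull_ctri[symmetric])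

lemma open_otri: "open (otri T)"
proof -
  have "otri T = (\<Inter>i\<in>letters. {p. 0 < bary T i p})" by (auto simp: otri_def)
  moreover have "open {p. 0 < bary T i p}" for i
    by (intro open_Collect_less continuous_intros)
  ultimately show ?thesis by auto
qed

lemma otri_subset: "otri T \<subseteq> ctri T"
  by (auto simp: otri_def ctri_def intro: less_imp_le)

text \<open>At a point whose coordinate i is 0, a small step straight away from corner i makes this
  coordinate negative and so leaves the closed triangle.\<close>

lemma interior_ctri:
  assumes "nondegenerate T" shows "interior (ctri T) = otri T"
proof (intro equalityI subsetI)
  fix p assume "p \<in> otri T"
  then show "p \<in> interior (ctri T)" using open_otri otri_subset by (meson interiorI)
next
  fix p assume p: "p \<in> interior (ctri T)"
  then have pc: "p \<in> ctri T" using interior_subset by blast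
  obtain e where e: "0 < e" "ball p e \<subseteq> ctri T"
    using p by (auto simp: mem_interior)
  show "p \<in> otri T"
  proof (rule ccontr)
    assume "p \<notin> otri T"
    then obtain i where i: "i \<in> letters" "bary T i p = 0"
      using pc unfolding otri_def ctri_def by (auto simp: not_less intro!: antisym)
    define q where "q = vtx T i"
    have bq: "bary T i q = 1" using assms i by (simp add: q_def bary_vtx)
    then have pq: "p \<noteq> q" using i by auto
    \<comment> \<open>Chosen so that the displaced point is at distance e / 2 from p.\<close>
    define s where "s = e / (2 * norm (q - p))"
    have s: "0 < s" using e pq by (simp add: s_def)
    let ?r = "p + of_real (- s) * (q - p)"
    have "dist p ?r = s * norm (q - p)" using s by (simp add: dist_norm norm_mult)
    also have "\<dots> = e / 2" using pq by (simp add: s_def)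
    finally have "?r \<in> ctri T" using e by auto
    then have "0 \<le> bary T i ?r" using i by (auto simp: ctri_def)
    also have "\<dots> = - s" unfolding bary_affine using i bq by simp
    finally show False using s by simp
  qed
qed

lemma centre_in_otri: "nondegenerate T \<Longrightarrow> centre T \<in> otri T"
  by (simp add: otri_def bary_centre)

lemma corners_subset_ctri: "nondegenerate T \<Longrightarrow> corners T \<subseteq> ctri T"
  by (auto simp: corners_vtx ctri_def bary_vtx)

lemma corners_not_otri: "nondegenerate T \<Longrightarrow> v \<in> corners T \<Longrightarrow> v \<notin> otri T"
  by (auto simp: corners_vtx otri_def bary_vtx letters_def)

lemma convex_otri: "nondegenerate T \<Longrightarrow> convex (otri T)"
  using convex_ctri convex_interior interior_ctri by metis

lemma closure_otri:
  assumes "nondegenerate T" shows "closure (otri T) = ctri T"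
proof -
  have "interior (ctri T) \<noteq> {}" unfolding interior_ctri[OF assms] using centre_in_otri[OF assms] by blast
  then have "closure (interior (ctri T)) = closure (ctri T)"
    using assms convex_closure_interior convex_ctri by blast
  then show ?thesis using assms by (simp add: interior_ctri closure_closed compact_ctri compact_imp_closed)
qed

lemma frontier_otri:
  assumes "nondegenerate T" shows "frontier (otri T) = ctri T - otri T"
  by (simp add: frontier_def closure_otri[OF assms] interior_open open_otri)

text \<open>Collinear points lie on a line on which the inner product with N is constant, and a line
  has empty interior; N is a side turned by a right angle, and arbitrary if the three points
  coincide. This deals with the triangles in \<open>triangular_face\<close>, whose definition does
  not mention their area.\<close>

lemma degenerate_interior_empty:
  assumes "area A B C = 0" shows "interior (convex hull {A, B, C}) = {}"
proof -
  have *: "\<exists>N. N \<noteq> 0 \<and> N \<bullet> B = N \<bullet> A \<and> N \<bullet> C = N \<bullet> A"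
  proof (cases "A = B")
    case True
    show ?thesis
    proof (cases "C = A")
      case True
      then show ?thesis using \<open>A = B\<close> by (intro exI[of _ 1]) simp
    next
      case False
      then show ?thesis using \<open>A = B\<close>
        by (intro exI[of _ "Complex (Im A - Im C) (Re C - Re A)"])
          (auto simp add: inner_complex_def complex_eq_iff algebra_simps)
    qed
  next
    case False
    moreover have "(Im A - Im B) * Re C + (Re B - Re A) * Im C = (Im A - Im B) * Re A + (Re B - Re A) * Im A"
      using assms by (simp add: area_def algebra_simps)
    ultimately show ?thesis
      by (intro exI[of _ "Complex (Im A - Im B) (Re B - Re A)"])
        (auto simp add: inner_complex_def complex_eq_iff algebra_simps)
  qed
  then obtain N where N: "N \<noteq> 0" "N \<bullet> B = N \<bullet> A" "N \<bullet> C = N \<bullet> A" by blast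
  then have "{A, B, C} \<subseteq> {p. N \<bullet> p = N \<bullet> A}" by simp
  then have "convex hull {A, B, C} \<subseteq> {p. N \<bullet> p = N \<bullet> A}"
    by (intro hull_minimal convex_hyperplane)
  then have "interior (convex hull {A, B, C}) \<subseteq> interior {p. N \<bullet> p = N \<bullet> A}"
    by (rule interior_mono)
  then show ?thesis using interior_hyperplane[OF N(1)] by simp
qed

lemma sides_cases:
  assumes "nondegenerate T" "e \<in> sides T"
  obtains i j k where "{i, j, k} = letters" "i \<noteq> j" "k \<noteq> i" "k \<noteq> j" "e = closed_segment (vtx T i) (vtx T j)"
    "\<And>p. p \<in> e \<Longrightarrow> bary T k p = 0 \<and> p \<in> ctri T"
proof -
  obtain A B C where T: "T = (A, B, C)" by (cases T)
  have "\<exists>i j k. {i, j, k} = letters \<and> i \<noteq> j \<and> k \<noteq> i \<and> k \<noteq> j \<and> e = closed_segment (vtx T i) (vtx T j)"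
  proof -
    from assms(2) T consider "e = closed_segment A B" | "e = closed_segment B C" | "e = closed_segment C A"
      by auto
    then show ?thesis
    proof cases
      case 1 then show ?thesis unfolding T letters_def by (intro exI[of _ 1] exI[of _ 2] exI[of _ 3]) simp
    next
      case 2 then show ?thesis unfolding T letters_def by (intro exI[of _ 2] exI[of _ 3] exI[of _ 1]) (simp add: insert_commute)
    next
      case 3 then show ?thesis unfolding T letters_def by (intro exI[of _ 3] exI[of _ 1] exI[of _ 2]) (simp add: insert_commute)
    qed
  qed
  then obtain i j k where ijk: "{i, j, k} = letters" "i \<noteq> j" "k \<noteq> i" "k \<noteq> j" "e = closed_segment (vtx T i) (vtx T j)"
    by blast
  have l: "i \<in> letters" "j \<in> letters" "k \<in> letters" using ijk by auto
  show thesis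
  proof (rule that[OF ijk])
    fix p assume "p \<in> e"
    then obtain s where s: "0 \<le> s" "s \<le> 1" "p = vtx T i + of_real s * (vtx T j - vtx T i)"
      using ijk(5) unfolding closed_segment_image_interval
      by (auto simp: scaleR_conv_of_real algebra_simps)
    have b: "bary T i p = 1 - s" "bary T j p = s" "bary T k p = 0"
      unfolding s(3) bary_affine using assms l ijk by (auto simp: bary_vtx)
    have "0 \<le> bary T m p" if "m \<in> letters" for m
    proof -
      have "m = i \<or> m = j \<or> m = k" using that ijk(1) by blast
      then show ?thesis using b s by auto
    qed
    with b show "bary T k p = 0 \<and> p \<in> ctri T" by (auto simp: ctri_def)
  qed
qed

lemma frontier_covered_by_sides:
  assumes "nondegenerate T" "p \<in> ctri T" "i \<in> letters" "bary T i p = 0"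
  shows "p \<in> \<Union>(sides T)"
proof -
  obtain A B C where T: "T = (A, B, C)" by (cases T)
  note d = bary_decomp[OF assms(1), of p] and s = bary_sum[OF assms(1), of p]
  have nn: "0 \<le> bary T 1 p" "0 \<le> bary T 2 p" "0 \<le> bary T 3 p"
    using assms(2) by (auto simp: ctri_def)
  have *: "of_real a * P + of_real b * Q \<in> closed_segment P Q" if "a + b = 1" "0 \<le> a" "0 \<le> b" for a b P Q
  proof -
    have "a = 1 - b" "b \<le> 1" using that by simp_all
    then show ?thesis using that unfolding closed_segment_def scaleR_conv_of_real by blast
  qed
  have v: "vtx T 1 = A" "vtx T 2 = B" "vtx T 3 = C" by (auto simp: T)
  from assms(3) show ?thesis
  proof (cases rule: letters_cases)
    case 1
    then have "p \<in> closed_segment B C" using assms(4) d s nn v *[of "bary T 2 p" "bary T 3 p" B C] by simp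
    then show ?thesis by (simp add: T)
  next
    case 2
    then have "p \<in> closed_segment A C" using assms(4) d s nn v *[of "bary T 1 p" "bary T 3 p" A C] by simp
    then show ?thesis by (simp add: T closed_segment_commute)
  next
    case 3
    then have "p \<in> closed_segment A B" using assms(4) d s nn v *[of "bary T 1 p" "bary T 2 p" A B] by simp
    then show ?thesis by (simp add: T)
  qed
qed

section \<open>The triangles of words\<close>

abbreviation wt :: "word \<Rightarrow> triangle" where "wt \<equiv> word_triangle"

lemma otri_ctri: "p \<in> otri T \<Longrightarrow> p \<in> ctri T"
  using otri_subset by blast

lemma wt_Nil [simp]: "wt [] = root_triangle"
  and wt_snoc: "wt (u @ [i]) = subtriangle (wt u) i"
  by (simp_all add: word_triangle_def)

lemma nondegenerate_root: "nondegenerate root_triangle"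
  by (auto simp: root_triangle_def nondegenerate.simps area_def sin_60)

lemma nondegenerate_wt [simp]: "nondegenerate (wt u)"
  by (induction u rule: rev_induct) (auto simp: nondegenerate_root wt_snoc nondegenerate_subtriangle)

lemma bary_child: "i \<in> letters \<Longrightarrow> j \<in> letters \<Longrightarrow>
    bary (wt (u @ [i])) j p = (if j = i then 3 * bary (wt u) i p else bary (wt u) j p - bary (wt u) i p)"
  by (simp add: wt_snoc bary_subtriangle)

lemma vtx_child: "i \<in> letters \<Longrightarrow> j \<in> letters \<Longrightarrow>
    vtx (wt (u @ [i])) j = (if j = i then centre (wt u) else vtx (wt u) j)"
  by (simp add: wt_snoc vtx_subtriangle)

lemma ctri_child_iff: "i \<in> letters \<Longrightarrow> p \<in> ctri (wt (u @ [i])) \<longleftrightarrow>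
    p \<in> ctri (wt u) \<and> (\<forall>j\<in>letters. bary (wt u) i p \<le> bary (wt u) j p)"
  unfolding ctri_def by (auto simp: bary_child split: if_splits) (smt (verit))+

lemma otri_child_iff: "i \<in> letters \<Longrightarrow> p \<in> otri (wt (u @ [i])) \<longleftrightarrow>
    0 < bary (wt u) i p \<and> (\<forall>j\<in>letters. j \<noteq> i \<longrightarrow> bary (wt u) i p < bary (wt u) j p)"
  unfolding otri_def by (auto simp: bary_child split: if_splits)

lemma ctri_append: "w \<in> lists letters \<Longrightarrow> ctri (wt (u @ w)) \<subseteq> ctri (wt u)"
proof (induction w rule: rev_induct)
  case (snoc i w)
  then show ?case using ctri_child_iff[of i _ "u @ w"] by auto
qed simp

lemma otri_append: "w \<in> lists letters \<Longrightarrow> otri (wt (u @ w)) \<subseteq> otri (wt u)"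
proof (induction w rule: rev_induct)
  case (snoc i w)
  have "p \<in> otri (wt (u @ w))" if "p \<in> otri (wt (u @ w @ [i]))" for p
  proof -
    have i: "i \<in> letters" using snoc.prems by simp
    have *: "0 < bary (wt (u @ w)) i p" "\<forall>j\<in>letters. j \<noteq> i \<longrightarrow> bary (wt (u @ w)) i p < bary (wt (u @ w)) j p"
      using that otri_child_iff[OF i, of p "u @ w"] by auto
    have "0 < bary (wt (u @ w)) j p" if "j \<in> letters" for j
      using * that by (cases "j = i") force+
    then show ?thesis by (simp add: otri_def)
  qed
  with snoc show ?case by auto
qed simp

lemma bary_spoke_ex:
  assumes "i \<in> letters" "p \<in> spoke (wt u) i"
  shows "\<exists>s\<ge>0. bary (wt u) i p = 1/3 + 2 * s / 3 \<and>
    (\<forall>j\<in>letters. j \<noteq> i \<longrightarrow> bary (wt u) j p = (1 - s) / 3)"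
  using bary_spoke[OF nondegenerate_wt assms] by metis

section \<open>Boundary points, whose coordinates persist under subdivision\<close>

definition on_boundary :: "word \<Rightarrow> complex \<Rightarrow> bool" where
  "on_boundary u p \<longleftrightarrow> p \<in> ctri (wt u) \<and> p \<notin> otri (wt u)"

lemma on_boundary_iff: "on_boundary u p \<longleftrightarrow> p \<in> ctri (wt u) \<and> (\<exists>i\<in>letters. bary (wt u) i p = 0)"
  unfolding on_boundary_def ctri_def otri_def by force

lemma corner_on_boundary: "b \<in> corners (wt u) \<Longrightarrow> on_boundary u b"
  unfolding on_boundary_def using corners_subset_ctri corners_not_otri nondegenerate_wt by blast

text \<open>At a boundary point the smallest coordinate vanishes, so that passing to a subtriangle
  containing the point leaves all coordinates unchanged.\<close>

lemma bary_boundary_child: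
  assumes "on_boundary u p" "i \<in> letters" "p \<in> ctri (wt (u @ [i]))" "j \<in> letters"
  shows "bary (wt u) i p = 0" "bary (wt (u @ [i])) j p = bary (wt u) j p"
proof -
  obtain k where "k \<in> letters" "bary (wt u) k p = 0" using assms(1) by (auto simp: on_boundary_iff)
  moreover have "p \<in> ctri (wt u)" "\<forall>j\<in>letters. bary (wt u) i p \<le> bary (wt u) j p"
    using assms(3) ctri_child_iff[OF assms(2)] by blast+
  ultimately show z: "bary (wt u) i p = 0"
    using assms(2) unfolding ctri_def by force
  then show "bary (wt (u @ [i])) j p = bary (wt u) j p"
    using assms by (simp add: bary_child)
qed

text \<open>Iterates the one-letter case. A corner is replaced only at the index of a least
  coordinate, which is 0 here; a corner with nonzero coordinate therefore survives in all smaller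
  triangles that contain the point.\<close>

lemma boundary_persists:
  assumes "on_boundary u p" "w \<in> lists letters" "p \<in> ctri (wt (u @ w))"
  shows "on_boundary (u @ w) p"
    and "j \<in> letters \<Longrightarrow> bary (wt (u @ w)) j p = bary (wt u) j p"
    and "j \<in> letters \<Longrightarrow> bary (wt u) j p \<noteq> 0 \<Longrightarrow> vtx (wt (u @ w)) j = vtx (wt u) j"
proof -
  have "on_boundary (u @ w) p \<and> (\<forall>j\<in>letters. bary (wt (u @ w)) j p = bary (wt u) j p \<and>
      (bary (wt u) j p \<noteq> 0 \<longrightarrow> vtx (wt (u @ w)) j = vtx (wt u) j))"
    using assms
  proof (induction w rule: rev_induct)
    case (snoc i w)
    then have i: "i \<in> letters" and w: "w \<in> lists letters" by auto
    have c: "p \<in> ctri (wt ((u @ w) @ [i]))" using snoc.prems by simp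
    then have "p \<in> ctri (wt (u @ w))" using ctri_child_iff[OF i] by blast
    with snoc w have IH: "on_boundary (u @ w) p" "\<And>j. j \<in> letters \<Longrightarrow> bary (wt (u @ w)) j p = bary (wt u) j p"
      "\<And>j. j \<in> letters \<Longrightarrow> bary (wt u) j p \<noteq> 0 \<Longrightarrow> vtx (wt (u @ w)) j = vtx (wt u) j" by blast+
    note B = bary_boundary_child[OF IH(1) i c]
    have "on_boundary (u @ w @ [i]) p"
      using c B i unfolding on_boundary_iff by auto
    moreover have "vtx (wt (u @ w @ [i])) j = vtx (wt u) j" if "j \<in> letters" "bary (wt u) j p \<noteq> 0" for j
      using vtx_child[OF i that(1), of "u @ w"] that IH(2,3)[OF that(1)] B(1)[OF that(1)] by auto
    ultimately show ?case using B(2) IH(2) by auto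
  qed simp
  then show "on_boundary (u @ w) p"
    and "j \<in> letters \<Longrightarrow> bary (wt (u @ w)) j p = bary (wt u) j p"
    and "j \<in> letters \<Longrightarrow> bary (wt u) j p \<noteq> 0 \<Longrightarrow> vtx (wt (u @ w)) j = vtx (wt u) j" by blast+
qed

lemma corner_persists:
  assumes "w \<in> lists letters" "j \<in> letters" "vtx (wt u) j \<in> ctri (wt (u @ w))"
  shows "vtx (wt (u @ w)) j = vtx (wt u) j"
  using boundary_persists(3)[OF corner_on_boundary assms(1,3) assms(2)] assms(2) by (simp add: bary_vtx)

text \<open>Some coordinate is 0 at a boundary point, and on a spoke this happens only for s = 1, at
  the outer end. As p has the same coordinates in u and in \<open>u @ w\<close>, it is corner c of
  both triangles.\<close>

lemma spoke_boundary:
  assumes "w \<in> lists letters" "c \<in> letters" "p \<in> spoke (wt (u @ w)) c" "on_boundary u p"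
  shows "p = vtx (wt (u @ w)) c" "p = vtx (wt u) c"
proof -
  have p: "p \<in> ctri (wt (u @ w))" using assms spoke_subset_ctri by (meson nondegenerate_wt subsetD)
  obtain s where s: "0 \<le> s" "s \<le> 1" "bary (wt (u @ w)) c p = 1/3 + 2 * s / 3"
    "\<And>j. j \<in> letters \<Longrightarrow> j \<noteq> c \<Longrightarrow> bary (wt (u @ w)) j p = (1 - s) / 3"
    using bary_spoke[OF nondegenerate_wt assms(2,3)] by blast
  obtain i where i: "i \<in> letters" "bary (wt (u @ w)) i p = 0"
    using boundary_persists(1)[OF assms(4,1) p] by (auto simp: on_boundary_iff)
  have "s = 1" using s(1,3) s(4)[OF i(1)] i(2) by (cases "i = c") auto
  then have z: "bary (wt (u @ w)) j p = 0" if "j \<in> letters" "j \<noteq> c" for j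
    using s(4)[OF that] by simp
  then show "p = vtx (wt (u @ w)) c" by (intro bary_zero_vtx) (auto simp: assms)
  show "p = vtx (wt u) c"
    using z boundary_persists(2)[OF assms(4,1) p] by (intro bary_zero_vtx) (auto simp: assms)
qed

text \<open>A spoke point in child i has another coordinate j tied with the least coordinate i, and
  the difference of the two is its coordinate j in the child.\<close>

lemma spoke_child_boundary:
  assumes "c \<in> letters" "p \<in> spoke (wt v) c" "i \<in> letters" "p \<in> ctri (wt (v @ [i]))"
  shows "on_boundary (v @ [i]) p"
proof -
  obtain j where "j \<in> letters" "j \<noteq> i" "bary (wt v) j p = bary (wt v) i p"
    using spoke_tie[OF nondegenerate_wt assms(1,2,3)] assms(4) by (auto simp: ctri_child_iff[OF assms(3)])
  then show ?thesis using assms unfolding on_boundary_iff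
    by (auto simp: bary_child intro!: bexI[of _ j])
qed

text \<open>In child i the coordinate i is least, in child j the coordinate j. In both children they
  are therefore equal, and their difference, a coordinate in the child, vanishes.\<close>

lemma siblings_boundary:
  assumes "i \<in> letters" "j \<in> letters" "i \<noteq> j" "p \<in> ctri (wt (q @ [i]))" "p \<in> ctri (wt (q @ [j]))"
  shows "on_boundary (q @ [i]) p"
proof -
  have "bary (wt q) i p = bary (wt q) j p"
    using assms ctri_child_iff by (auto intro!: antisym)
  then show ?thesis using assms unfolding on_boundary_iff
    by (auto simp: bary_child intro!: bexI[of _ j])
qed

section \<open>Incidences between the triangles of different words\<close>

lemma words_compare:
  "v = w \<or> (\<exists>i w'. w = v @ i # w') \<or> (\<exists>i v'. v = w @ i # v') \<or>
    (\<exists>q i j v' w'. v = q @ i # v' \<and> w = q @ j # w' \<and> i \<noteq> j)"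
proof (induction v arbitrary: w)
  case Nil
  then show ?case by (cases w) auto
next
  case (Cons a v)
  show ?case
  proof (cases w)
    case (Cons b w')
    show ?thesis
    proof (cases "a = b")
      case False
      then have "a # v = [] @ a # v \<and> w = [] @ b # w' \<and> a \<noteq> b" using Cons by simp
      then show ?thesis by blast
    next
      case True
      from Cons.IH[of w'] show ?thesis unfolding Cons True
        by (elim disjE exE conjE) (simp_all, metis append_Cons)
    qed
  qed simp
qed

lemma word_cases [consumes 2, case_names eq prefix suffix diverge]:
  assumes "v \<in> lists L" "w \<in> lists L"
  obtains "v = w" | i w' where "w = v @ i # w'" "i \<in> L" "w' \<in> lists L"
    | i v' where "v = w @ i # v'" "i \<in> L" "v' \<in> lists L"
    | q i j v' w' where "v = q @ i # v'" "w = q @ j # w'" "i \<noteq> j" "i \<in> L" "j \<in> L" "v' \<in> lists L" "w' \<in> lists L"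
proof -
  consider "v = w" | i w' where "w = v @ i # w'" | i v' where "v = w @ i # v'"
    | q i j v' w' where "v = q @ i # v'" "w = q @ j # w'" "i \<noteq> j"
    using words_compare[of v w] by blast
  then show thesis
  proof cases
    case 1 then show ?thesis by (rule that(1))
  next
    case (2 i w')
    then have "i \<in> L" "w' \<in> lists L" using assms by simp_all
    with 2 show ?thesis by (rule that(2))
  next
    case (3 i v')
    then have "i \<in> L" "v' \<in> lists L" using assms by simp_all
    with 3 show ?thesis by (rule that(3))
  next
    case (4 q i j v' w')
    then have "i \<in> L" "j \<in> L" "v' \<in> lists L" "w' \<in> lists L" using assms by simp_all
    with 4 show ?thesis by (rule that(4))
  qed
qed

lemma ctri_Cons: "w \<in> lists letters \<Longrightarrow> ctri (wt (u @ i # w)) \<subseteq> ctri (wt (u @ [i]))"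
  using ctri_append[of w "u @ [i]"] by simp

lemma otri_Cons: "w \<in> lists letters \<Longrightarrow> otri (wt (u @ i # w)) \<subseteq> otri (wt (u @ [i]))"
  using otri_append[of w "u @ [i]"] by simp

lemma spoke_in_ctri: "c \<in> letters \<Longrightarrow> p \<in> spoke (wt u) c \<Longrightarrow> p \<in> ctri (wt u)"
  using spoke_subset_ctri nondegenerate_wt by blast

lemma centre_otri [simp]: "centre (wt u) \<in> otri (wt u)"
  by (simp add: centre_in_otri)

lemma centre_spoke [simp]: "centre (wt u) \<in> spoke (wt u) c"
  by (simp add: spoke_def)

lemma vtx_spoke [simp]: "vtx (wt u) c \<in> spoke (wt u) c"
  by (simp add: spoke_def)

lemma not_boundary_otri: "p \<in> otri (wt u) \<Longrightarrow> \<not> on_boundary u p"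
  by (simp add: on_boundary_def)

text \<open>If w properly extends v, the centre of v, being a spoke point, is at best on the
  boundary of the child towards w; if the words diverge, a common centre would be a boundary point
  of two siblings. But a centre is interior to its own triangle and hence to those of all
  prefixes.\<close>

lemma centre_inj:
  assumes "v \<in> lists letters" "w \<in> lists letters" "centre (wt v) = centre (wt w)"
  shows "v = w"
proof -
  have *: False if "centre (wt v) \<in> otri (wt (v @ i # w'))" "i \<in> letters" "w' \<in> lists letters" for v i w'
  proof -
    have "centre (wt v) \<in> otri (wt (v @ [i]))" using that otri_Cons by blast
    moreover have "on_boundary (v @ [i]) (centre (wt v))"
      using calculation that(2) otri_ctri by (intro spoke_child_boundary[of i]) auto
    ultimately show False by (simp add: not_boundary_otri)
  qed
  from assms(1,2) show ?thesis
  proof (cases rule: word_cases)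
    case (prefix i w')
    then show ?thesis using *[of v i w'] assms(3) by simp
  next
    case (suffix i v')
    then show ?thesis using *[of w i v'] assms(3) centre_otri[of v] by simp
  next
    case (diverge q i j v' w')
    have "centre (wt v) \<in> otri (wt (q @ [i]))"
      using diverge otri_Cons[of v' q i] centre_otri[of v] by blast
    moreover have "centre (wt v) \<in> otri (wt (q @ [j]))"
      using diverge otri_Cons[of w' q j] centre_otri[of w] assms(3) by auto
    ultimately have "on_boundary (q @ [i]) (centre (wt v))"
      using siblings_boundary[OF diverge(4,5,3)] otri_ctri by blast
    then show ?thesis using \<open>centre (wt v) \<in> otri (wt (q @ [i]))\<close> by (simp add: not_boundary_otri)
  qed simp
qed

text \<open>A point of the spoke of v inside child i is on the boundary of that child, so it can
  only be the outer end of the deeper spoke, namely corner d of the child. This is the centre of v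
  or corner d of v, and the latter is on spoke c only for d = c: its coordinate d is 1, whereas
  spoke c allows at most 1/3.\<close>

lemma spokes_meet_prefix:
  assumes "c \<in> letters" "d \<in> letters" "i \<in> letters" "w' \<in> lists letters"
    and "p \<in> spoke (wt v) c" "p \<in> spoke (wt (v @ i # w')) d"
  shows "p \<in> {centre (wt v), vtx (wt v) c}" "p = vtx (wt (v @ i # w')) d"
proof -
  have "p \<in> ctri (wt (v @ [i]))" using assms ctri_Cons[of w' v i] spoke_in_ctri by blast
  then have bd: "on_boundary (v @ [i]) p" using assms by (intro spoke_child_boundary)
  show "p = vtx (wt (v @ i # w')) d"
    using spoke_boundary(1)[of w' d p "v @ [i]"] bd assms by simp
  have "p = vtx (wt (v @ [i])) d"
    using spoke_boundary(2)[of w' d p "v @ [i]"] bd assms by simp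
  then have p: "p = (if d = i then centre (wt v) else vtx (wt v) d)" using assms by (simp add: vtx_child)
  show "p \<in> {centre (wt v), vtx (wt v) c}"
  proof (cases "d = i \<or> d = c")
    case False
    then have pd: "p = vtx (wt v) d" using p by simp
    obtain s where s: "0 \<le> s" "bary (wt v) d p = (1 - s) / 3"
      using bary_spoke[OF nondegenerate_wt assms(1) assms(5)] False assms(2) by metis
    then show ?thesis using pd assms by (simp add: bary_vtx)
  qed (use p in auto)
qed

lemma spokes_meet:
  assumes "v \<in> lists letters" "w \<in> lists letters" "c \<in> letters" "d \<in> letters"
    and "p \<in> spoke (wt v) c" "p \<in> spoke (wt w) d" "(v, c) \<noteq> (w, d)"
  shows "p \<in> {centre (wt v), vtx (wt v) c} \<inter> {centre (wt w), vtx (wt w) d}"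
  using assms(1,2)
proof (cases rule: word_cases)
  case eq
  then have cd: "c \<noteq> d" using assms by simp
  obtain s where s: "bary (wt v) c p = 1/3 + 2 * s / 3" "\<forall>j\<in>letters. j \<noteq> c \<longrightarrow> bary (wt v) j p = (1 - s) / 3" "0 \<le> s"
    using bary_spoke_ex[OF assms(3,5)] by blast
  obtain r where r: "bary (wt v) d p = 1/3 + 2 * r / 3" "\<forall>j\<in>letters. j \<noteq> d \<longrightarrow> bary (wt v) j p = (1 - r) / 3" "0 \<le> r"
    using bary_spoke_ex[OF assms(4,6)] eq by blast
  \<comment> \<open>Both descriptions of p, as a point of two distinct spokes of the same triangle,
    give - s = 2 r with s and r nonnegative.\<close>
  have "(1 - s) / 3 = 1/3 + 2 * r / 3" "(1 - r) / 3 = 1/3 + 2 * s / 3"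
    using s(1,2) r(1,2) cd assms(3,4) by metis+
  then have "s = 0" using s(3) r(3) by simp
  then have "bary (wt v) j p = 1/3" if "j \<in> letters" for j
    using s(1,2) that by (cases "j = c") auto
  then have "p = centre (wt v)"
    by (intro bary_inject[OF nondegenerate_wt[of v]]) (auto simp: bary_centre)
  then show ?thesis using eq by simp
next
  case (prefix i w')
  then show ?thesis using spokes_meet_prefix[OF assms(3,4) prefix(2,3), of p v] assms by simp
next
  case (suffix i v')
  then show ?thesis using spokes_meet_prefix[OF assms(4,3) suffix(2,3), of p w] assms by simp
next
  case (diverge q i j v' w')
  have "p \<in> ctri (wt (q @ [i]))" "p \<in> ctri (wt (q @ [j]))"
    using assms diverge spoke_in_ctri ctri_Cons by blast+
  then have "on_boundary (q @ [i]) p" "on_boundary (q @ [j]) p"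
    using diverge siblings_boundary[of i j p q] siblings_boundary[of j i p q] by auto
  then have "p = vtx (wt v) c" "p = vtx (wt w) d"
    using spoke_boundary(1)[of v' c p "q @ [i]"] spoke_boundary(1)[of w' d p "q @ [j]"] assms diverge by auto
  then show ?thesis by auto
qed

lemma centre_on_spoke:
  assumes "v \<in> lists letters" "w \<in> lists letters" "c \<in> letters" "centre (wt w) \<in> spoke (wt v) c"
  shows "w = v \<or> centre (wt w) = vtx (wt v) c"
proof -
  \<comment> \<open>The centre lies on all three spokes of w; choosing one of index d \<noteq> c
    makes \<open>spokes_meet\<close> applicable also when v = w.\<close>
  obtain d where d: "d \<in> letters" "d \<noteq> c" using third_letter by blast
  have "centre (wt w) \<in> {centre (wt v), vtx (wt v) c}"
    using spokes_meet[OF assms(1,2,3) d(1) assms(4)] d by auto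
  then show ?thesis using centre_inj assms by auto
qed

text \<open>A corner of w is on the boundary of its triangle, whereas the centre of p is interior to
  the triangle of every prefix of p; divergence is excluded by
  \<open>siblings_boundary\<close>.\<close>

lemma centre_corner_prefix:
  assumes "p \<in> lists letters" "w \<in> lists letters" "centre (wt p) \<in> corners (wt w)"
  obtains i w' where "w = p @ i # w'" "i \<in> letters" "w' \<in> lists letters"
proof -
  have bd: "on_boundary w (centre (wt p))" using assms corner_on_boundary by blast
  from assms(1,2) show ?thesis
  proof (cases rule: word_cases)
    case eq then show ?thesis using bd not_boundary_otri[OF centre_otri] by simp
  next
    case (prefix i w') then show ?thesis using that by blast
  next
    case (suffix i p')
    then have "centre (wt p) \<in> otri (wt w)" using otri_append[of "i # p'" w] centre_otri[of p] by auto
    then show ?thesis using bd not_boundary_otri by blast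
  next
    case (diverge q i j p' w')
    have "centre (wt p) \<in> otri (wt (q @ [i]))" using diverge otri_Cons centre_otri by blast
    moreover have "centre (wt p) \<in> ctri (wt (q @ [j]))" using diverge ctri_Cons bd on_boundary_def by blast
    ultimately show ?thesis using siblings_boundary[OF diverge(4,5,3)] otri_ctri not_boundary_otri by blast
  qed
qed

lemma corners_child: "i \<in> letters \<Longrightarrow> corners (wt (u @ [i])) = insert (centre (wt u)) (vtx (wt u) ` (letters - {i}))"
  unfolding corners_vtx by (force simp: vtx_child image_iff)

lemma corner_cases:
  assumes "u \<in> lists letters" "b \<in> corners (wt u)"
  shows "b \<in> corners root_triangle \<or> (\<exists>p i w. u = p @ i # w \<and> b = centre (wt p))"
  using assms
proof (induction u rule: rev_induct)
  case (snoc i u)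
  then have "i \<in> letters" "b \<in> corners (wt (u @ [i]))" by auto
  then have "b = centre (wt u) \<or> b \<in> corners (wt u)"
    unfolding corners_child[OF \<open>i \<in> letters\<close>] by (auto simp: corners_vtx)
  then show ?case
  proof
    assume "b = centre (wt u)"
    then have "u @ [i] = u @ i # [] \<and> b = centre (wt u)" by simp
    then show ?thesis by blast
  next
    assume "b \<in> corners (wt u)"
    with snoc consider "b \<in> corners root_triangle" | p j w where "u = p @ j # w" "b = centre (wt p)" by auto
    then show ?thesis
    proof cases
      case (2 p j w)
      then have "u @ [i] = p @ j # (w @ [i]) \<and> b = centre (wt p)" by simp
      then show ?thesis by blast
    qed simp
  qed
qed simp

lemma vtx_inj: "i \<in> letters \<Longrightarrow> j \<in> letters \<Longrightarrow> vtx (wt u) i = vtx (wt u) j \<Longrightarrow> i = j"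
  using bary_vtx[OF nondegenerate_wt[of u]] by (metis zero_neq_one)

lemma centre_neq_vtx: "c \<in> letters \<Longrightarrow> centre (wt u) \<noteq> vtx (wt u) c"
  using not_boundary_otri[OF centre_otri] corner_on_boundary vtx_in_corners by metis

text \<open>At corner i the coordinate i is 1 and the others are 0, so coordinate i is not
  least.\<close>

lemma vtx_not_in_own_child:
  assumes "i \<in> letters" "w \<in> lists letters" shows "vtx (wt u) i \<notin> ctri (wt (u @ i # w))"
proof
  assume "vtx (wt u) i \<in> ctri (wt (u @ i # w))"
  then have "vtx (wt u) i \<in> ctri (wt (u @ [i]))" using ctri_Cons assms by blast
  then have "bary (wt u) i (vtx (wt u) i) \<le> bary (wt u) j (vtx (wt u) i)" if "j \<in> letters" for j
    using that assms by (simp add: ctri_child_iff)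
  moreover obtain j where "j \<in> letters" "j \<noteq> i" using third_letter by blast
  ultimately show False using assms by (fastforce simp: bary_vtx)
qed

section \<open>Canonical drawings of ternary trees\<close>

lemma
  assumes "ternary_tree t"
  shows tree_root: "[] \<in> t" and tree_lists: "u \<in> t \<Longrightarrow> u \<in> lists letters"
    and tree_parent: "u @ [i] \<in> t \<Longrightarrow> u \<in> t"
    and tree_siblings: "i \<in> letters \<Longrightarrow> j \<in> letters \<Longrightarrow> u @ [i] \<in> t \<Longrightarrow> u @ [j] \<in> t"
  using assms unfolding ternary_tree_def letters_def[symmetric] by blast+

lemma tree_prefix: "ternary_tree t \<Longrightarrow> u @ w \<in> t \<Longrightarrow> u \<in> t"
proof (induction w rule: rev_induct)
  case (snoc i w)
  then show ?case using tree_parent[of t "u @ w" i] by simp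
qed simp

lemma internal_subset: "internal_nodes t \<subseteq> t"
  by (auto simp: internal_nodes_def)

lemma internal_lists: "ternary_tree t \<Longrightarrow> u \<in> internal_nodes t \<Longrightarrow> u \<in> lists letters"
  using internal_subset tree_lists by blast

lemma internal_iff: "ternary_tree t \<Longrightarrow> i \<in> letters \<Longrightarrow> u \<in> internal_nodes t \<longleftrightarrow> u @ [i] \<in> t"
  unfolding internal_nodes_def letters_def[symmetric] using tree_parent tree_siblings by blast

lemma internal_child: "u \<in> internal_nodes t \<Longrightarrow> i \<in> letters \<Longrightarrow> u @ [i] \<in> t"
  unfolding internal_nodes_def letters_def by blast

lemma internal_prefix:
  assumes "ternary_tree t" "u @ i # w \<in> t" shows "u \<in> internal_nodes t"
proof -
  have "u @ [i] \<in> t" using tree_prefix[of t "u @ [i]" w] assms by simp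
  moreover have "i \<in> letters" using tree_lists[OF assms] by simp
  ultimately show ?thesis using internal_iff assms by blast
qed

text \<open>The nodes are the root and the children of internal nodes.\<close>

lemma tree_eqI:
  assumes "ternary_tree t" "ternary_tree t'" "internal_nodes t = internal_nodes t'"
  shows "t = t'"
proof -
  have *: "u \<in> t \<longleftrightarrow> u = [] \<or> (\<exists>v i. u = v @ [i] \<and> i \<in> letters \<and> v \<in> internal_nodes t)" if "ternary_tree t" for t u
  proof (cases u rule: rev_cases)
    case (snoc v i)
    then show ?thesis using internal_iff[OF that] tree_lists[OF that, of u] by auto
  qed (simp add: tree_root[OF that])
  show ?thesis by (rule set_eqI) (simp only: *[OF assms(1)] *[OF assms(2)] assms(3))
qed

lemma verts_tree: "verts (tree_drawing t) = corners root_triangle \<union> (\<lambda>u. centre (wt u)) ` internal_nodes t"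
  and root_tree [simp]: "root (tree_drawing t) = linepath 0 1"
  and root_vertex_tree [simp]: "root_vertex (tree_drawing t) = 0"
  by (simp_all add: tree_drawing_def root_vertex_def)

lemma edges_tree: "edges (tree_drawing t) = sides root_triangle \<union> {spoke (wt v) c |v c. v \<in> internal_nodes t \<and> c \<in> letters}"
  by (auto simp: tree_drawing_def spoke_def corners_vtx)

lemma corners_in_verts: "ternary_tree t \<Longrightarrow> u \<in> t \<Longrightarrow> corners (wt u) \<subseteq> verts (tree_drawing t)"
  using corner_cases tree_lists internal_prefix unfolding verts_tree by blast

lemma root_corner_boundary: "b \<in> corners root_triangle \<Longrightarrow> on_boundary [] b"
  using corner_on_boundary[of b "[]"] by simp

lemma spoke_verts:
  assumes t: "ternary_tree t" and v: "v \<in> internal_nodes t" and c: "c \<in> letters"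
  shows "spoke (wt v) c \<inter> verts (tree_drawing t) = {centre (wt v), vtx (wt v) c}"
proof (intro equalityI subsetI)
  fix p assume p: "p \<in> spoke (wt v) c \<inter> verts (tree_drawing t)"
  have vl: "v \<in> lists letters" using internal_lists[OF t v] .
  from p consider "p \<in> corners root_triangle" | w where "w \<in> internal_nodes t" "p = centre (wt w)"
    unfolding verts_tree by blast
  then show "p \<in> {centre (wt v), vtx (wt v) c}"
  proof cases
    case 1
    then have "p = vtx (wt v) c" using spoke_boundary(1)[of v c p "[]"] vl c p root_corner_boundary by simp
    then show ?thesis by simp
  next
    case 2
    then show ?thesis using centre_on_spoke[OF vl internal_lists[OF t 2(1)] c] p by auto
  qed
next
  have "vtx (wt v) c \<in> verts (tree_drawing t)" "centre (wt v) \<in> verts (tree_drawing t)"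
    using corners_in_verts[OF t] internal_subset v c vtx_in_corners by (blast, simp add: verts_tree)
  then show "p \<in> spoke (wt v) c \<inter> verts (tree_drawing t)" if "p \<in> {centre (wt v), vtx (wt v) c}" for p
    using that by auto
qed

lemma root_side_cases:
  assumes "e \<in> sides root_triangle"
  obtains i j k where "{i, j, k} = letters" "i \<noteq> j" "k \<noteq> i" "k \<noteq> j"
    "e = closed_segment (vtx root_triangle i) (vtx root_triangle j)"
    "\<And>p. p \<in> e \<Longrightarrow> bary root_triangle k p = 0 \<and> on_boundary [] p"
proof -
  obtain i j k where *: "{i, j, k} = letters" "i \<noteq> j" "k \<noteq> i" "k \<noteq> j"
    "e = closed_segment (vtx root_triangle i) (vtx root_triangle j)"
    "\<forall>p\<in>e. bary root_triangle k p = 0 \<and> p \<in> ctri root_triangle"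
    using sides_cases[OF nondegenerate_root assms] by metis
  have "k \<in> letters" using *(1) by blast
  then have "on_boundary [] p" if "p \<in> e" for p using *(6) that by (auto simp: on_boundary_iff)
  then show thesis using that[OF *(1-5)] *(6) by blast
qed

lemma side_verts:
  assumes t: "ternary_tree t" and e: "e \<in> sides root_triangle"
  obtains i j where "i \<in> letters" "j \<in> letters" "i \<noteq> j"
    "e = closed_segment (vtx root_triangle i) (vtx root_triangle j)"
    "e \<inter> verts (tree_drawing t) = {vtx root_triangle i, vtx root_triangle j}"
proof -
  obtain i j k where *: "{i, j, k} = letters" "i \<noteq> j" "k \<noteq> i" "k \<noteq> j"
    "e = closed_segment (vtx root_triangle i) (vtx root_triangle j)"
    and bd: "\<And>p. p \<in> e \<Longrightarrow> bary root_triangle k p = 0 \<and> on_boundary [] p"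
    using root_side_cases[OF e] by metis
  have l: "i \<in> letters" "j \<in> letters" "k \<in> letters" using *(1) by blast+
  have "e \<inter> verts (tree_drawing t) = {vtx root_triangle i, vtx root_triangle j}"
  proof (intro equalityI subsetI)
    fix p assume p: "p \<in> e \<inter> verts (tree_drawing t)"
    have "p \<noteq> centre (wt w)" if "w \<in> internal_nodes t" for w
    proof
      assume "p = centre (wt w)"
      then have "p \<in> otri (wt [])" using otri_append[of w "[]"] internal_lists[OF t that] centre_otri[of w] by auto
      then show False using bd p not_boundary_otri by blast
    qed
    then have "p \<in> corners root_triangle" using p unfolding verts_tree by blast
    then obtain m where m: "m \<in> letters" "p = vtx root_triangle m" by (auto simp: corners_vtx)
    moreover have "m \<noteq> k" using bd[of p] p m l bary_vtx[OF nondegenerate_root] by auto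
    ultimately show "p \<in> {vtx root_triangle i, vtx root_triangle j}" using *(1) by auto
  next
    fix p assume "p \<in> {vtx root_triangle i, vtx root_triangle j}"
    then show "p \<in> e \<inter> verts (tree_drawing t)" using *(5) l unfolding verts_tree by auto
  qed
  then show thesis using that[OF l(1,2) *(2,5)] by blast
qed

text \<open>On each side the coordinate of the opposite corner vanishes; two different sides leave a
  single nonzero coordinate.\<close>

lemma sides_meet:
  assumes "e \<in> sides root_triangle" "e' \<in> sides root_triangle" "e \<noteq> e'" "p \<in> e" "p \<in> e'"
  shows "p \<in> corners root_triangle"
proof -
  obtain i j k where *: "{i, j, k} = letters" "i \<noteq> j" "k \<noteq> i" "k \<noteq> j"
    "e = closed_segment (vtx root_triangle i) (vtx root_triangle j)"
    and bd: "\<And>p. p \<in> e \<Longrightarrow> bary root_triangle k p = 0 \<and> on_boundary [] p"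
    using root_side_cases[OF assms(1)] by metis
  obtain i' j' k' where **: "{i', j', k'} = letters" "i' \<noteq> j'" "k' \<noteq> i'" "k' \<noteq> j'"
    "e' = closed_segment (vtx root_triangle i') (vtx root_triangle j')"
    and bd': "\<And>p. p \<in> e' \<Longrightarrow> bary root_triangle k' p = 0 \<and> on_boundary [] p"
    using root_side_cases[OF assms(2)] by metis
  have l: "k \<in> letters" "k' \<in> letters" using *(1) **(1) by blast+
  have "k \<noteq> k'"
  proof
    assume "k = k'"
    then have "{i, j} = {i', j'}" using *(1-4) **(1-4) by blast
    then have "e = e'" unfolding *(5) **(5) by (metis doubleton_eq_iff closed_segment_commute)
    then show False using assms by simp
  qed
  then obtain m where m: "m \<in> letters" "m \<noteq> k" "m \<noteq> k'" using third_letter by blast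
  have "p = vtx root_triangle m"
  proof (rule bary_zero_vtx[OF nondegenerate_root m(1)])
    fix n assume "n \<in> letters" "n \<noteq> m"
    then have "n = k \<or> n = k'" using m l \<open>k \<noteq> k'\<close> unfolding letters_def by auto
    then show "bary root_triangle n p = 0" using bd bd' assms by blast
  qed
  then show ?thesis using m by simp
qed

lemma edges_meet:
  assumes t: "ternary_tree t" and "e \<in> edges (tree_drawing t)" "e' \<in> edges (tree_drawing t)" "e \<noteq> e'"
  shows "e \<inter> e' \<subseteq> verts (tree_drawing t)"
proof
  fix p assume p: "p \<in> e \<inter> e'"
  have side_spoke: "p \<in> verts (tree_drawing t)"
    if "e \<in> sides root_triangle" "v \<in> internal_nodes t" "c \<in> letters" "p \<in> e" "p \<in> spoke (wt v) c" for e v c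
  proof -
    have "on_boundary [] p" using root_side_cases[OF that(1)] that(4) by metis
    then have "p = vtx root_triangle c"
      using spoke_boundary(2)[of v c p "[]"] internal_lists[OF t that(2)] that by simp
    then show ?thesis using that unfolding verts_tree by simp
  qed
  consider "e \<in> sides root_triangle" "e' \<in> sides root_triangle"
    | v c where "e \<in> sides root_triangle" "e' = spoke (wt v) c" "v \<in> internal_nodes t" "c \<in> letters"
    | v c where "e' \<in> sides root_triangle" "e = spoke (wt v) c" "v \<in> internal_nodes t" "c \<in> letters"
    | v c w d where "e = spoke (wt v) c" "v \<in> internal_nodes t" "c \<in> letters"
       "e' = spoke (wt w) d" "w \<in> internal_nodes t" "d \<in> letters"
    using assms(2,3) unfolding edges_tree by blast
  then show "p \<in> verts (tree_drawing t)"
  proof cases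
    case 1
    then show ?thesis using sides_meet assms(4) p unfolding verts_tree by blast
  next
    case (2 v c) then show ?thesis using side_spoke p by blast
  next
    case (3 v c) then show ?thesis using side_spoke p by blast
  next
    case (4 v c w d)
    then have "p \<in> {centre (wt v), vtx (wt v) c}"
      using spokes_meet[of v w c d p] internal_lists[OF t] p assms(4) by blast
    then show ?thesis using spoke_verts[OF t 4(2,3)] by blast
  qed
qed

lemma vtx_root_inj: "i \<in> letters \<Longrightarrow> j \<in> letters \<Longrightarrow> vtx root_triangle i = vtx root_triangle j \<Longrightarrow> i = j"
  using vtx_inj[of i j "[]"] by simp

lemma side_exists:
  assumes "i \<in> letters" "j \<in> letters" "i \<noteq> j"
  shows "closed_segment (vtx root_triangle i) (vtx root_triangle j) \<in> sides root_triangle"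
  using assms unfolding root_triangle_def
  by (elim letters_cases) (auto simp: closed_segment_commute)

text \<open>Each edge meets the vertex set exactly in its two ends, so the geometric relation
  \<open>adj\<close> becomes a combinatorial one: sides join corners of the root triangle, spokes
  join a centre to the corners around it.\<close>

lemma adj_tree_iff:
  assumes t: "ternary_tree t"
  shows "adj (tree_drawing t) x y \<longleftrightarrow> (x \<noteq> y \<and> x \<in> corners root_triangle \<and> y \<in> corners root_triangle)
     \<or> (\<exists>v\<in>internal_nodes t. x = centre (wt v) \<and> y \<in> corners (wt v) \<or> y = centre (wt v) \<and> x \<in> corners (wt v))"
    (is "?L \<longleftrightarrow> ?R")
proof
  assume ?L
  then obtain e where e: "e \<in> edges (tree_drawing t)" "e \<inter> verts (tree_drawing t) = {x, y}"
    unfolding adj_def by blast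
  from e(1) consider "e \<in> sides root_triangle" | v c where "e = spoke (wt v) c" "v \<in> internal_nodes t" "c \<in> letters"
    unfolding edges_tree by blast
  then show ?R
  proof cases
    case 1
    then obtain i j where "i \<in> letters" "j \<in> letters" "i \<noteq> j" "{x, y} = {vtx root_triangle i, vtx root_triangle j}"
      using side_verts[OF t 1] e(2) by metis
    then show ?thesis using vtx_root_inj[of i j] vtx_in_corners by (auto simp: doubleton_eq_iff)
  next
    case (2 v c)
    then have "{x, y} = {centre (wt v), vtx (wt v) c}" using spoke_verts[OF t] e(2) by simp
    then have "x = centre (wt v) \<and> y = vtx (wt v) c \<or> y = centre (wt v) \<and> x = vtx (wt v) c"
      unfolding doubleton_eq_iff by blast
    then show ?thesis using 2(2) vtx_in_corners[OF 2(3), of "wt v"] by metis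
  qed
next
  assume ?R
  then consider "x \<noteq> y" "x \<in> corners root_triangle" "y \<in> corners root_triangle"
    | v where "v \<in> internal_nodes t" "x = centre (wt v)" "y \<in> corners (wt v)"
    | v where "v \<in> internal_nodes t" "y = centre (wt v)" "x \<in> corners (wt v)" by blast
  then show ?L
  proof cases
    case 1
    then obtain i j where ij: "i \<in> letters" "j \<in> letters" "i \<noteq> j" "x = vtx root_triangle i" "y = vtx root_triangle j"
      by (auto simp: corners_vtx)
    let ?e = "closed_segment x y"
    have e: "?e \<in> sides root_triangle" using side_exists ij by simp
    obtain i' j' where *: "i' \<in> letters" "j' \<in> letters" "i' \<noteq> j'"
      "?e \<inter> verts (tree_drawing t) = {vtx root_triangle i', vtx root_triangle j'}"
      using side_verts[OF t e] by metis
    moreover have "{x, y} \<subseteq> ?e \<inter> verts (tree_drawing t)" using ij by (auto simp: verts_tree)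
    ultimately have "?e \<inter> verts (tree_drawing t) = {x, y}" using ij by auto
    then show ?thesis using e unfolding adj_def edges_tree by blast
  next
    case (2 v)
    then obtain c where "c \<in> letters" "y = vtx (wt v) c" by (auto simp: corners_vtx)
    then show ?thesis using 2 spoke_verts[OF t] unfolding adj_def edges_tree by blast
  next
    case (3 v)
    then obtain c where c: "c \<in> letters" "x = vtx (wt v) c" by (auto simp: corners_vtx)
    then have "spoke (wt v) c \<inter> verts (tree_drawing t) = {x, y}"
      using spoke_verts[OF t 3(1) c(1)] 3(2) by (simp add: insert_commute)
    moreover have "spoke (wt v) c \<in> edges (tree_drawing t)" using 3(1) c(1) unfolding edges_tree by blast
    ultimately show ?thesis unfolding adj_def by blast
  qed
qed

lemma adj_tree_sym: "ternary_tree t \<Longrightarrow> adj (tree_drawing t) x y \<Longrightarrow> adj (tree_drawing t) y x"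
  by (simp add: adj_def insert_commute)

text \<open>Induction on the length of u: a corner of its triangle (corner 1 is an arbitrary choice)
  is a root corner or the centre of a proper prefix.\<close>

lemma connected_to_root:
  assumes t: "ternary_tree t" and x: "x \<in> verts (tree_drawing t)"
  shows "(adj (tree_drawing t))\<^sup>*\<^sup>* x 0"
proof -
  have root: "(adj (tree_drawing t))\<^sup>*\<^sup>* b 0" if "b \<in> corners root_triangle" for b
  proof (cases "b = 0")
    case False
    then have "adj (tree_drawing t) b 0" unfolding adj_tree_iff[OF t] using that by (simp add: root_triangle_def)
    then show ?thesis by blast
  qed simp
  have "(adj (tree_drawing t))\<^sup>*\<^sup>* (centre (wt u)) 0" if "u \<in> internal_nodes t" for u
    using that
  proof (induction u rule: measure_induct_rule[of length])
    case (less u)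
    let ?b = "vtx (wt u) 1"
    have "adj (tree_drawing t) (centre (wt u)) ?b"
      unfolding adj_tree_iff[OF t] using less.prems vtx_in_corners[OF letters_mem(2), of "wt u"] by blast
    moreover have "(adj (tree_drawing t))\<^sup>*\<^sup>* ?b 0"
    proof -
      have "?b \<in> corners root_triangle \<or> (\<exists>p i w. u = p @ i # w \<and> ?b = centre (wt p))"
        using corner_cases[OF internal_lists[OF t less.prems]] by simp
      then show ?thesis
      proof
        assume "\<exists>p i w. u = p @ i # w \<and> ?b = centre (wt p)"
        then obtain p i w where p: "u = p @ i # w" "?b = centre (wt p)" by blast
        have "u \<in> t" using less.prems internal_subset by blast
        then have "p \<in> internal_nodes t" using internal_prefix[OF t] p by simp
        then show ?thesis using less.IH[of p] p by simp
      qed (rule root)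
    qed
    ultimately show ?case by (rule converse_rtranclp_into_rtranclp)
  qed
  then show ?thesis using x root unfolding verts_tree by blast
qed

section \<open>Position of the drawing relative to the root triangle\<close>

lemma drawing_subset: "ternary_tree t \<Longrightarrow> verts (tree_drawing t) \<union> \<Union>(edges (tree_drawing t)) \<subseteq> ctri root_triangle"
proof -
  assume t: "ternary_tree t"
  have sub: "ctri (wt u) \<subseteq> ctri root_triangle" if "u \<in> internal_nodes t" for u
    using ctri_append[of u "[]"] internal_lists[OF t that] by simp
  have "corners root_triangle \<subseteq> ctri root_triangle" using corners_subset_ctri nondegenerate_root by blast
  moreover have "centre (wt u) \<in> ctri root_triangle" if "u \<in> internal_nodes t" for u
    using sub[OF that] otri_ctri[OF centre_otri[of u]] by blast
  moreover have "e \<subseteq> ctri root_triangle" if "e \<in> sides root_triangle" for e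
    using root_side_cases[OF that] unfolding on_boundary_def wt_Nil by (metis subsetI)
  moreover have "spoke (wt u) c \<subseteq> ctri root_triangle" if "u \<in> internal_nodes t" "c \<in> letters" for u c
    using sub[OF that(1)] spoke_in_ctri that(2) by blast
  ultimately show ?thesis unfolding verts_tree edges_tree by blast
qed

lemma boundary_in_drawing: "on_boundary [] p \<Longrightarrow> p \<in> \<Union>(edges (tree_drawing t))"
  using frontier_covered_by_sides[OF nondegenerate_root] unfolding on_boundary_iff edges_tree by auto

text \<open>The complement of a bounded convex set in the plane is connected. It is a whole
  component because the frontier of the triangle is drawn: a larger connected set would be split by
  two disjoint open sets, the outside and the open triangle. Infinite trees are included.\<close>

lemma outer_face:
  assumes t: "ternary_tree t"
  shows "- ctri root_triangle \<in> faces (tree_drawing t)"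
  unfolding faces_def in_components_maximal
proof (intro conjI allI impI)
  let ?K = "ctri root_triangle" and ?S = "verts (tree_drawing t) \<union> \<Union>(edges (tree_drawing t))"
  have b: "bounded ?K" using compact_ctri[OF nondegenerate_root] compact_imp_bounded by blast
  then show "- ?K \<noteq> {}" using not_bounded_UNIV by (metis Compl_empty_eq double_complement)
  show "- ?K \<subseteq> - ?S" using drawing_subset[OF t] by blast
  show "connected (- ?K)"
    using connected_complement_bounded_convex[OF b convex_ctri[OF nondegenerate_root]] by simp
  fix d assume d: "d \<noteq> {} \<and> - ?K \<subseteq> d \<and> d \<subseteq> - ?S \<and> connected d"
  have o: "open (- ?K)" "open (otri root_triangle)"
    using compact_ctri[OF nondegenerate_root] compact_imp_closed open_otri by auto
  have "d \<subseteq> - ?K \<union> otri root_triangle"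
    using d boundary_in_drawing[of _ t] by (auto simp: on_boundary_def)
  moreover have "- ?K \<inter> otri root_triangle \<inter> d = {}" using otri_ctri by blast
  moreover have "- ?K \<inter> d \<noteq> {}" using d \<open>- ?K \<noteq> {}\<close> by blast
  ultimately have "otri root_triangle \<inter> d = {}"
    using d connectedD[OF _ o, of d] by blast
  then show "d = - ?K" using d \<open>d \<subseteq> - ?K \<union> otri root_triangle\<close> by blast
qed

text \<open>The third coordinate is a positive multiple of the imaginary part, since the opposite
  side is on the real axis. Hence the points below the root edge are in the outer face.\<close>

lemma Im_nonneg_ctri: "p \<in> ctri root_triangle \<Longrightarrow> 0 \<le> Im p"
proof -
  assume "p \<in> ctri root_triangle"
  then have "0 \<le> bary root_triangle 3 p" by (simp add: ctri_def)
  also have "bary root_triangle 3 p = Im p / Im (cis (pi / 3))"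
    by (simp add: root_triangle_def bary.simps area_def)
  finally show ?thesis by (simp add: sin_60 zero_le_divide_iff)
qed

section \<open>Orientation-preserving homeomorphisms and rooted maps\<close>

lemma oriented_homeoD:
  assumes "oriented_homeo h"
  obtains h' where "homeomorphism UNIV UNIV h h'"
  using assms unfolding oriented_homeo_def by blast

lemma homeomorphism_UNIV:
  assumes "homeomorphism UNIV UNIV h h'"
  shows "continuous_on A h" "continuous_on B h'" "h' (h x) = x" "h (h' y) = y" "inj h" "bij h"
proof -
  show *: "h' (h x) = x" "h (h' y) = y" for x y using assms by (auto simp: homeomorphism_def)
  show "continuous_on A h" "continuous_on B h'"
    using assms continuous_on_subset by (auto simp: homeomorphism_def)
  show "inj h" by (metis injI *(1))
  show "bij h" by (metis bijI' *)
qed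

lemma circlepath_eq: "circlepath z r = (\<lambda>t. z + of_real r * exp (2 * of_real pi * \<i> * of_real t))"
  by (auto simp: circlepath_def part_circlepath_def linepath_def mult_ac)

text \<open>The two circles are deformed into each other, the centre moving along.\<close>

lemma winding_number_circle_const:
  fixes h :: "complex \<Rightarrow> complex"
  assumes h: "continuous_on UNIV h" "inj h" and r: "0 < r" "0 < s"
  shows "winding_number (h \<circ> circlepath z r) (h z) = winding_number (h \<circ> circlepath w s) (h w)"
proof -
  define c where "c = (\<lambda>t. exp (2 * of_real pi * \<i> * of_real t) :: complex)"
  define Z where "Z = (\<lambda>a. z + of_real a * (w - z))"
  define R where "R = (\<lambda>a. r + a * (s - r))"
  define H where "H = (\<lambda>(a, t). h (Z a + of_real (R a) * c t) - h (Z a))"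
  have R: "0 < R a" if "a \<in> {0..1}" for a
  proof -
    have "0 < (1 - a) * r + a * s"
      using that r by (cases "a = 0") (auto intro!: add_nonneg_pos)
    then show ?thesis by (simp add: R_def algebra_simps)
  qed
  have "homotopic_loops (- {0}) (\<lambda>t. H (0, t)) (\<lambda>t. H (1, t))"
    unfolding homotopic_loops
  proof (intro exI[of _ H] conjI ballI)
    have "continuous_on UNIV (\<lambda>x::real\<times>real. h (Z (fst x) + of_real (R (fst x)) * c (snd x)) - h (Z (fst x)))"
      unfolding Z_def R_def c_def
      by (intro continuous_intros continuous_on_compose2[OF h(1)]) auto
    then show "continuous_on ({0..1} \<times> {0..1}) H"
      unfolding H_def case_prod_beta using continuous_on_subset by blast
    show "H \<in> {0..1} \<times> {0..1} \<rightarrow> - {0}"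
    proof
      fix x :: "real \<times> real" assume "x \<in> {0..1} \<times> {0..1}"
      then obtain a t where x: "x = (a, t)" "a \<in> {0..1}" by (cases x) auto
      have "of_real (R a) * c t \<noteq> 0" using R[OF x(2)] by (simp add: c_def)
      then have "h (Z a + of_real (R a) * c t) \<noteq> h (Z a)" using inj_eq[OF h(2)] by simp
      then show "H x \<in> - {0}" by (simp add: H_def x)
    qed
    show "pathfinish (H \<circ> Pair a) = pathstart (H \<circ> Pair a)" for a
      by (simp add: H_def pathfinish_def pathstart_def c_def)
  qed auto
  then have "winding_number (\<lambda>t. H (0, t)) 0 = winding_number (\<lambda>t. H (1, t)) 0"
    by (rule winding_number_homotopic_loops)
  moreover have "winding_number (\<lambda>t. H (0, t)) 0 = winding_number (h \<circ> circlepath z r) (h z)"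
    by (subst (2) winding_number_offset) (simp add: H_def Z_def R_def circlepath_eq c_def o_def)
  moreover have "winding_number (\<lambda>t. H (1, t)) 0 = winding_number (h \<circ> circlepath w s) (h w)"
    by (subst (2) winding_number_offset) (simp add: H_def Z_def R_def circlepath_eq c_def o_def)
  ultimately show ?thesis by simp
qed

text \<open>The winding number is the same for all circles, so a single circle decides the
  orientation.\<close>

lemma oriented_homeoI:
  assumes "homeomorphism UNIV UNIV h h'" "0 < r" "winding_number (h \<circ> circlepath z r) (h z) = 1"
  shows "oriented_homeo h"
  unfolding oriented_homeo_def
  using assms winding_number_circle_const[of h r] homeomorphism_UNIV(1,5)[OF assms(1)] by metis

lemma oriented_homeo_id: "oriented_homeo id"
proof (rule oriented_homeoI[of _ id 1 0])
  show "homeomorphism UNIV UNIV (id :: complex \<Rightarrow> complex) id"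
    using homeomorphism_ident by (simp add: id_def)
qed (auto simp: winding_number_circlepath)

lemma loop_avoid:
  assumes "homeomorphism UNIV UNIV h h'" "path p" "z \<notin> path_image p"
  shows "path (h \<circ> p)" "h z \<notin> path_image (h \<circ> p)"
  using assms(2,3) homeomorphism_UNIV(1)[OF assms(1)] inj_eq[OF homeomorphism_UNIV(5)[OF assms(1)]]
  by (auto simp: path_image_compose intro!: path_continuous_image)

text \<open>Loops of equal winding number around z are homotopic in the plane without z, and h
  carries the homotopy to the plane without \<open>h z\<close>.\<close>

lemma winding_number_homeo_eq:
  assumes h: "homeomorphism UNIV UNIV h h'" and pq: "path p" "path q" "z \<notin> path_image p" "z \<notin> path_image q"
    "pathfinish p = pathstart p" "pathfinish q = pathstart q"
    and eq: "winding_number p z = winding_number q z"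
  shows "winding_number (h \<circ> p) (h z) = winding_number (h \<circ> q) (h z)"
proof (rule winding_number_homotopic_loops)
  have "homotopic_loops (- {z}) p q"
    using winding_number_homotopic_loops_eq[OF pq(1,3,2,4,5,6)] eq by simp
  then show "homotopic_loops (- {h z}) (h \<circ> p) (h \<circ> q)"
    by (rule homotopic_loops_continuous_image) (auto simp: homeomorphism_UNIV(1)[OF h] inj_eq[OF homeomorphism_UNIV(5)[OF h]])
qed

text \<open>The image under h of a circle around 0 winds once around \<open>h 0\<close>, like a
  circle centred there; g may therefore be tested on the latter.\<close>

lemma oriented_homeo_comp:
  assumes "oriented_homeo h" "oriented_homeo g"
  shows "oriented_homeo (g \<circ> h)"
proof -
  obtain h' g' where h: "homeomorphism UNIV UNIV h h'" and g: "homeomorphism UNIV UNIV g g'"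
    using assms oriented_homeoD by metis
  have "winding_number (g \<circ> (h \<circ> circlepath 0 1)) (g (h 0)) = winding_number (g \<circ> circlepath (h 0) 1) (g (h 0))"
  proof (rule winding_number_homeo_eq[OF g])
    show "path (h \<circ> circlepath 0 1)" "h 0 \<notin> path_image (h \<circ> circlepath 0 1)"
      using loop_avoid[OF h, of "circlepath 0 1" 0] by (auto simp: path_image_circlepath)
    show "winding_number (h \<circ> circlepath 0 1) (h 0) = winding_number (circlepath (h 0) 1) (h 0)"
      using assms(1) by (simp add: oriented_homeo_def winding_number_circlepath)
  qed (auto simp: path_image_circlepath pathstart_compose pathfinish_compose)
  also have "\<dots> = 1" using assms(2) by (simp add: oriented_homeo_def)
  finally show ?thesis
    by (intro oriented_homeoI[OF homeomorphism_compose[OF h g], of 1 0]) (auto simp: o_assoc)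
qed

text \<open>The same comparison for h': a circle around \<open>h 0\<close> is exchanged for the
  image under h of a circle around 0, which h' takes back to that circle.\<close>

lemma oriented_homeo_inverse:
  assumes "oriented_homeo h" "homeomorphism UNIV UNIV h h'"
  shows "oriented_homeo h'"
proof -
  note h = assms(2)
  have h': "homeomorphism UNIV UNIV h' h" using h homeomorphism_symD by blast
  have *: "h' (h x) = x" for x using homeomorphism_UNIV(3)[OF h] by simp
  have "winding_number (h' \<circ> circlepath (h 0) 1) (h' (h 0)) = winding_number (h' \<circ> (h \<circ> circlepath 0 1)) (h' (h 0))"
  proof (rule winding_number_homeo_eq[OF h'])
    show "path (h \<circ> circlepath 0 1)" "h 0 \<notin> path_image (h \<circ> circlepath 0 1)"
      using loop_avoid[OF h, of "circlepath 0 1" 0] by (auto simp: path_image_circlepath)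
    show "winding_number (circlepath (h 0) 1) (h 0) = winding_number (h \<circ> circlepath 0 1) (h 0)"
      using assms(1) by (simp add: oriented_homeo_def winding_number_circlepath)
  qed (auto simp: path_image_circlepath pathstart_compose pathfinish_compose)
  also have "h' \<circ> (h \<circ> circlepath 0 1) = circlepath 0 1" by (auto simp: *)
  finally have "winding_number (h' \<circ> circlepath (h 0) 1) (h' (h 0)) = 1"
    by (simp add: * winding_number_circlepath del: o_apply)
  then show ?thesis
    by (intro oriented_homeoI[OF h', of 1 "h 0"]) auto
qed

text \<open>The clause of \<open>same_map\<close> on root edges, isolated so that inverses and
  compositions reduce to those of the changes of parameter.\<close>

definition same_orientation :: "(complex \<Rightarrow> complex) \<Rightarrow> (real \<Rightarrow> complex) \<Rightarrow> (real \<Rightarrow> complex) \<Rightarrow> bool" where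
  "same_orientation h p q \<longleftrightarrow> (\<exists>\<phi> \<phi>'. homeomorphism {0..1} {0..1} \<phi> \<phi>' \<and> \<phi> 0 = 0 \<and> \<phi> 1 = (1::real)
            \<and> (\<forall>s\<in>{0..1}. h (p s) = q (\<phi> s)))"

lemma same_orientation_id: "same_orientation id p p"
  unfolding same_orientation_def
proof (intro exI conjI)
  show "homeomorphism {0..1::real} {0..1} (\<lambda>x. x) (\<lambda>x. x)" by (rule homeomorphism_ident)
qed auto

lemma same_orientation_inverse:
  assumes "same_orientation h p q" and inv: "\<And>x. h' (h x) = x"
  shows "same_orientation h' q p"
proof -
  obtain \<phi> \<phi>' where \<phi>: "homeomorphism {0..1} {0..1} \<phi> \<phi>'" "\<phi> 0 = 0" "\<phi> 1 = (1::real)"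
      "\<forall>s\<in>{0..1}. h (p s) = q (\<phi> s)" using assms(1) unfolding same_orientation_def by blast
  have "\<phi>' 0 = 0" "\<phi>' 1 = 1"
    using homeomorphism_apply1[OF \<phi>(1), of 0] homeomorphism_apply1[OF \<phi>(1), of 1] \<phi>(2,3) by auto
  moreover have "h' (q s) = p (\<phi>' s)" if "s \<in> {0..1}" for s
  proof -
    have "\<phi>' s \<in> {0..1}" "\<phi> (\<phi>' s) = s" using \<phi>(1) that by (auto simp: homeomorphism_def)
    then show ?thesis using \<phi>(4) inv by metis
  qed
  ultimately show ?thesis unfolding same_orientation_def
    using homeomorphism_symD[OF \<phi>(1)] by blast
qed

lemma same_orientation_comp:
  assumes "same_orientation h p q" "same_orientation g q r"
  shows "same_orientation (g \<circ> h) p r"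
proof -
  obtain \<phi> \<phi>' where \<phi>: "homeomorphism {0..1} {0..1} \<phi> \<phi>'" "\<phi> 0 = 0" "\<phi> 1 = (1::real)"
      "\<forall>s\<in>{0..1}. h (p s) = q (\<phi> s)" using assms(1) unfolding same_orientation_def by blast
  obtain \<psi> \<psi>' where \<psi>: "homeomorphism {0..1} {0..1} \<psi> \<psi>'" "\<psi> 0 = 0" "\<psi> 1 = (1::real)"
      "\<forall>s\<in>{0..1}. g (q s) = r (\<psi> s)" using assms(2) unfolding same_orientation_def by blast
  have "(g \<circ> h) (p s) = r ((\<psi> \<circ> \<phi>) s)" if "s \<in> {0..1}" for s
  proof -
    have "\<phi> s \<in> {0..1}" using \<phi>(1) that by (auto simp: homeomorphism_def)
    then show ?thesis using \<phi>(4) \<psi>(4) that by simp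
  qed
  then show ?thesis unfolding same_orientation_def
    using homeomorphism_compose[OF \<phi>(1) \<psi>(1)] \<phi>(2,3) \<psi>(2,3)
    by (intro exI[of _ "\<psi> \<circ> \<phi>"] exI[of _ "\<phi>' \<circ> \<psi>'"]) simp
qed

text \<open>\<open>same_map\<close> with its homeomorphism as an argument, since later proofs follow
  individual points under it.\<close>

definition map_iso :: "(complex \<Rightarrow> complex) \<Rightarrow> drawing \<Rightarrow> drawing \<Rightarrow> bool" where
  "map_iso h D D' \<longleftrightarrow> oriented_homeo h
     \<and> h ` verts D = verts D' \<and> (\<lambda>e. h ` e) ` edges D = edges D'
     \<and> h (root_vertex D) = root_vertex D'
     \<and> (path_image (root D) \<in> edges D \<longleftrightarrow> path_image (root D') \<in> edges D')
     \<and> (path_image (root D) \<in> edges D \<longrightarrow> same_orientation h (root D) (root D'))"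

lemma same_map_iff: "same_map D D' \<longleftrightarrow> (\<exists>h. map_iso h D D')"
  unfolding same_map_def map_iso_def same_orientation_def ..

lemma map_iso_id: "map_iso id D D"
  by (simp add: map_iso_def oriented_homeo_id same_orientation_id)

lemma map_iso_inverse:
  assumes "map_iso h D D'" "homeomorphism UNIV UNIV h h'"
  shows "map_iso h' D' D"
proof -
  note h' = assms(2)
  have inv: "h' (h x) = x" for x using homeomorphism_UNIV(3)[OF h'] by simp
  note h = assms(1)[unfolded map_iso_def]
  have "oriented_homeo h'" using oriented_homeo_inverse[OF _ h'] h by simp
  moreover have "h' ` verts D' = verts D"
    using h by (simp add: image_image inv flip: h[THEN conjunct2, THEN conjunct1])
  moreover have "(\<lambda>e. h' ` e) ` edges D' = edges D"
    by (simp add: image_image inv flip: h[THEN conjunct2, THEN conjunct2, THEN conjunct1])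
  moreover have "h' (root_vertex D') = root_vertex D"
    using h inv by metis
  ultimately show ?thesis using h same_orientation_inverse[of h "root D" "root D'" h'] inv
    by (simp add: map_iso_def)
qed

lemma map_iso_comp:
  assumes "map_iso h D1 D2" "map_iso g D2 D3"
  shows "map_iso (g \<circ> h) D1 D3"
proof -
  note h = assms(1)[unfolded map_iso_def] and g = assms(2)[unfolded map_iso_def]
  have "oriented_homeo (g \<circ> h)" using h g oriented_homeo_comp by simp
  moreover have "(g \<circ> h) ` verts D1 = verts D3"
    using h g by (metis image_comp)
  moreover have "(\<lambda>e. (g \<circ> h) ` e) ` edges D1 = edges D3"
    by (simp add: image_image flip: h[THEN conjunct2, THEN conjunct2, THEN conjunct1] g[THEN conjunct2, THEN conjunct2, THEN conjunct1])
  ultimately show ?thesis using h g same_orientation_comp[of h "root D1" "root D2" g "root D3"]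
    by (simp add: map_iso_def)
qed

lemma same_map_refl: "same_map D D"
  using map_iso_id same_map_iff by blast

lemma same_map_sym: "same_map D D' \<Longrightarrow> same_map D' D"
  using map_iso_inverse oriented_homeoD unfolding same_map_iff map_iso_def by metis

lemma same_map_trans: "same_map D1 D2 \<Longrightarrow> same_map D2 D3 \<Longrightarrow> same_map D1 D3"
  using map_iso_comp unfolding same_map_iff by blast

lemma map_of_drawing_eq_iff: "map_of_drawing D = map_of_drawing D' \<longleftrightarrow> same_map D D'"
  unfolding map_of_drawing_def using same_map_refl same_map_sym same_map_trans by blast

lemma mem_map_of_drawing: "D \<in> map_of_drawing D"
  by (simp add: map_of_drawing_def same_map_refl)

section \<open>Local finiteness\<close>

text \<open>Each internal node with b among its corners contributes one edge at b. The other edges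
  at b are three spokes if b is a centre, or sides of the root triangle, so this says that all
  degrees are finite.\<close>

definition finite_degrees :: "word set \<Rightarrow> bool" where
  "finite_degrees t \<longleftrightarrow> (\<forall>b. finite {v \<in> internal_nodes t. b \<in> corners (wt v)})"

text \<open>Deep in the tree, a point of an edge lies on the boundary of all triangles containing it; by
  the persistence of its coordinates these triangles have a common corner, whose degree bounds
  their number.\<close>

lemma edge_boundary_deep:
  assumes t: "ternary_tree t" and e: "e \<in> edges (tree_drawing t)" and q: "q \<in> e"
  obtains N where "\<And>w. w \<in> lists letters \<Longrightarrow> N \<le> length w \<Longrightarrow> q \<in> ctri (wt w) \<Longrightarrow> on_boundary w q"
proof -
  from e consider "e \<in> sides root_triangle" | v c where "e = spoke (wt v) c" "v \<in> internal_nodes t" "c \<in> letters"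
    unfolding edges_tree by blast
  then show thesis
  proof cases
    case 1
    then have "on_boundary [] q" using root_side_cases[OF 1] q by metis
    then show thesis using boundary_persists(1)[of "[]" q] by (intro that[of 0]) simp
  next
    case (2 v c)
    have vl: "v \<in> lists letters" using internal_lists[OF t 2(2)] .
    show thesis
    proof (rule that)
      fix w assume w: "w \<in> lists letters" "Suc (length v) \<le> length w" "q \<in> ctri (wt w)"
      from vl w(1) show "on_boundary w q"
      proof (cases rule: word_cases)
        case eq then show ?thesis using w(2) by simp
      next
        case (prefix i w')
        then have "q \<in> ctri (wt (v @ [i]))" using w(3) ctri_Cons by blast
        then have "on_boundary (v @ [i]) q" using spoke_child_boundary[of c q v i] 2 q prefix by simp
        then show ?thesis using boundary_persists(1)[of "v @ [i]" q w'] prefix w(3) by simp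
      next
        case (suffix i v') then show ?thesis using w(2) by simp
      next
        case (diverge p i j v' w')
        have "q \<in> ctri (wt (p @ [j]))" using diverge w(3) ctri_Cons by blast
        moreover have "q \<in> ctri (wt (p @ [i]))"
          using diverge ctri_Cons[of v' p i] spoke_in_ctri[OF 2(3), of q v] 2(1) q by blast
        ultimately have "on_boundary (p @ [j]) q" using siblings_boundary[of j i q p] diverge by simp
        then show ?thesis using boundary_persists(1)[of "p @ [j]" q w'] diverge w(3) by simp
      qed
    qed
  qed
qed

lemma finite_words: "finite {w. w \<in> lists letters \<and> length w \<le> n}"
proof -
  have "{w. w \<in> lists letters \<and> length w \<le> n} = {w. set w \<subseteq> letters \<and> length w \<le> n}" by auto
  then show ?thesis by (simp add: finite_lists_length_le)
qed

lemma finite_triangles_at_point: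
  assumes t: "ternary_tree t" and f: "finite_degrees t" and e: "e \<in> edges (tree_drawing t)" and q: "q \<in> e"
  shows "finite {w \<in> internal_nodes t. q \<in> ctri (wt w)}"
proof -
  obtain N where N: "\<And>w. w \<in> lists letters \<Longrightarrow> N \<le> length w \<Longrightarrow> q \<in> ctri (wt w) \<Longrightarrow> on_boundary w q"
    using edge_boundary_deep[OF t e q] by metis
  have "\<exists>b. \<forall>x\<in>lists letters. q \<in> ctri (wt (w @ x)) \<longrightarrow> b \<in> corners (wt (w @ x))" if w: "w \<in> lists letters" "length w = N" for w
  proof (cases "q \<in> ctri (wt w)")
    case True
    then have bd: "on_boundary w q" using N w by simp
    \<comment> \<open>The coordinates sum to 1, so one of them is nonzero; its corner persists in
      all smaller triangles containing q.\<close>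
    obtain j where j: "j \<in> letters" "bary (wt w) j q \<noteq> 0"
    proof (rule ccontr)
      assume "\<not> thesis"
      then have "bary (wt w) j q = 0" if "j \<in> letters" for j using \<open>\<And>j. j \<in> letters \<Longrightarrow> bary (wt w) j q \<noteq> 0 \<Longrightarrow> thesis\<close> that by blast
      then show False using bary_sum[OF nondegenerate_wt[of w], of q] by simp
    qed
    have "vtx (wt w) j \<in> corners (wt (w @ x))" if "x \<in> lists letters" "q \<in> ctri (wt (w @ x))" for x
      using boundary_persists(3)[OF bd that j] vtx_in_corners[OF j(1), of "wt (w @ x)"] by simp
    then show ?thesis by blast
  next
    case False
    then show ?thesis using ctri_append by blast
  qed
  then obtain b where b: "\<And>w x. w \<in> lists letters \<Longrightarrow> length w = N \<Longrightarrow> x \<in> lists letters \<Longrightarrow>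
      q \<in> ctri (wt (w @ x)) \<Longrightarrow> b w \<in> corners (wt (w @ x))" by metis
  have "{w \<in> internal_nodes t. q \<in> ctri (wt w)} \<subseteq> {w. w \<in> lists letters \<and> length w \<le> N} \<union>
     (\<Union>w0\<in>{w. w \<in> lists letters \<and> length w \<le> N}. {v \<in> internal_nodes t. b w0 \<in> corners (wt v)})"
  proof
    fix w assume w: "w \<in> {w \<in> internal_nodes t. q \<in> ctri (wt w)}"
    then have l: "w \<in> lists letters" using internal_lists[OF t] by blast
    show "w \<in> {w. w \<in> lists letters \<and> length w \<le> N} \<union>
     (\<Union>w0\<in>{w. w \<in> lists letters \<and> length w \<le> N}. {v \<in> internal_nodes t. b w0 \<in> corners (wt v)})"
    proof (cases "length w \<le> N")
      case False
      have td: "take N w \<in> lists letters" "drop N w \<in> lists letters"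
        using l by (auto dest: in_set_takeD in_set_dropD)
      then have "b (take N w) \<in> corners (wt w)" using b[of "take N w" "drop N w"] False w by simp
      then show ?thesis using w td by (intro UnI2 UN_I[of "take N w"]) auto
    qed (use l in simp)
  qed
  then show ?thesis
    by (rule finite_subset) (use f finite_words in \<open>auto simp: finite_degrees_def\<close>)
qed

lemma drawing_point_on_edge:
  assumes "p \<in> verts (tree_drawing t) \<union> \<Union>(edges (tree_drawing t))"
  shows "p \<in> \<Union>(edges (tree_drawing t))"
proof -
  have "p \<in> \<Union>(edges (tree_drawing t))" if "p \<in> corners root_triangle"
    using root_corner_boundary[OF that] boundary_in_drawing by blast
  moreover have "centre (wt u) \<in> \<Union>(edges (tree_drawing t))" if "u \<in> internal_nodes t" for u
    using that letters_mem(2) centre_spoke[of u 1] unfolding edges_tree by blast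
  ultimately show ?thesis using assms unfolding verts_tree by blast
qed

lemma finite_sides: "finite (sides T)"
  by (cases T) simp

text \<open>Only finitely many internal nodes have p in their triangle, so p avoids the finitely
  many closed triangles at some height. Their complement is the neighbourhood: all edges created
  from that height on lie inside those triangles.\<close>

lemma drawing_locally_finite:
  assumes t: "ternary_tree t" and f: "finite_degrees t" and p: "p \<in> verts (tree_drawing t) \<union> \<Union>(edges (tree_drawing t))"
  shows "\<exists>U. open U \<and> p \<in> U \<and> finite {e \<in> edges (tree_drawing t). e \<inter> U \<noteq> {}}"
proof -
  obtain e where e: "e \<in> edges (tree_drawing t)" "p \<in> e" using drawing_point_on_edge[OF p] by blast
  let ?W = "{w \<in> internal_nodes t. p \<in> ctri (wt w)}"
  have "finite (length ` ?W)" using finite_triangles_at_point[OF t f e] by simp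
  then obtain h where h: "\<And>w. w \<in> ?W \<Longrightarrow> length w < h"
    by (auto simp: finite_nat_set_iff_bounded)
  \<comment> \<open>One level below the bound: a node of length \<open>Suc h\<close> has an internal
    parent of length h, whose triangle cannot contain p because h exceeds all lengths in
    \<open>?W\<close>.\<close>
  define L where "L = {w \<in> t. length w = Suc h}"
  have "L \<subseteq> {w. w \<in> lists letters \<and> length w \<le> Suc h}" using tree_lists[OF t] by (auto simp: L_def)
  then have "finite L" using finite_words finite_subset by blast
  define U where "U = - (\<Union>w\<in>L. ctri (wt w))"
  have "open U" unfolding U_def using \<open>finite L\<close>
    by (auto intro!: closed_UN simp: open_closed compact_ctri compact_imp_closed)
  moreover have "p \<in> U"
  proof (rule ccontr)
    assume "p \<notin> U"
    then obtain w where w: "w \<in> t" "length w = Suc h" "p \<in> ctri (wt w)" by (auto simp: U_def L_def)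
    then obtain v i where vi: "w = v @ [i]" by (cases w rule: rev_cases) auto
    have i: "i \<in> letters" using tree_lists[OF t w(1)] vi by simp
    then have "v \<in> ?W" using internal_iff[OF t i, of v] w vi ctri_child_iff[OF i, of p v] by simp
    then show False using h w vi by force
  qed
  moreover have "{e \<in> edges (tree_drawing t). e \<inter> U \<noteq> {}} \<subseteq> sides root_triangle \<union>
     (\<lambda>(v, c). spoke (wt v) c) ` ({w. w \<in> lists letters \<and> length w \<le> h} \<times> letters)"
  proof
    fix e assume e: "e \<in> {e \<in> edges (tree_drawing t). e \<inter> U \<noteq> {}}"
    then consider "e \<in> sides root_triangle" | v c where "e = spoke (wt v) c" "v \<in> internal_nodes t" "c \<in> letters"
      unfolding edges_tree by blast
    then show "e \<in> sides root_triangle \<union> (\<lambda>(v, c). spoke (wt v) c) ` ({w. w \<in> lists letters \<and> length w \<le> h} \<times> letters)"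
    proof cases
      case (2 v c)
      have vl: "v \<in> lists letters" using internal_lists[OF t 2(2)] .
      have "length v \<le> h"
      proof (rule ccontr)
        assume "\<not> length v \<le> h"
        then have *: "length (take (Suc h) v) = Suc h" by simp
        have "take (Suc h) v \<in> t"
          using tree_prefix[OF t, of "take (Suc h) v" "drop (Suc h) v"] 2(2) internal_subset by auto
        with * have "take (Suc h) v \<in> L" by (simp add: L_def)
        moreover have "e \<subseteq> ctri (wt (take (Suc h) v))"
        proof -
          have "drop (Suc h) v \<in> lists letters" using vl by (auto dest: in_set_dropD)
          then have "ctri (wt v) \<subseteq> ctri (wt (take (Suc h) v))"
            using ctri_append[of "drop (Suc h) v" "take (Suc h) v"] by simp
          then show ?thesis using spoke_in_ctri[OF 2(3)] 2(1) by blast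
        qed
        ultimately show False using e unfolding U_def by blast
      qed
      then have "(v, c) \<in> {w. w \<in> lists letters \<and> length w \<le> h} \<times> letters" using vl 2 by simp
      then show ?thesis using 2(1) by force
    qed simp
  qed
  then have "finite {e \<in> edges (tree_drawing t). e \<inter> U \<noteq> {}}"
    by (rule finite_subset) (intro finite_UnI finite_sides finite_imageI finite_cartesian_product finite_words finite_letters)
  ultimately show ?thesis by blast
qed

lemma edge_simple_path:
  assumes t: "ternary_tree t" and e: "e \<in> edges (tree_drawing t)"
  shows "\<exists>g. simple_path g \<and> path_image g = e \<and> e \<inter> verts (tree_drawing t) = {pathstart g, pathfinish g}"
proof -
  from e consider "e \<in> sides root_triangle" | v c where "e = spoke (wt v) c" "v \<in> internal_nodes t" "c \<in> letters"
    unfolding edges_tree by blast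
  then show ?thesis
  proof cases
    case 1
    obtain i j where ij: "i \<in> letters" "j \<in> letters" "i \<noteq> j"
      "e = closed_segment (vtx root_triangle i) (vtx root_triangle j)"
      "e \<inter> verts (tree_drawing t) = {vtx root_triangle i, vtx root_triangle j}"
      using side_verts[OF t 1] by metis
    then have "vtx root_triangle i \<noteq> vtx root_triangle j" using vtx_root_inj by blast
    then show ?thesis using ij(4,5)
      by (intro exI[of _ "linepath (vtx root_triangle i) (vtx root_triangle j)"]) (simp add: simple_path_linepath)
  next
    case (2 v c)
    have "centre (wt v) \<noteq> vtx (wt v) c" using centre_neq_vtx[OF 2(3)] .
    then show ?thesis using spoke_verts[OF t 2(2,3)] 2(1)
      by (intro exI[of _ "linepath (centre (wt v)) (vtx (wt v) c)"]) (simp add: spoke_def simple_path_linepath)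
  qed
qed

lemma root_edge: "path_image (root (tree_drawing t)) \<in> edges (tree_drawing t)"
  by (simp add: edges_tree root_triangle_def)

lemma root_verts:
  assumes "ternary_tree t"
  shows "path_image (root (tree_drawing t)) \<inter> verts (tree_drawing t) =
     {pathstart (root (tree_drawing t)), pathfinish (root (tree_drawing t))}"
proof -
  have s: "closed_segment 0 1 \<in> sides root_triangle" by (simp add: root_triangle_def)
  obtain i j where ij: "i \<in> letters" "j \<in> letters"
      "closed_segment 0 1 \<inter> verts (tree_drawing t) = {vtx root_triangle i, vtx root_triangle j}"
    using side_verts[OF assms s] by metis
  have "{0, 1} \<subseteq> closed_segment 0 1 \<inter> verts (tree_drawing t)"
    by (auto simp: verts_tree root_triangle_def)
  then have "{0, 1} = {vtx root_triangle i, vtx root_triangle j}"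
    unfolding ij by (metis doubleton_eq_iff insert_subset singleton_insert_inj_eq' zero_neq_one insertE singletonD)
  then show ?thesis using ij by simp
qed

lemma tree_infinite_face_on_right:
  assumes "ternary_tree t" shows "infinite_face_on_right (tree_drawing t)"
  unfolding infinite_face_on_right_def
proof (intro exI conjI)
  show "oriented_homeo id" by (rule oriented_homeo_id)
  show "- ctri root_triangle \<in> faces (tree_drawing t)" using outer_face[OF assms] .
  show "\<not> bounded (- ctri root_triangle)"
    using compact_ctri[OF nondegenerate_root] compact_imp_bounded cobounded_imp_unbounded by blast
  show "(0::real) < 1" by simp
  show "\<forall>s\<in>{0<..<1}. Complex (1/2) (- s) \<in> id ` (- ctri root_triangle)"
    using Im_nonneg_ctri by force
  show "\<forall>s\<in>{1/3..2/3}. id (root (tree_drawing t) s) = complex_of_real s"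
    by (simp add: linepath_def scaleR_conv_of_real)
qed

text \<open>Distinct internal nodes with corner b have distinct spokes ending in b, and all of these
  meet every neighbourhood of b.\<close>

lemma locally_finite_finite_degrees:
  assumes t: "ternary_tree t" and l: "locally_finite_map (tree_drawing t)"
  shows "finite_degrees t"
  unfolding finite_degrees_def
proof
  fix b
  let ?S = "{v \<in> internal_nodes t. b \<in> corners (wt v)}"
  show "finite ?S"
  proof (cases "b \<in> verts (tree_drawing t)")
    case False
    then have "?S = {}" using corners_in_verts[OF t] internal_subset by blast
    then show ?thesis by (simp only: finite.emptyI)
  next
    case True
    then obtain U where U: "b \<in> U" "finite {e \<in> edges (tree_drawing t). e \<inter> U \<noteq> {}}"
      using l[unfolded locally_finite_map_def, THEN conjunct2, THEN conjunct2, THEN conjunct1, rule_format, of b]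
      by blast
    have "\<forall>v\<in>?S. \<exists>c. c \<in> letters \<and> b = vtx (wt v) c" by (auto simp: corners_vtx)
    then obtain c where c: "\<And>v. v \<in> ?S \<Longrightarrow> c v \<in> letters \<and> b = vtx (wt v) (c v)" by metis
    have "inj_on (\<lambda>v. spoke (wt v) (c v)) ?S"
    proof (rule inj_onI)
      fix v w assume vw: "v \<in> ?S" "w \<in> ?S" "spoke (wt v) (c v) = spoke (wt w) (c w)"
      have l: "v \<in> lists letters" "w \<in> lists letters" using internal_lists[OF t] vw by auto
      have "centre (wt w) \<in> spoke (wt v) (c v)" using vw(3) by simp
      then have "w = v \<or> centre (wt w) = b" using centre_on_spoke[OF l] c vw by metis
      then show "v = w" using centre_neq_vtx[of "c w" w] c[OF vw(2)] by auto
    qed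
    moreover have "(\<lambda>v. spoke (wt v) (c v)) ` ?S \<subseteq> {e \<in> edges (tree_drawing t). e \<inter> U \<noteq> {}}"
    proof
      fix e assume "e \<in> (\<lambda>v. spoke (wt v) (c v)) ` ?S"
      then obtain v where v: "v \<in> ?S" "e = spoke (wt v) (c v)" by blast
      have "b \<in> e" using c[OF v(1)] v(2) by auto
      moreover have "e \<in> edges (tree_drawing t)" using v c[OF v(1)] unfolding edges_tree by blast
      ultimately show "e \<in> {e \<in> edges (tree_drawing t). e \<inter> U \<noteq> {}}" using U(1) by blast
    qed
    ultimately show ?thesis using U(2) by (meson finite_imageD finite_subset)
  qed
qed

theorem locally_finite_tree_iff:
  assumes t: "ternary_tree t"
  shows "locally_finite_map (tree_drawing t) \<longleftrightarrow> finite_degrees t"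
proof
  assume f: "finite_degrees t"
  have conn: "(adj (tree_drawing t))\<^sup>*\<^sup>* u v" if "u \<in> verts (tree_drawing t)" "v \<in> verts (tree_drawing t)" for u v
  proof -
    have "symp (adj (tree_drawing t))" using adj_tree_sym[OF t] by (simp add: symp_def)
    then have "(adj (tree_drawing t))\<^sup>*\<^sup>* 0 v"
      using connected_to_root[OF t that(2)] by (metis sympD symp_rtranclp)
    then show ?thesis using connected_to_root[OF t that(1)] by simp
  qed
  show "locally_finite_map (tree_drawing t)"
    unfolding locally_finite_map_def
  proof (intro conjI ballI impI)
    fix e assume "e \<in> edges (tree_drawing t)"
    then show "\<exists>g. simple_path g \<and> path_image g = e \<and> e \<inter> verts (tree_drawing t) = {pathstart g, pathfinish g}"
      by (rule edge_simple_path[OF t])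
  next
    fix e e' assume "e \<in> edges (tree_drawing t)" "e' \<in> edges (tree_drawing t)" "e \<noteq> e'"
    then show "e \<inter> e' \<subseteq> verts (tree_drawing t)" by (rule edges_meet[OF t])
  next
    fix p assume "p \<in> verts (tree_drawing t) \<union> \<Union>(edges (tree_drawing t))"
    then show "\<exists>U. open U \<and> p \<in> U \<and> finite {e \<in> edges (tree_drawing t). e \<inter> U \<noteq> {}}"
      by (rule drawing_locally_finite[OF t f])
  qed (use conn root_verts[OF t] root_edge tree_infinite_face_on_right[OF t] in \<open>simp_all add: simple_path_linepath\<close>)
qed (rule locally_finite_finite_degrees[OF t])

section \<open>The tree is determined by its map\<close>

lemma homeo_bounded_image:
  fixes h :: "complex \<Rightarrow> complex"
  assumes "homeomorphism UNIV UNIV h h'" "bounded X" shows "bounded (h ` X)"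
proof -
  have "compact (h ` closure X)"
    using assms homeomorphism_UNIV(1)[OF assms(1)] by (intro compact_continuous_image) auto
  then show ?thesis using compact_imp_bounded closure_subset bounded_subset image_mono by metis
qed

lemma homeo_image_vimage:
  assumes "homeomorphism UNIV UNIV h h'" shows "h ` X = h' -` X"
  using homeomorphism_UNIV(3,4)[OF assms] by (auto simp: image_iff) metis

lemma homeo_open_image:
  assumes "homeomorphism UNIV UNIV h h'" "open X" shows "open (h ` X)"
  unfolding homeo_image_vimage[OF assms(1)]
  using homeomorphism_UNIV(2)[OF assms(1)] assms(2) by (intro open_vimage)

lemma homeo_closed_image:
  assumes "homeomorphism UNIV UNIV h h'" "closed X" shows "closed (h ` X)"
  unfolding homeo_image_vimage[OF assms(1)]
  using homeomorphism_UNIV(2)[OF assms(1)] assms(2) by (intro closed_vimage)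

lemma map_isoD:
  assumes "map_iso h D D'"
  shows "oriented_homeo h" "h ` verts D = verts D'" "(\<lambda>e. h ` e) ` edges D = edges D'"
     "h (root_vertex D) = root_vertex D'"
     "path_image (root D) \<in> edges D \<longleftrightarrow> path_image (root D') \<in> edges D'"
     "path_image (root D) \<in> edges D \<Longrightarrow> same_orientation h (root D) (root D')"
  using assms unfolding map_iso_def by simp_all

definition drawn_points :: "drawing \<Rightarrow> complex set" where
  "drawn_points D = verts D \<union> \<Union>(edges D)"

lemma map_iso_drawn_points:
  assumes "map_iso h D D'" shows "h ` drawn_points D = drawn_points D'"
proof -
  have "h ` \<Union>(edges D) = \<Union>((\<lambda>e. h ` e) ` edges D)" by blast
  then show ?thesis using map_isoD(2,3)[OF assms] by (simp add: drawn_points_def image_Un)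
qed

lemma map_iso_inj:
  assumes "map_iso h D D'" shows "inj h"
  using oriented_homeoD[OF map_isoD(1)[OF assms]] homeomorphism_UNIV(5) by metis

lemma map_iso_adj:
  assumes "map_iso h D D'" "adj D u v" shows "adj D' (h u) (h v)"
proof -
  obtain e where e: "e \<in> edges D" "e \<inter> verts D = {u, v}" using assms(2) unfolding adj_def by blast
  have "h ` e \<in> edges D'" using e(1) map_isoD(3)[OF assms(1)] by blast
  moreover have "h ` e \<inter> verts D' = h ` (e \<inter> verts D)"
    using map_isoD(2)[OF assms(1)] map_iso_inj[OF assms(1)] by (simp add: image_Int)
  ultimately show ?thesis unfolding adj_def using e(2) by auto
qed

text \<open>The frontier of the root triangle is drawn, so a connected set avoiding the drawing lies
  either outside or in the open triangle, and the latter is bounded.\<close>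

lemma connected_unbounded_outside:
  assumes t: "ternary_tree t" and C: "connected C" "C \<subseteq> - drawn_points (tree_drawing t)" "\<not> bounded C"
  shows "C \<subseteq> - ctri root_triangle"
proof -
  let ?K = "ctri root_triangle"
  have o: "open (- ?K)" "open (otri root_triangle)"
    using compact_ctri[OF nondegenerate_root] compact_imp_closed open_otri by auto
  have sub: "C \<subseteq> - ?K \<union> otri root_triangle"
    using C(2) boundary_in_drawing[of _ t] unfolding drawn_points_def by (auto simp: on_boundary_def)
  moreover have "- ?K \<inter> otri root_triangle \<inter> C = {}" using otri_ctri by blast
  ultimately have "- ?K \<inter> C = {} \<or> otri root_triangle \<inter> C = {}"
    using connectedD[OF C(1) o] by blast
  moreover have "\<not> C \<subseteq> ?K" using C(3) compact_ctri[OF nondegenerate_root] compact_imp_bounded bounded_subset by blast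
  ultimately show ?thesis using sub by blast
qed

lemma map_iso_outside:
  assumes t: "ternary_tree t" "ternary_tree t'" and h: "map_iso h (tree_drawing t) (tree_drawing t')"
  shows "h ` (- ctri root_triangle) \<subseteq> - ctri root_triangle"
proof -
  let ?K = "ctri root_triangle"
  obtain h' where h': "homeomorphism UNIV UNIV h h'" using map_isoD(1)[OF h] oriented_homeoD by blast
  have b: "bounded ?K" using compact_ctri[OF nondegenerate_root] compact_imp_bounded by blast
  show ?thesis
  proof (rule connected_unbounded_outside[OF t(2)])
    show "connected (h ` (- ?K))"
      using connected_complement_bounded_convex[OF b convex_ctri[OF nondegenerate_root]] homeomorphism_UNIV(1)[OF h']
      by (intro connected_continuous_image) simp_all
    have "- ?K \<subseteq> - drawn_points (tree_drawing t)" using drawing_subset[OF t(1)] by (auto simp: drawn_points_def)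
    then have "h ` (- ?K) \<subseteq> h ` (- drawn_points (tree_drawing t))" by blast
    also have "\<dots> = - drawn_points (tree_drawing t')"
      using bij_image_Compl_eq[OF homeomorphism_UNIV(6)[OF h']] map_iso_drawn_points[OF h] by simp
    finally show "h ` (- ?K) \<subseteq> - drawn_points (tree_drawing t')" .
    show "\<not> bounded (h ` (- ?K))"
    proof
      assume "bounded (h ` (- ?K))"
      then have "bounded (h' ` (h ` (- ?K)))" using homeo_bounded_image homeomorphism_symD[OF h'] by blast
      then have "bounded (- ?K)" by (simp add: image_image homeomorphism_UNIV(3)[OF h'])
      then show False using b cobounded_imp_unbounded by blast
    qed
  qed
qed

text \<open>Describes the corners by sets that an isomorphism respects: the vertices, the unbounded
  face and the interior of its complement.\<close>

lemma corners_root_eq: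
  assumes "ternary_tree t"
  shows "corners root_triangle = verts (tree_drawing t) - - ctri root_triangle - otri root_triangle"
proof -
  have "centre (wt u) \<in> otri root_triangle" if "u \<in> internal_nodes t" for u
    using otri_append[of u "[]"] internal_lists[OF assms that] centre_otri[of u] by auto
  moreover have "b \<in> ctri root_triangle \<and> b \<notin> otri root_triangle" if "b \<in> corners root_triangle" for b
    using root_corner_boundary[OF that] by (simp add: on_boundary_def)
  ultimately show ?thesis unfolding verts_tree by blast
qed

lemma map_iso_corners:
  assumes t: "ternary_tree t" "ternary_tree t'" and h: "map_iso h (tree_drawing t) (tree_drawing t')"
  shows "h ` corners root_triangle = corners root_triangle"
proof -
  let ?K = "ctri root_triangle"
  obtain h' where h': "homeomorphism UNIV UNIV h h'" using map_isoD(1)[OF h] oriented_homeoD by blast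
  have g: "map_iso h' (tree_drawing t') (tree_drawing t)" using map_iso_inverse[OF h h'] .
  have outer: "h ` (- ?K) = - ?K"
  proof
    show "h ` (- ?K) \<subseteq> - ?K" by (rule map_iso_outside[OF t h])
    have "h ` (h' ` (- ?K)) \<subseteq> h ` (- ?K)" using map_iso_outside[OF t(2,1) g] by blast
    then show "- ?K \<subseteq> h ` (- ?K)" by (simp add: image_image homeomorphism_UNIV(4)[OF h'])
  qed
  have K: "h ` ?K = ?K" using bij_image_Compl_eq[OF homeomorphism_UNIV(6)[OF h'], of ?K] outer by (metis double_complement)
  have i: "f ` otri root_triangle \<subseteq> otri root_triangle" if "homeomorphism UNIV UNIV f f'" "f ` ?K = ?K" for f f'
  proof -
    have "open (f ` otri root_triangle)" using homeo_open_image[OF that(1) open_otri] .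
    moreover have "f ` otri root_triangle \<subseteq> ?K" using that(2) otri_ctri by blast
    ultimately show ?thesis using interior_maximal interior_ctri[OF nondegenerate_root] by metis
  qed
  have K': "h' ` ?K = ?K" using arg_cong[OF K, of "(`) h'"] by (simp add: image_image homeomorphism_UNIV(3)[OF h'])
  have "h ` (h' ` otri root_triangle) \<subseteq> h ` otri root_triangle"
    using i[OF homeomorphism_symD[OF h'] K'] by blast
  then have I: "h ` otri root_triangle = otri root_triangle"
    using i[OF h' K] by (simp add: image_image homeomorphism_UNIV(4)[OF h'])
  show ?thesis
    unfolding corners_root_eq[OF t(1)]
    unfolding image_set_diff[OF map_iso_inj[OF h]] outer I map_isoD(2)[OF h]
    using corners_root_eq[OF t(1)] corners_root_eq[OF t(2)] by simp
qed

text \<open>The root vertex 0 is respected by definition, and the other end 1 of the root edge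
  because the change of parameter fixes 1; the third corner is what remains.\<close>

lemma map_iso_fixes_corner:
  assumes t: "ternary_tree t" "ternary_tree t'" and h: "map_iso h (tree_drawing t) (tree_drawing t')"
    and b: "b \<in> corners root_triangle"
  shows "h b = b"
proof -
  have 0: "h 0 = 0" using map_isoD(4)[OF h] by simp
  have r: "path_image (root (tree_drawing t)) \<in> edges (tree_drawing t)"
    by (simp add: edges_tree root_triangle_def)
  obtain \<phi> where "\<phi> 1 = (1::real)" "\<forall>s\<in>{0..1}. h (linepath 0 1 s) = linepath 0 1 (\<phi> s)"
    using map_isoD(6)[OF h r] unfolding same_orientation_def by auto
  then have "h (linepath 0 1 1) = linepath 0 1 1" by (metis atLeastAtMost_iff order_refl zero_le_one)
  then have 1: "h 1 = 1" by (simp add: linepath_def)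
  let ?E = "cis (pi / 3)"
  have c: "corners root_triangle = {0, 1, ?E}" by (simp add: root_triangle_def)
  have "Im ?E \<noteq> 0" by (simp add: sin_60)
  then have E: "?E \<noteq> 0" "?E \<noteq> 1" by (metis zero_complex.simps(2), metis one_complex.simps(2))
  have "h ?E \<in> {0, 1, ?E}" using map_iso_corners[OF t h] unfolding c by blast
  moreover have "h ?E \<noteq> 0" "h ?E \<noteq> 1" using E 0 1 inj_eq[OF map_iso_inj[OF h]] by metis+
  ultimately show ?thesis using b 0 1 c by auto
qed

lemma corner_neq_centre:
  assumes "b \<in> corners root_triangle" "u \<in> lists letters" shows "b \<noteq> centre (wt u)"
proof -
  have "centre (wt u) \<in> otri (wt [])" using subsetD[OF otri_append[OF assms(2), of "[]"]] by simp
  then show ?thesis using root_corner_boundary[OF assms(1)] not_boundary_otri by blast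
qed

text \<open>A triangle of a stack-triangulation has at most two common neighbours of its corners: the
  vertex inserted in it, and the corner of its parent that was replaced.\<close>

lemma common_neighbour:
  assumes t: "ternary_tree t" and u: "u \<in> t" and y: "\<And>b. b \<in> corners (wt u) \<Longrightarrow> adj (tree_drawing t) y b"
    and par: "\<And>p i. u = p @ [i] \<Longrightarrow> y \<noteq> vtx (wt p) i"
  shows "u \<in> internal_nodes t \<and> y = centre (wt u)"
proof -
  have ul: "u \<in> lists letters" using tree_lists[OF t u] .
  have irrefl: "\<not> adj (tree_drawing t) x x" for x
    unfolding adj_tree_iff[OF t] using not_boundary_otri[OF centre_otri] corner_on_boundary by blast
  have ynot: "y \<notin> corners (wt u)" using y irrefl by blast
  \<comment> \<open>Reduces to a centre y of a node at or below u that has all corners of u among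
    its own. No proper descendant of u keeps all these corners, which leaves u itself.\<close>
  have "\<exists>v\<in>internal_nodes t. y = centre (wt v) \<and> corners (wt u) \<subseteq> corners (wt v) \<and> (\<exists>w. v = u @ w)"
  proof (cases u rule: rev_cases)
    case Nil
    then have yn: "y \<notin> corners root_triangle" using ynot by simp
    have "\<exists>v\<in>internal_nodes t. y = centre (wt v) \<and> b \<in> corners (wt v)" if b: "b \<in> corners root_triangle" for b
    proof -
      have "adj (tree_drawing t) y b" using y b Nil by simp
      then show ?thesis unfolding adj_tree_iff[OF t]
        using yn b corner_neq_centre[OF b internal_lists[OF t]] by blast
    qed
    then obtain v where v: "\<And>b. b \<in> corners root_triangle \<Longrightarrow> v b \<in> internal_nodes t \<and> y = centre (wt (v b)) \<and> b \<in> corners (wt (v b))"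
      by metis
    have r: "0 \<in> corners root_triangle" by (simp add: root_triangle_def)
    have "v b = v 0" if "b \<in> corners root_triangle" for b
      using centre_inj[of "v b" "v 0"] internal_lists[OF t] v[OF that] v[OF r] by simp
    then have "b \<in> corners (wt (v 0))" if "b \<in> corners root_triangle" for b using v[OF that] that by metis
    then have "corners root_triangle \<subseteq> corners (wt (v 0))" by blast
    then show ?thesis using v[OF r] Nil by auto
  next
    case (snoc p i)
    then have i: "i \<in> letters" and pl: "p \<in> lists letters" using ul by auto
    have cu: "corners (wt u) = insert (centre (wt p)) (vtx (wt p) ` (letters - {i}))"
      using corners_child[OF i] snoc by simp
    have "adj (tree_drawing t) y (centre (wt p))" using y cu by simp
    moreover have "\<not> (y = vtx (wt p) c)" if "c \<in> letters" for c
      using par[OF snoc] ynot that unfolding cu by (cases "c = i") auto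
    ultimately obtain v where v: "v \<in> internal_nodes t" "y = centre (wt v)" "centre (wt p) \<in> corners (wt v)"
      unfolding adj_tree_iff[OF t] using corner_neq_centre[OF _ pl] centre_inj[OF pl internal_lists[OF t]]
      by (metis (no_types, lifting) corners_vtx imageE)
    have vl: "v \<in> lists letters" using internal_lists[OF t v(1)] .
    obtain j w where w: "v = p @ j # w" "j \<in> letters" "w \<in> lists letters"
      using centre_corner_prefix[OF pl vl v(3)] by metis
    have sub: "b \<in> corners (wt v)" if b: "b \<in> corners (wt u)" for b
    proof -
      have a: "adj (tree_drawing t) y b" using y b .
      have 1: "y \<notin> corners root_triangle" using corner_neq_centre[OF _ vl] v(2) by blast
      have 2: False if x: "x \<in> internal_nodes t" "b = centre (wt x)" "y \<in> corners (wt x)" for x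
      proof -
        have xl: "x \<in> lists letters" using internal_lists[OF t x(1)] .
        obtain k z where "x = v @ k # z" using centre_corner_prefix[OF vl xl] x(3) v(2) by metis
        moreover obtain k' z' where "u = x @ k' # z'" using centre_corner_prefix[OF xl ul] x(2) b by metis
        ultimately show False using w(1) snoc by (auto dest: arg_cong[of _ _ length])
      qed
      obtain x where "x \<in> internal_nodes t" "y = centre (wt x)" "b \<in> corners (wt x)"
        using a 1 2 unfolding adj_tree_iff[OF t] by blast
      then show ?thesis using centre_inj[OF vl internal_lists[OF t]] v(2) by metis
    qed
    \<comment> \<open>If v were below another child j of p, then corner j of p, which is a corner of
      u, would have to be a corner of v, although child j has lost it.\<close>
    have "j = i"
    proof (rule ccontr)
      assume "j \<noteq> i"
      then have "vtx (wt p) j \<in> corners (wt v)" using sub w(2) unfolding cu by blast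
      then show False
        using vtx_not_in_own_child[OF w(2,3), of p] corners_subset_ctri[OF nondegenerate_wt] w(1) by blast
    qed
    then show ?thesis using v(1,2) w(1) sub snoc by (intro bexI[of _ v]) auto
  qed
  then obtain v w where v: "v \<in> internal_nodes t" "y = centre (wt v)" "corners (wt u) \<subseteq> corners (wt v)" "v = u @ w"
    by blast
  have "w = []"
  proof (cases w)
    case (Cons k z)
    then have kz: "k \<in> letters" "z \<in> lists letters" using internal_lists[OF t v(1)] v(4) by auto
    then have "vtx (wt u) k \<in> ctri (wt (u @ k # z))"
      using v(3,4) Cons corners_subset_ctri[OF nondegenerate_wt] vtx_in_corners by blast
    then show ?thesis using vtx_not_in_own_child kz by blast
  qed
  then show ?thesis using v by simp
qed

text \<open>Induction on the length: the centres of all proper prefixes are fixed, hence so are all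
  corners of u, and the image of the centre of u is a common neighbour of them in t'. The other
  candidate, the corner of the parent that was replaced, is fixed by h and so is not the image of
  the centre.\<close>

lemma map_iso_fixes_centres:
  assumes t: "ternary_tree t" "ternary_tree t'" and h: "map_iso h (tree_drawing t) (tree_drawing t')"
    and u: "u \<in> internal_nodes t"
  shows "u \<in> internal_nodes t' \<and> h (centre (wt u)) = centre (wt u)"
  using u
proof (induction u rule: measure_induct_rule[of length])
  case (less u)
  have ut: "u \<in> t" using less.prems internal_subset by blast
  have ul: "u \<in> lists letters" using tree_lists[OF t(1) ut] .
  have IH: "p \<in> internal_nodes t' \<and> h (centre (wt p)) = centre (wt p)" if "u = p @ i # w" for p i w
    using less.IH[of p] internal_prefix[OF t(1)] ut that by simp
  have fix_corner: "h b = b" if "v \<in> lists letters" "u = v @ w" "b \<in> corners (wt v)" for v w b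
    using corner_cases[OF that(1,3)]
  proof (elim disjE exE conjE)
    fix p i x assume "v = p @ i # x" "b = centre (wt p)"
    then show ?thesis using IH[of p i "x @ w"] that by simp
  qed (rule map_iso_fixes_corner[OF t h])
  have "u \<in> t'"
  proof (cases u rule: rev_cases)
    case (snoc p i)
    then show ?thesis using IH[of p i "[]"] internal_child ul by simp
  qed (simp add: tree_root[OF t(2)])
  moreover have "adj (tree_drawing t') (h (centre (wt u))) b" if b: "b \<in> corners (wt u)" for b
  proof -
    have "adj (tree_drawing t) (centre (wt u)) b" unfolding adj_tree_iff[OF t(1)] using less.prems b by blast
    then show ?thesis using map_iso_adj[OF h] fix_corner[OF ul _ b, of "[]"] by fastforce
  qed
  moreover have "h (centre (wt u)) \<noteq> vtx (wt p) i" if p: "u = p @ [i]" for p i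
  proof
    assume "h (centre (wt u)) = vtx (wt p) i"
    moreover have i: "i \<in> letters" and "h (vtx (wt p) i) = vtx (wt p) i"
      using fix_corner[of p "[i]"] p ul vtx_in_corners by auto
    ultimately have "centre (wt u) = vtx (wt p) i" using inj_eq[OF map_iso_inj[OF h]] by metis
    moreover have "centre (wt u) \<in> otri (wt p)" using otri_append[of "[i]" p] i p centre_otri[of u] by auto
    ultimately show False using corners_not_otri[OF nondegenerate_wt] vtx_in_corners[OF i] by metis
  qed
  ultimately show ?case using common_neighbour[OF t(2)] by blast
qed

theorem same_map_tree_inj:
  assumes t: "ternary_tree t" "ternary_tree t'" and s: "same_map (tree_drawing t) (tree_drawing t')"
  shows "t = t'"
proof (rule tree_eqI[OF t])
  obtain h g where "map_iso h (tree_drawing t) (tree_drawing t')" "map_iso g (tree_drawing t') (tree_drawing t)"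
    using s same_map_sym[OF s] unfolding same_map_iff by blast
  then show "internal_nodes t = internal_nodes t'"
    using map_iso_fixes_centres[OF t] map_iso_fixes_centres[OF t(2,1)] by blast
qed

section \<open>Extension of homeomorphisms by coning\<close>

text \<open>A gauge centred at \<open>x\<close> is a Minkowski functional: the homeomorphism \<open>h\<close> of the boundary curves
  \<open>{\<rho> = 1}\<close> and \<open>{\<sigma> = 1}\<close> is extended to the inside by coning, i.e. linearly along the rays.\<close>

definition is_gauge :: "complex \<Rightarrow> (complex \<Rightarrow> real) \<Rightarrow> bool" where
  "is_gauge x \<rho> \<longleftrightarrow> continuous_on UNIV \<rho> \<and> (\<forall>z s. 0 \<le> s \<longrightarrow> \<rho> (x + of_real s * (z - x)) = s * \<rho> z)
     \<and> (\<forall>z. z \<noteq> x \<longrightarrow> 0 < \<rho> z) \<and> bounded {z. \<rho> z \<le> 1}"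

text \<open>At z = x the quotient is a division by 0, but the factor \<open>\<rho> z\<close>, which
  is 0 there, makes the value c.\<close>

definition cone_map :: "complex \<Rightarrow> complex \<Rightarrow> (complex \<Rightarrow> real) \<Rightarrow> (complex \<Rightarrow> complex) \<Rightarrow> complex \<Rightarrow> complex" where
  "cone_map x c \<rho> h z = (if \<rho> z \<le> 1 then c + of_real (\<rho> z) * (h (x + (z - x) / of_real (\<rho> z)) - c) else h z)"

lemma is_gaugeD:
  assumes "is_gauge x \<rho>"
  shows "continuous_on A \<rho>" "0 \<le> s \<Longrightarrow> \<rho> (x + of_real s * (z - x)) = s * \<rho> z" "z \<noteq> x \<Longrightarrow> 0 < \<rho> z"
    "bounded {z. \<rho> z \<le> 1}" "\<rho> x = 0" "0 \<le> \<rho> z"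
proof -
  note g = assms[unfolded is_gauge_def]
  show "continuous_on A \<rho>" using g continuous_on_subset by blast
  show "\<rho> (x + of_real s * (z - x)) = s * \<rho> z" if "0 \<le> s" for s z using g that by blast
  from this[of 0 x] show 0: "\<rho> x = 0" by simp
  show p: "0 < \<rho> z" if "z \<noteq> x" for z using g that by blast
  show "bounded {z. \<rho> z \<le> 1}" using g by blast
  show "0 \<le> \<rho> z" using p[of z] 0 by (cases "z = x") auto
qed

lemma gauge_project:
  assumes "is_gauge x \<rho>" "z \<noteq> x" shows "\<rho> (x + (z - x) / of_real (\<rho> z)) = 1"
proof -
  have "0 < \<rho> z" using is_gaugeD(3)[OF assms] .
  then show ?thesis using is_gaugeD(2)[OF assms(1), of "1 / \<rho> z" z] by (simp add: divide_inverse mult.commute)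
qed

lemma cone_map_ray:
  assumes g: "is_gauge x \<rho>" and b: "\<rho> b = 1" and s: "0 \<le> s" "s \<le> 1"
  shows "cone_map x c \<rho> h (x + of_real s * (b - x)) = c + of_real s * (h b - c)"
proof -
  have "\<rho> (x + of_real s * (b - x)) = s" using is_gaugeD(2)[OF g s(1), of b] b by simp
  then show ?thesis using s by (cases "s = 0") (auto simp: cone_map_def)
qed

text \<open>This is what coning is for: the new edge from x to a corner b must become a straight
  edge from c.\<close>

lemma cone_map_segment:
  assumes "is_gauge x \<rho>" "\<rho> b = 1"
  shows "cone_map x c \<rho> h ` closed_segment x b = closed_segment c (h b)"
proof -
  have seg: "closed_segment p q = (\<lambda>s. p + of_real s * (q - p)) ` {0..1}" for p q :: complex
    unfolding closed_segment_image_interval by (simp add: scaleR_conv_of_real algebra_simps)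
  show ?thesis unfolding seg image_image
    by (intro image_cong refl cone_map_ray[OF assms]) auto
qed

lemma cone_map_outside: "1 \<le> \<rho> z \<Longrightarrow> cone_map x c \<rho> h z = h z"
  by (cases "\<rho> z = 1") (auto simp: cone_map_def)

lemma cone_map_centre: "is_gauge x \<rho> \<Longrightarrow> cone_map x c \<rho> h x = c"
  by (simp add: cone_map_def is_gaugeD(5))

text \<open>Rays from x go linearly to rays from c, and the cone over the inverse, with the gauges
  exchanged, goes back along the same rays.\<close>

lemma cone_map_inverse:
  assumes g: "is_gauge x \<rho>" "is_gauge c \<sigma>" and inv: "\<And>z. h' (h z) = z"
    and bd: "\<And>z. \<rho> z = 1 \<Longrightarrow> \<sigma> (h z) = 1" "\<And>z. 1 < \<rho> z \<Longrightarrow> 1 < \<sigma> (h z)"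
  shows "cone_map c x \<sigma> h' (cone_map x c \<rho> h z) = z"
proof (cases "\<rho> z \<le> 1")
  case False
  then have "cone_map x c \<rho> h z = h z" by (intro cone_map_outside) simp
  moreover have "1 < \<sigma> (h z)" using bd(2) False by simp
  ultimately show ?thesis using cone_map_outside[of \<sigma> "h z"] inv by simp
next
  case True
  show ?thesis
  proof (cases "z = x")
    case True then show ?thesis using cone_map_centre g by simp
  next
    case False
    define b where "b = x + (z - x) / of_real (\<rho> z)"
    have pos: "0 < \<rho> z" using is_gaugeD(3)[OF g(1) False] .
    have b1: "\<rho> b = 1" using gauge_project[OF g(1) False] by (simp add: b_def)
    have z: "z = x + of_real (\<rho> z) * (b - x)" using pos by (simp add: b_def)
    have "cone_map x c \<rho> h z = c + of_real (\<rho> z) * (h b - c)" using True by (simp add: cone_map_def b_def)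
    also have "cone_map c x \<sigma> h' \<dots> = x + of_real (\<rho> z) * (h' (h b) - x)"
      using pos True by (intro cone_map_ray[OF g(2) bd(1)[OF b1]]) auto
    finally show ?thesis using inv z by simp
  qed
qed

text \<open>Away from x the inner formula is composed of continuous maps. Near x it differs from c
  by \<open>\<rho> z\<close> times a quantity bounded by compactness, and where
  \<open>\<rho> z = 1\<close> both branches give \<open>h z\<close>.\<close>

lemma cone_map_continuous:
  assumes g: "is_gauge x \<rho>" and h: "continuous_on UNIV h"
  shows "continuous_on UNIV (cone_map x c \<rho> h)"
proof -
  define f where "f = (\<lambda>z. c + of_real (\<rho> z) * (h (x + (z - x) / of_real (\<rho> z)) - c))"
  let ?A = "{z. \<rho> z \<le> 1}" and ?B = "{z. 1 \<le> \<rho> z}"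
  have cr: "continuous_on A \<rho>" for A using is_gaugeD(1)[OF g] .
  have closed: "closed ?A" "closed ?B"
    by (intro closed_Collect_le cr continuous_intros)+
  have "compact ?A" using closed is_gaugeD(4)[OF g] compact_eq_bounded_closed by blast
  then have "compact (h ` ?A)" using h continuous_on_subset by (intro compact_continuous_image) blast+
  then have "\<exists>a. \<forall>y\<in>h ` ?A. norm y \<le> a" using compact_imp_bounded bounded_iff by metis
  then obtain M0 where M0: "\<forall>y\<in>h ` ?A. norm y \<le> M0" ..
  have M: "norm (h z - c) \<le> M0 + norm c" if "\<rho> z \<le> 1" for z
  proof -
    have "norm (h z) \<le> M0" using M0 that by simp
    then show ?thesis using norm_triangle_ineq4[of "h z" c] by simp
  qed
  have "continuous_on ?A f"
    unfolding continuous_on_eq_continuous_within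
  proof
    fix z assume "z \<in> ?A"
    show "continuous (at z within ?A) f"
    proof (cases "z = x")
      case True
      have "((\<lambda>w. f w - c) \<longlongrightarrow> 0) (at x within ?A)"
      proof (rule Lim_null_comparison)
        show "\<forall>\<^sub>F w in at x within ?A. norm (f w - c) \<le> \<rho> w * (M0 + norm c)"
        proof (intro always_eventually allI)
          fix w
          show "norm (f w - c) \<le> \<rho> w * (M0 + norm c)"
          proof (cases "w = x")
            case False
            have "norm (h (x + (w - x) / of_real (\<rho> w)) - c) \<le> M0 + norm c" using gauge_project[OF g False] M by simp
            then show ?thesis using is_gaugeD(6)[OF g, of w]
              by (auto simp: f_def norm_mult intro!: mult_left_mono)
          qed (simp add: f_def is_gaugeD(5)[OF g])
        qed
        have "(\<rho> \<longlongrightarrow> \<rho> x) (at x within ?A)" using cr[of ?A] \<open>z \<in> ?A\<close> True by (simp add: continuous_on_def)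
        then show "((\<lambda>w. \<rho> w * (M0 + norm c)) \<longlongrightarrow> 0) (at x within ?A)"
          using tendsto_mult_right[of \<rho> 0 _ M] is_gaugeD(5)[OF g] by (auto intro: tendsto_mult_left_zero)
      qed
      then have "(f \<longlongrightarrow> c) (at x within ?A)" using LIM_zero_iff by blast
      moreover have "f x = c" by (simp add: f_def is_gaugeD(5)[OF g])
      ultimately show ?thesis by (simp add: continuous_within True)
    next
      case False
      have "continuous_on (- {x}) f"
        unfolding f_def
        by (intro continuous_intros cr continuous_on_compose2[OF h])
          (use is_gaugeD(3)[OF g] in force)+
      then have "continuous (at z) f" using False continuous_on_interior[of "- {x}" f z] interior_open[of "- {x}"] by auto
      then show ?thesis using continuous_at_imp_continuous_at_within by blast
    qed
  qed
  moreover have "continuous_on ?B h" using h continuous_on_subset by blast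
  moreover have "f z = h z" if "z \<in> ?A" "\<not> \<rho> z \<le> 1 \<or> z \<in> ?B \<and> \<rho> z \<le> 1" for z
    using that by (auto simp: f_def)
  ultimately have "continuous_on (?A \<union> ?B) (\<lambda>z. if \<rho> z \<le> 1 then f z else h z)"
    using closed by (intro continuous_on_cases) (auto simp: f_def)
  moreover have "?A \<union> ?B = UNIV" by auto
  ultimately show ?thesis unfolding cone_map_def[abs_def] f_def by simp
qed

lemma cone_map_homeomorphism:
  assumes g: "is_gauge x \<rho>" "is_gauge c \<sigma>" and h: "homeomorphism UNIV UNIV h h'"
    and bd: "\<And>z. \<rho> z = 1 \<longleftrightarrow> \<sigma> (h z) = 1" "\<And>z. 1 < \<rho> z \<longleftrightarrow> 1 < \<sigma> (h z)"
  shows "homeomorphism UNIV UNIV (cone_map x c \<rho> h) (cone_map c x \<sigma> h')"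
proof -
  note H = homeomorphism_UNIV[OF h]
  have 1: "cone_map c x \<sigma> h' (cone_map x c \<rho> h z) = z" for z
    by (rule cone_map_inverse[OF g]) (use H bd in auto)
  have 2: "cone_map x c \<rho> h (cone_map c x \<sigma> h' z) = z" for z
  proof (rule cone_map_inverse[OF g(2,1)])
    show "h (h' z) = z" for z using H by simp
    show "\<sigma> z = 1 \<Longrightarrow> \<rho> (h' z) = 1" for z using bd(1)[of "h' z"] H by simp
    show "1 < \<sigma> z \<Longrightarrow> 1 < \<rho> (h' z)" for z using bd(2)[of "h' z"] H by simp
  qed
  show ?thesis
  proof (rule homeomorphismI)
    show "continuous_on UNIV (cone_map x c \<rho> h)" "continuous_on UNIV (cone_map c x \<sigma> h')"
      using cone_map_continuous g H by blast+
  qed (use 1 2 in auto)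
qed

text \<open>The cone map coincides with h far away, and one distant circle is enough to test the
  orientation.\<close>

lemma cone_map_oriented:
  assumes g: "is_gauge x \<rho>" "is_gauge c \<sigma>" and h: "homeomorphism UNIV UNIV h h'" "oriented_homeo h"
    and bd: "\<And>z. \<rho> z = 1 \<longleftrightarrow> \<sigma> (h z) = 1" "\<And>z. 1 < \<rho> z \<longleftrightarrow> 1 < \<sigma> (h z)"
  shows "oriented_homeo (cone_map x c \<rho> h)"
proof -
  obtain R where R: "\<And>z. \<rho> z \<le> 1 \<Longrightarrow> norm z \<le> R" "0 < R"
    using is_gaugeD(4)[OF g(1)] unfolding bounded_pos by blast
  \<comment> \<open>The unit disc around R + 2 stays outside the disc of radius R, which contains
    all points with \<open>\<rho> z \<le> 1\<close>.\<close>
  define w where "w = complex_of_real (R + 2)"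
  have out: "cone_map x c \<rho> h z = h z" if "dist w z \<le> 1" for z
  proof (rule cone_map_outside, rule ccontr)
    assume "\<not> 1 \<le> \<rho> z"
    then have "norm z \<le> R" using R by simp
    moreover have "norm w \<le> norm z + dist w z" by (simp add: dist_norm norm_triangle_sub)
    moreover have "norm w = R + 2" using R unfolding w_def norm_of_real by simp
    ultimately show False using that by simp
  qed
  have "cone_map x c \<rho> h \<circ> circlepath w 1 = h \<circ> circlepath w 1"
    by (auto simp: fun_eq_iff circlepath_eq dist_norm intro!: out)
  then have "winding_number (cone_map x c \<rho> h \<circ> circlepath w 1) (cone_map x c \<rho> h w) = 1"
    using h(2) out[of w] by (simp add: oriented_homeo_def)
  then show ?thesis by (rule oriented_homeoI[OF cone_map_homeomorphism[OF g h(1) bd] zero_less_one])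
qed

text \<open>The i-th term is affine, with value 0 at x and 1 on the line of the side opposite to
  corner i; for x inside, the maximum is the Minkowski functional of the triangle as seen from
  x.\<close>

definition gauge_tri :: "triangle \<Rightarrow> complex \<Rightarrow> complex \<Rightarrow> real" where
  "gauge_tri T x z = max (1 - bary T 1 z / bary T 1 x) (max (1 - bary T 2 z / bary T 2 x) (1 - bary T 3 z / bary T 3 x))"

lemma
  assumes T: "nondegenerate T" and x: "x \<in> otri T"
  shows gauge_tri_less: "gauge_tri T x z < 1 \<longleftrightarrow> z \<in> otri T"
    and gauge_tri_le: "gauge_tri T x z \<le> 1 \<longleftrightarrow> z \<in> ctri T"
    and gauge_tri: "is_gauge x (gauge_tri T x)"
proof -
  have pos: "0 < bary T 1 x" "0 < bary T 2 x" "0 < bary T 3 x" using x by (auto simp: otri_def)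
  show "gauge_tri T x z < 1 \<longleftrightarrow> z \<in> otri T" for z
    using pos unfolding otri_def mem_Collect_eq ball_letters by (simp add: gauge_tri_def zero_less_divide_iff not_less[symmetric])
  show le: "gauge_tri T x z \<le> 1 \<longleftrightarrow> z \<in> ctri T" for z
    using pos unfolding ctri_def mem_Collect_eq ball_letters by (simp add: gauge_tri_def zero_le_divide_iff not_le[symmetric])
  show "is_gauge x (gauge_tri T x)"
    unfolding is_gauge_def
  proof (intro conjI allI impI)
    show "continuous_on UNIV (gauge_tri T x)"
      unfolding gauge_tri_def[abs_def] using pos by (intro continuous_intros) auto
    show "bounded {z. gauge_tri T x z \<le> 1}"
      unfolding le using compact_ctri[OF T] compact_imp_bounded by simp
    show "gauge_tri T x (x + of_real s * (z - x)) = s * gauge_tri T x z" if "0 \<le> s" for s z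
    proof -
      have "1 - bary T i (x + of_real s * (z - x)) / bary T i x = s * (1 - bary T i z / bary T i x)"
        if "0 < bary T i x" for i
        unfolding bary_affine using that by (simp add: field_simps)
      then show ?thesis unfolding gauge_tri_def using pos that by (simp add: max_mult_distrib_left)
    qed
    \<comment> \<open>If no term is positive, no coordinate of z is below that of x; as both triples
      sum to 1, they agree.\<close>
    show "0 < gauge_tri T x z" if "z \<noteq> x" for z
    proof (rule ccontr)
      assume "\<not> 0 < gauge_tri T x z"
      then have "bary T 1 x \<le> bary T 1 z" "bary T 2 x \<le> bary T 2 z" "bary T 3 x \<le> bary T 3 z"
        using pos by (auto simp: gauge_tri_def not_less le_divide_eq)
      moreover have "bary T 1 x + bary T 2 x + bary T 3 x = bary T 1 z + bary T 2 z + bary T 3 z"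
        using bary_sum[OF T] by simp
      ultimately have "bary T 1 x = bary T 1 z" "bary T 2 x = bary T 2 z" "bary T 3 x = bary T 3 z" by simp_all
      then have "z = x" by (intro bary_inject[OF T]) (auto elim!: letters_cases)
      then show False using that by simp
    qed
  qed
qed

section \<open>Faces of finite trees\<close>

lemma diverging_otri_disjoint:
  assumes "i \<in> letters" "j \<in> letters" "i \<noteq> j" "v \<in> lists letters" "w \<in> lists letters"
  shows "otri (wt (q @ i # v)) \<inter> ctri (wt (q @ j # w)) = {}"
proof (rule ccontr)
  assume "otri (wt (q @ i # v)) \<inter> ctri (wt (q @ j # w)) \<noteq> {}"
  then obtain p where p: "p \<in> otri (wt (q @ [i]))" "p \<in> ctri (wt (q @ [j]))"
    using otri_Cons[OF assms(4)] ctri_Cons[OF assms(5)] by blast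
  then show False using siblings_boundary[OF assms(1,2,3) otri_ctri[OF p(1)] p(2)] not_boundary_otri by blast
qed

text \<open>A spoke of a proper prefix of u touches the child towards u only on its boundary,
  diverging triangles do not reach the open triangle of u, and a leaf has no internal
  descendants.\<close>

lemma leaf_otri_disjoint:
  assumes t: "ternary_tree t" and u: "u \<in> t" "u \<notin> internal_nodes t"
  shows "otri (wt u) \<inter> drawn_points (tree_drawing t) = {}"
proof (rule ccontr)
  assume "otri (wt u) \<inter> drawn_points (tree_drawing t) \<noteq> {}"
  then obtain p where p: "p \<in> otri (wt u)" "p \<in> \<Union>(edges (tree_drawing t))"
    using drawing_point_on_edge unfolding drawn_points_def by blast
  have ul: "u \<in> lists letters" using tree_lists[OF t u(1)] .
  from p(2) consider e where "e \<in> sides root_triangle" "p \<in> e"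
    | v c where "p \<in> spoke (wt v) c" "v \<in> internal_nodes t" "c \<in> letters"
    unfolding edges_tree by blast
  then show False
  proof cases
    case (1 e)
    then have "on_boundary [] p" using root_side_cases[OF 1(1)] by metis
    moreover have "p \<in> otri (wt [])" using subsetD[OF otri_append[OF ul, of "[]"]] p(1) by simp
    ultimately show False using not_boundary_otri by blast
  next
    case (2 v c)
    have vl: "v \<in> lists letters" using internal_lists[OF t 2(2)] .
    from vl ul show False
    proof (cases rule: word_cases)
      case eq then show False using u 2 by simp
    next
      case (prefix i w)
      then have o: "p \<in> otri (wt (v @ [i]))" using p(1) otri_Cons by blast
      then have "on_boundary (v @ [i]) p" using spoke_child_boundary[OF 2(3,1) prefix(2)] otri_ctri by blast
      then show False using o not_boundary_otri by blast
    next
      case (suffix i w)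
      have "v \<in> t" using 2(2) internal_subset by blast
      then show False using internal_prefix[OF t] suffix u(2) by blast
    next
      case (diverge q i j v' w')
      then show False
        using diverging_otri_disjoint[of j i w' v' q] p(1) spoke_in_ctri[OF 2(3,1)] by auto
    qed
  qed
qed

text \<open>A vertex in the closed triangle of u is a corner already for some prefix of u, and
  corners persist in the smaller triangles that still contain them.\<close>

lemma leaf_verts:
  assumes t: "ternary_tree t" and u: "u \<in> t" "u \<notin> internal_nodes t"
  shows "verts (tree_drawing t) \<inter> ctri (wt u) = corners (wt u)"
proof (intro equalityI subsetI)
  have ul: "u \<in> lists letters" using tree_lists[OF t u(1)] .
  fix p assume p: "p \<in> verts (tree_drawing t) \<inter> ctri (wt u)"
  have persist: "p \<in> corners (wt u)" if "p \<in> corners (wt v)" "u = v @ w" "w \<in> lists letters" for v w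
  proof -
    obtain j where "j \<in> letters" "p = vtx (wt v) j" using \<open>p \<in> corners (wt v)\<close> by (auto simp: corners_vtx)
    then show ?thesis using corner_persists[OF that(3), of j v] p vtx_in_corners[of j "wt u"] that(2) by simp
  qed
  from p consider "p \<in> corners root_triangle" | v where "v \<in> internal_nodes t" "p = centre (wt v)"
    unfolding verts_tree by blast
  then show "p \<in> corners (wt u)"
  proof cases
    case 1 then show ?thesis using persist[of "[]" u] ul by simp
  next
    case (2 v)
    have vl: "v \<in> lists letters" using internal_lists[OF t 2(1)] .
    from vl ul show ?thesis
    proof (cases rule: word_cases)
      case eq then show ?thesis using u 2 by simp
    next
      case (prefix i w)
      then have "p \<in> corners (wt (v @ [i]))" using corners_child[OF prefix(2)] 2 by simp
      then show ?thesis using persist[of "v @ [i]" w] prefix by simp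
    next
      case (suffix i w)
      have "v \<in> t" using 2(1) internal_subset by blast
      then show ?thesis using internal_prefix[OF t] suffix u(2) by blast
    next
      case (diverge q i j v' w')
      have "p \<in> otri (wt (q @ i # v'))" using centre_otri[of v] 2(2) diverge(1) by simp
      moreover have "p \<in> ctri (wt (q @ j # w'))" using p diverge(2) by simp
      ultimately show ?thesis using diverging_otri_disjoint[of i j v' w' q] diverge by blast
    qed
  qed
next
  fix p assume "p \<in> corners (wt u)"
  then show "p \<in> verts (tree_drawing t) \<inter> ctri (wt u)"
    using corners_in_verts[OF t u(1)] corners_subset_ctri[OF nondegenerate_wt] by blast
qed

text \<open>Consider a least coordinate m. If it is strictly least, p is in the open child m; if it
  ties with k, then p is on the spoke of the third index.\<close>

lemma otri_split:
  assumes "p \<in> otri (wt u)"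
  shows "(\<exists>i\<in>letters. p \<in> otri (wt (u @ [i]))) \<or> (\<exists>i\<in>letters. p \<in> spoke (wt u) i)"
proof -
  obtain m where m: "m \<in> letters" "\<And>j. j \<in> letters \<Longrightarrow> bary (wt u) m p \<le> bary (wt u) j p"
  proof -
    let ?B = "(\<lambda>j. bary (wt u) j p) ` letters"
    have f: "finite ?B" "?B \<noteq> {}" by (auto simp: letters_def)
    from Min_in[OF f] obtain m where "m \<in> letters" "Min ?B = bary (wt u) m p" by auto
    moreover have "Min ?B \<le> bary (wt u) j p" if "j \<in> letters" for j using f that by simp
    ultimately show thesis using that by metis
  qed
  have pos: "0 < bary (wt u) m p" using assms m by (simp add: otri_def)
  show ?thesis
  proof (cases "\<exists>k\<in>letters. k \<noteq> m \<and> bary (wt u) k p = bary (wt u) m p")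
    case False
    then have "p \<in> otri (wt (u @ [m]))"
      unfolding otri_child_iff[OF m(1)] using m(2) pos by (metis order_le_less)
    then show ?thesis using m by blast
  next
    case True
    then obtain k where k: "k \<in> letters" "k \<noteq> m" "bary (wt u) k p = bary (wt u) m p" by blast
    obtain i where i: "i \<in> letters" "i \<noteq> m" "i \<noteq> k" using third_letter by blast
    have "bary (wt u) 1 p + bary (wt u) 2 p + bary (wt u) 3 p = 1" using bary_sum nondegenerate_wt by blast
    \<comment> \<open>Three times the least coordinate is at most the sum 1; \<open>spokeI\<close>
      asks for the resulting bound 1/3.\<close>
    moreover have "3 * bary (wt u) m p \<le> bary (wt u) 1 p + bary (wt u) 2 p + bary (wt u) 3 p"
      using m(2)[of 1] m(2)[of 2] m(2)[of 3] by simp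
    ultimately have "bary (wt u) m p \<le> 1/3" by simp
    moreover have "bary (wt u) j p = bary (wt u) m p" if "j \<in> letters" "j \<noteq> i" for j
    proof -
      have "j = m \<or> j = k" using that m(1) k(1,2) i unfolding letters_def by auto
      then show ?thesis using k by auto
    qed
    ultimately have "p \<in> spoke (wt u) i" using pos by (intro spokeI[OF nondegenerate_wt i(1)]) auto
    then show ?thesis using i by blast
  qed
qed

lemma longest_word:
  assumes "S \<noteq> {}" "finite S" shows "\<exists>u\<in>S. \<forall>v\<in>S. length v \<le> length u"
proof -
  have f: "finite (length ` S)" "length ` S \<noteq> {}" using assms by auto
  from Max_in[OF this] obtain u where "u \<in> S" "Max (length ` S) = length u" by auto
  then show ?thesis using Max_ge[OF f(1)] by force
qed

text \<open>Take a longest node of the finite tree whose open triangle contains p. Were it internal,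
  \<open>otri_split\<close> would give a longer one or put p on an edge.\<close>

lemma finite_tree_cover:
  assumes t: "ternary_tree t" "finite t" and p: "p \<in> ctri root_triangle" "p \<notin> drawn_points (tree_drawing t)"
  obtains u where "u \<in> t" "u \<notin> internal_nodes t" "p \<in> otri (wt u)"
proof -
  let ?S = "{u \<in> t. p \<in> otri (wt u)}"
  have "p \<in> otri (wt [])"
    using p boundary_in_drawing[of p t] unfolding drawn_points_def by (auto simp: on_boundary_def)
  then have ne: "?S \<noteq> {}" "finite ?S" using tree_root[OF t(1)] t(2) by auto
  then obtain u where u: "u \<in> ?S" "\<forall>v\<in>?S. length v \<le> length u"
    using longest_word[OF ne] by blast
  have "u \<notin> internal_nodes t"
  proof
    assume i: "u \<in> internal_nodes t"
    from otri_split[of p u] u(1) consider j where "j \<in> letters" "p \<in> otri (wt (u @ [j]))"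
      | j where "j \<in> letters" "p \<in> spoke (wt u) j" by blast
    then show False
    proof cases
      case (1 j)
      then have "u @ [j] \<in> ?S" using internal_child[OF i] by simp
      then show False using u(2) by fastforce
    next
      case (2 j)
      then show False using p(2) i unfolding drawn_points_def edges_tree by blast
    qed
  qed
  then show thesis using u that by blast
qed

text \<open>Disjoint nonempty open connected sets that fill the complement of the drawing are its
  components. Finiteness of t enters through the covering by leaf triangles.\<close>

lemma tree_faces:
  assumes t: "ternary_tree t" "finite t"
  shows "faces (tree_drawing t) = insert (- ctri root_triangle) {otri (wt u) |u. u \<in> t \<and> u \<notin> internal_nodes t}"
  unfolding faces_def
proof (rule components_open_unique)
  let ?A = "insert (- ctri root_triangle) {otri (wt u) |u. u \<in> t \<and> u \<notin> internal_nodes t}"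
  let ?K = "ctri root_triangle"
  have sub: "otri (wt u) \<subseteq> ?K" if "u \<in> t" for u
    using ctri_append[OF tree_lists[OF t(1) that], of "[]"] otri_subset[of "wt u"] by simp
  have disj: "otri (wt u) \<inter> otri (wt v) = {}"
    if "u \<in> t" "u \<notin> internal_nodes t" "v \<in> t" "v \<notin> internal_nodes t" "u \<noteq> v" for u v
  proof -
    have "u \<in> lists letters" "v \<in> lists letters" using tree_lists[OF t(1)] that by auto
    then show ?thesis
    proof (cases rule: word_cases)
      case (diverge q i j v' w')
      then show ?thesis using diverging_otri_disjoint[of i j v' w' q] otri_ctri by blast
    qed (use that internal_prefix[OF t(1)] in blast)+
  qed
  show "pairwise disjnt ?A"
    unfolding pairwise_insert using disj sub
    by (auto simp: pairwise_def disjnt_def)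
  have b: "bounded ?K" using compact_ctri[OF nondegenerate_root] compact_imp_bounded by blast
  show "\<Union>?A = - (verts (tree_drawing t) \<union> \<Union>(edges (tree_drawing t)))"
    unfolding drawn_points_def[symmetric]
  proof (intro equalityI subsetI)
    fix p assume "p \<in> \<Union>?A"
    then show "p \<in> - drawn_points (tree_drawing t)"
      using leaf_otri_disjoint[OF t(1)] drawing_subset[OF t(1)] unfolding drawn_points_def by blast
  next
    fix p assume p: "p \<in> - drawn_points (tree_drawing t)"
    show "p \<in> \<Union>?A"
    proof (cases "p \<in> ?K")
      case True
      obtain u where "u \<in> t" "u \<notin> internal_nodes t" "p \<in> otri (wt u)"
        using finite_tree_cover[OF t True] p by blast
      then show ?thesis by blast
    qed simp
  qed
  fix X assume "X \<in> ?A"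
  then consider "X = - ?K" | u where "X = otri (wt u)" by blast
  then show "open X \<and> connected X \<and> X \<noteq> {}"
  proof cases
    case 1
    have "- ?K \<noteq> {}" using b not_bounded_UNIV by (metis Compl_empty_eq double_complement)
    then show ?thesis
      using 1 connected_complement_bounded_convex[OF b convex_ctri[OF nondegenerate_root]]
        compact_ctri[OF nondegenerate_root] compact_imp_closed by auto
  next
    case (2 u)
    then show ?thesis using open_otri convex_otri[OF nondegenerate_wt] convex_connected centre_otri by blast
  qed
qed

section \<open>Growing a finite tree at a leaf\<close>

definition grow :: "word set \<Rightarrow> word \<Rightarrow> word set" where
  "grow t u = t \<union> (\<lambda>i. u @ [i]) ` letters"

text \<open>The index counts internal nodes, that is, inserted vertices; the map then has 2 (k + 1)
  faces, whence the shift from k to \<open>Suc k\<close> in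
  \<open>stack_triangulations_trees\<close>.\<close>

definition finite_trees :: "nat \<Rightarrow> word set set" where
  "finite_trees k = {t. ternary_tree t \<and> finite t \<and> card (internal_nodes t) = k}"

lemma ternary_tree_iff:
  "ternary_tree t \<longleftrightarrow> [] \<in> t \<and> t \<subseteq> lists letters \<and> (\<forall>u i. u @ [i] \<in> t \<longrightarrow> u \<in> t \<and> (\<forall>j\<in>letters. u @ [j] \<in> t))"
  unfolding ternary_tree_def letters_def[symmetric]
proof (intro iffI conjI allI impI ballI; (elim conjE)?)
  assume *: "[] \<in> t" "t \<subseteq> lists letters" "\<forall>u i. u @ [i] \<in> t \<longrightarrow> u \<in> t"
    "\<forall>u\<in>t. (\<forall>i\<in>letters. u @ [i] \<notin> t) \<or> (\<forall>i\<in>letters. u @ [i] \<in> t)"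
  fix u i j assume ui: "u @ [i] \<in> t" "j \<in> letters"
  then have "u \<in> t" "i \<in> letters" using * by auto
  then show "u @ [j] \<in> t" using * ui by blast
qed auto

lemma ternary_grow:
  assumes t: "ternary_tree t" and u: "u \<in> t" shows "ternary_tree (grow t u)"
proof -
  have "u \<in> lists letters" using tree_lists[OF t u] .
  then show ?thesis using t u unfolding ternary_tree_iff grow_def by auto
qed

lemma internal_grow:
  assumes t: "ternary_tree t" and u: "u \<in> t" "u \<notin> internal_nodes t"
  shows "internal_nodes (grow t u) = insert u (internal_nodes t)"
proof -
  have 1: "1 \<in> letters" by simp
  have "v \<in> internal_nodes (grow t u) \<longleftrightarrow> v @ [1] \<in> grow t u" for v
    using internal_iff[OF ternary_grow[OF t u(1)] 1] .
  moreover have "v \<in> internal_nodes t \<longleftrightarrow> v @ [1] \<in> t" for v using internal_iff[OF t 1] .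
  ultimately show ?thesis unfolding grow_def by auto
qed

lemma finite_internal: "finite t \<Longrightarrow> finite (internal_nodes t)"
  using internal_subset finite_subset by blast

lemma grow_finite_trees:
  assumes "t \<in> finite_trees k" "u \<in> t" "u \<notin> internal_nodes t" shows "grow t u \<in> finite_trees (Suc k)"
  using assms ternary_grow[of t u] internal_grow[of t u] finite_internal[of t]
  by (auto simp: finite_trees_def) (simp add: grow_def)

text \<open>The children of an internal node of maximal length are leaves and can be cut
  off.\<close>

lemma finite_trees_Suc:
  assumes "t' \<in> finite_trees (Suc k)"
  obtains t u where "t \<in> finite_trees k" "u \<in> t" "u \<notin> internal_nodes t" "t' = grow t u"
proof -
  have t': "ternary_tree t'" "finite t'" "card (internal_nodes t') = Suc k" using assms by (auto simp: finite_trees_def)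
  let ?I = "internal_nodes t'"
  have ne: "?I \<noteq> {}" "finite ?I" using t' finite_internal by auto
  then obtain u where u: "u \<in> ?I" "\<forall>v\<in>?I. length v \<le> length u"
    using longest_word[OF ne] by blast
  define t where "t = t' - (\<lambda>i. u @ [i]) ` letters"
  have uc: "u @ [i] \<in> t'" "u @ [i] \<notin> ?I" if "i \<in> letters" for i
    using internal_child[OF u(1) that] u(2) by force+
  have eq: "t' = grow t u" unfolding grow_def t_def using uc by blast
  have ut: "u \<in> t" using u(1) internal_subset unfolding t_def by auto
  have tt: "ternary_tree t"
    unfolding ternary_tree_iff
  proof (intro conjI allI impI ballI)
    show "[] \<in> t" "t \<subseteq> lists letters" using t'(1) tree_root[of t'] tree_lists[of t'] unfolding t_def by auto
    fix v i assume vi: "v @ [i] \<in> t"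
    have vi': "v @ [i] \<in> t'" using vi t_def by blast
    have vI: "v \<in> ?I" using internal_prefix[OF t'(1), of v i "[]"] vi' by simp
    have vu: "v \<noteq> u" using vi tree_lists[OF t'(1) vi'] unfolding t_def by auto
    show "v \<in> t" using vI uc internal_subset unfolding t_def by blast
    show "v @ [j] \<in> t" if "j \<in> letters" for j using internal_child[OF vI that] vu unfolding t_def by auto
  qed
  have un: "u \<notin> internal_nodes t" using internal_iff[OF tt, of 1 u] letters_mem(2) unfolding t_def by auto
  have "card (internal_nodes t') = Suc (card (internal_nodes t))"
    unfolding eq internal_grow[OF tt ut un] using un t'(2) finite_internal[of t] by (simp add: t_def)
  then have "t \<in> finite_trees k" using tt t' by (simp add: finite_trees_def t_def)
  then show thesis using that ut un eq by blast
qed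

lemma finite_trees_0: "finite_trees 0 = {{[]}}"
proof (intro equalityI subsetI)
  fix t assume "t \<in> finite_trees 0"
  then have t: "ternary_tree t" "finite t" "card (internal_nodes t) = 0" by (simp_all add: finite_trees_def)
  then have e: "internal_nodes t = {}" using finite_internal[OF t(2)] by simp
  have "u = []" if "u \<in> t" for u
  proof (cases u rule: rev_cases)
    case (snoc v i)
    then show ?thesis using internal_prefix[OF t(1), of v i "[]"] that e by simp
  qed
  then show "t \<in> {{[]}}" using tree_root[OF t(1)] by auto
next
  fix t :: "word set" assume "t \<in> {{[]}}"
  then show "t \<in> finite_trees 0"
    by (simp add: finite_trees_def ternary_tree_iff internal_nodes_def)
qed

lemma tree_drawing_grow:
  assumes t: "ternary_tree t" and u: "u \<in> t" "u \<notin> internal_nodes t"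
  shows "tree_drawing (grow t u) = insert_vertex (tree_drawing t) (otri (wt u)) (centre (wt u))"
proof -
  have "frontier (otri (wt u)) = ctri (wt u) - otri (wt u)" by (rule frontier_otri[OF nondegenerate_wt])
  then have "verts (tree_drawing t) \<inter> frontier (otri (wt u)) = corners (wt u) - otri (wt u)"
    using leaf_verts[OF t u] by blast
  also have "\<dots> = corners (wt u)" using corners_not_otri[OF nondegenerate_wt] by blast
  finally have v: "verts (tree_drawing t) \<inter> frontier (otri (wt u)) = corners (wt u)" .
  show ?thesis
    unfolding insert_vertex_def v by (simp add: tree_drawing_def internal_grow[OF t u] Un_ac)
qed

lemma leaf_face:
  assumes t: "ternary_tree t" "finite t" and u: "u \<in> t" "u \<notin> internal_nodes t"
  shows "triangular_face (tree_drawing t) (otri (wt u))"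
proof -
  obtain A B C where T: "wt u = (A, B, C)" by (cases "wt u")
  have "otri (wt u) = interior (convex hull {A, B, C})"
    using interior_ctri[OF nondegenerate_wt[of u]] convex_hull_ctri[of A B C] nondegenerate_wt[of u] T by simp
  moreover have "verts (tree_drawing t) \<inter> frontier (otri (wt u)) = {A, B, C}"
  proof -
    have "verts (tree_drawing t) \<inter> frontier (otri (wt u)) = corners (wt u) - otri (wt u)"
      using leaf_verts[OF t(1) u] frontier_otri[OF nondegenerate_wt[of u]] by blast
    also have "\<dots> = corners (wt u)" using corners_not_otri[OF nondegenerate_wt] by blast
    finally show ?thesis by (simp add: T)
  qed
  ultimately show ?thesis unfolding triangular_face_def using tree_faces[OF t] u by blast
qed

section \<open>Stack-triangulations and finite trees\<close>

lemma homeo_component: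
  fixes h :: "complex \<Rightarrow> complex"
  assumes h: "homeomorphism UNIV UNIV h h'" and F: "F \<in> components X"
  shows "h ` F \<in> components (h ` X)"
  unfolding in_components_maximal
proof (intro conjI allI impI)
  note H = homeomorphism_UNIV[OF h]
  show "h ` F \<noteq> {}" "h ` F \<subseteq> h ` X" "connected (h ` F)"
    using F in_components_nonempty in_components_subset in_components_connected H(1) connected_continuous_image
    by blast+
  fix d assume d: "d \<noteq> {} \<and> h ` F \<subseteq> d \<and> d \<subseteq> h ` X \<and> connected d"
  have "h' ` d \<noteq> {}" using d by simp
  moreover have "F \<subseteq> h' ` d"
  proof
    fix x assume "x \<in> F"
    then have "h x \<in> d" using d by blast
    then show "x \<in> h' ` d" using imageI[of "h x" d h'] H(3) by simp
  qed
  moreover have "h' ` d \<subseteq> X"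
  proof
    fix x assume "x \<in> h' ` d"
    then obtain y where "y \<in> X" "x = h' (h y)" using d by blast
    then show "x \<in> X" using H(3) by simp
  qed
  moreover have "connected (h' ` d)" using d H(2) connected_continuous_image by blast
  ultimately have "h' ` d = F"
    using F[unfolded in_components_maximal, THEN conjunct2, THEN conjunct2, THEN conjunct2, THEN spec, of "h' ` d"]
    by simp
  then have "h ` F = h ` (h' ` d)" by simp
  then show "d = h ` F" by (simp add: image_image H(4))
qed

lemma homeo_closure:
  fixes h :: "complex \<Rightarrow> complex"
  assumes h: "homeomorphism UNIV UNIV h h'" shows "h ` closure X = closure (h ` X)"
proof
  show "h ` closure X \<subseteq> closure (h ` X)"
    by (rule image_closure_subset[OF homeomorphism_UNIV(1)[OF h] closed_closure closure_subset])
  show "closure (h ` X) \<subseteq> h ` closure X"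
    using homeo_closed_image[OF h] closure_subset by (intro closure_minimal) auto
qed

text \<open>h takes F to the open triangle of a leaf, but need not take x to its centre or the new
  edges to segments. Inside F it is replaced by the cone map over the same boundary values, which
  does both; since F misses the drawing, nothing already drawn moves.\<close>

lemma insert_vertex_iso:
  assumes t: "ternary_tree t" "finite t" and h: "map_iso h D (tree_drawing t)"
    and F: "triangular_face D F" and x: "x \<in> F"
  obtains u where "u \<in> t" "u \<notin> internal_nodes t" "same_map (insert_vertex D F x) (tree_drawing (grow t u))"
proof -
  obtain h' where h': "homeomorphism UNIV UNIV h h'" using map_isoD(1)[OF h] oriented_homeoD by blast
  note H = homeomorphism_UNIV[OF h'] and D = map_isoD[OF h]
  obtain A B C where ABC: "F = interior (convex hull {A, B, C})" using F unfolding triangular_face_def by blast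
  define T where "T = (A, B, C)"
  \<comment> \<open>A degenerate triangle has empty interior and could not contain x.\<close>
  have nT: "nondegenerate T" using degenerate_interior_empty[of A B C] x ABC by (auto simp: T_def nondegenerate.simps)
  have FT: "F = otri T" using ABC interior_ctri[OF nT] convex_hull_ctri[of A B C] nT by (simp add: T_def)
  have Fc: "F \<in> components (- drawn_points D)" using F unfolding triangular_face_def faces_def drawn_points_def by blast
  have F0: "F \<inter> drawn_points D = {}" using in_components_subset[OF Fc] by blast
  have img: "h ` (- drawn_points D) = - drawn_points (tree_drawing t)"
    using bij_image_Compl_eq[OF H(6)] map_iso_drawn_points[OF h] by simp
  have "h ` F \<in> faces (tree_drawing t)"
    using homeo_component[OF h' Fc, unfolded img] unfolding faces_def drawn_points_def .
  \<comment> \<open>F is bounded and homeomorphisms of the plane preserve boundedness, so its image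
    is not the outer face.\<close>
  moreover have "h ` F \<noteq> - ctri root_triangle"
  proof -
    have "bounded F" using compact_ctri[OF nT] compact_imp_bounded bounded_subset otri_subset unfolding FT by blast
    then have "bounded (h ` F)" using homeo_bounded_image[OF h'] by blast
    moreover have "\<not> bounded (- ctri root_triangle)"
      using compact_ctri[OF nondegenerate_root] compact_imp_bounded cobounded_imp_unbounded by blast
    ultimately show ?thesis by metis
  qed
  ultimately obtain u where u: "u \<in> t" "u \<notin> internal_nodes t" "h ` F = otri (wt u)"
    unfolding tree_faces[OF t] by blast
  define c where "c = centre (wt u)"
  have cl: "h ` ctri T = ctri (wt u)"
    using homeo_closure[OF h', of F] closure_otri[OF nT] closure_otri[OF nondegenerate_wt[of u]] u(3) FT by simp
  define \<rho> where "\<rho> = gauge_tri T x"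
  define \<sigma> where "\<sigma> = gauge_tri (wt u) c"
  have xT: "x \<in> otri T" using x FT by simp
  have cu: "c \<in> otri (wt u)" by (simp add: c_def)
  note \<rho>less = gauge_tri_less[OF nT xT, folded \<rho>_def] and \<rho>le = gauge_tri_le[OF nT xT, folded \<rho>_def]
    and \<sigma>less = gauge_tri_less[OF nondegenerate_wt cu, folded \<sigma>_def] and \<sigma>le = gauge_tri_le[OF nondegenerate_wt cu, folded \<sigma>_def]
  have g: "is_gauge x \<rho>" "is_gauge c \<sigma>"
    using gauge_tri[OF nT xT] gauge_tri[OF nondegenerate_wt cu] by (simp_all add: \<rho>_def \<sigma>_def)
  \<comment> \<open>h matches the open triangles and, passing to closures, the closed ones; hence it
    matches the level sets 1 of the two gauges, as the cone construction requires.\<close>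
  have less: "\<sigma> (h z) < 1 \<longleftrightarrow> \<rho> z < 1" for z
    unfolding \<rho>less \<sigma>less u(3)[symmetric] FT using H(5) by (simp add: inj_image_mem_iff)
  have le: "\<sigma> (h z) \<le> 1 \<longleftrightarrow> \<rho> z \<le> 1" for z
    unfolding \<rho>le \<sigma>le cl[symmetric] using H(5) by (simp add: inj_image_mem_iff)
  have bd: "\<rho> z = 1 \<longleftrightarrow> \<sigma> (h z) = 1" "1 < \<rho> z \<longleftrightarrow> 1 < \<sigma> (h z)" for z
    using less[of z] le[of z] by auto
  define k where "k = cone_map x c \<rho> h"
  have ko: "oriented_homeo k" unfolding k_def by (rule cone_map_oriented[OF g h' D(1) bd])
  have kx: "k x = c" unfolding k_def by (rule cone_map_centre[OF g(1)])
  have kh: "k z = h z" if "z \<notin> F" for z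
    unfolding k_def using that \<rho>less[of z] FT by (intro cone_map_outside) simp
  have kS: "k ` S = h ` S" if "S \<subseteq> drawn_points D" for S
    using that F0 kh by (intro image_cong) auto
  let ?V = "verts D \<inter> frontier F" and ?D = "insert_vertex D F x"
  let ?V' = "verts (tree_drawing t) \<inter> frontier (otri (wt u))"
  let ?D' = "insert_vertex (tree_drawing t) (otri (wt u)) c"
  have V: "h ` ?V = ?V'"
  proof -
    have "h ` frontier F = frontier (otri (wt u))"
      unfolding FT frontier_otri[OF nT] frontier_otri[OF nondegenerate_wt] image_set_diff[OF H(5)] cl
      using u(3) FT by simp
    then show ?thesis unfolding image_Int[OF H(5)] D(2) by simp
  qed
  have seg: "k ` closed_segment x v = closed_segment c (h v)" if "v \<in> ?V" for v
  proof -
    have "\<not> \<rho> v < 1" "\<rho> v \<le> 1" using that frontier_otri[OF nT] unfolding \<rho>less \<rho>le FT by auto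
    then have "\<rho> v = 1" by simp
    then show ?thesis unfolding k_def by (rule cone_map_segment[OF g(1)])
  qed
  have "map_iso k ?D ?D'"
    unfolding map_iso_def
  proof (intro conjI impI)
    show "oriented_homeo k" by (rule ko)
    have "k ` verts D = verts (tree_drawing t)" using kS[of "verts D"] D(2) by (simp add: drawn_points_def)
    then show "k ` verts ?D = verts ?D'" by (simp add: insert_vertex_def kx)
    have "(\<lambda>e. k ` e) ` edges D = (\<lambda>e. h ` e) ` edges D"
      by (intro image_cong refl kS) (auto simp: drawn_points_def)
    moreover have "(\<lambda>e. k ` e) ` (closed_segment x ` ?V) = closed_segment c ` ?V'"
      unfolding V[symmetric] image_image by (intro image_cong refl seg)
    ultimately show "(\<lambda>e. k ` e) ` edges ?D = edges ?D'"
      using D(3) by (simp add: insert_vertex_def image_Un)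
    have re: "path_image (root (tree_drawing t)) \<in> edges (tree_drawing t)"
      by (simp add: edges_tree root_triangle_def)
    then have rD: "path_image (root D) \<in> edges D" using D(5) by blast
    show "path_image (root ?D) \<in> edges ?D \<longleftrightarrow> path_image (root ?D') \<in> edges ?D'"
      using re rD by (simp add: insert_vertex_def)
    have kr: "k (root D s) = h (root D s)" if "s \<in> {0..1}" for s
    proof -
      have "root D s \<in> drawn_points D" using rD that unfolding drawn_points_def path_image_def by blast
      then show ?thesis using kh F0 by blast
    qed
    then show "k (root_vertex ?D) = root_vertex ?D'"
      using D(4) by (simp add: insert_vertex_def root_vertex_def pathstart_def)
    show "same_orientation k (root ?D) (root ?D')"
      using D(6)[OF rD] kr unfolding same_orientation_def by (simp add: insert_vertex_def)
  qed
  then have "same_map ?D (tree_drawing (grow t u))"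
    unfolding tree_drawing_grow[OF t(1) u(1,2)] same_map_iff c_def by blast
  then show thesis using that u by blast
qed

lemma Theta_tree: "Theta = tree_drawing {[]}"
proof -
  have "internal_nodes {[]} = {}" using finite_trees_0 finite_internal[of "{[]}"]
    by (auto simp: internal_nodes_def)
  then show ?thesis by (simp add: Theta_def tree_drawing_def)
qed

theorem stack_triangulations_trees:
  "stack_triangulations (Suc k) = (\<lambda>t. map_of_drawing (tree_drawing t)) ` finite_trees k"
proof (induction k)
  case 0
  then show ?case by (simp add: finite_trees_0 Theta_tree)
next
  case (Suc k)
  show ?case
  proof (intro equalityI subsetI)
    fix m assume "m \<in> stack_triangulations (Suc (Suc k))"
    then obtain D F x where m: "m = map_of_drawing (insert_vertex D F x)"
      "map_of_drawing D \<in> stack_triangulations (Suc k)" "triangular_face D F" "x \<in> F" by auto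
    then obtain t where t: "t \<in> finite_trees k" "map_of_drawing D = map_of_drawing (tree_drawing t)"
      unfolding Suc.IH by blast
    then obtain h where h: "map_iso h D (tree_drawing t)"
      unfolding map_of_drawing_eq_iff same_map_iff by blast
    have tt: "ternary_tree t" "finite t" using t(1) by (auto simp: finite_trees_def)
    obtain u where u: "u \<in> t" "u \<notin> internal_nodes t" "same_map (insert_vertex D F x) (tree_drawing (grow t u))"
      using insert_vertex_iso[OF tt h m(3,4)] by metis
    then have "m = map_of_drawing (tree_drawing (grow t u))" using m(1) map_of_drawing_eq_iff by simp
    then show "m \<in> (\<lambda>t. map_of_drawing (tree_drawing t)) ` finite_trees (Suc k)"
      using grow_finite_trees[OF t(1) u(1,2)] by blast
  next
    fix m assume "m \<in> (\<lambda>t. map_of_drawing (tree_drawing t)) ` finite_trees (Suc k)"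
    then obtain t' where t': "t' \<in> finite_trees (Suc k)" "m = map_of_drawing (tree_drawing t')" by blast
    obtain t u where t: "t \<in> finite_trees k" "u \<in> t" "u \<notin> internal_nodes t" "t' = grow t u"
      using finite_trees_Suc[OF t'(1)] by metis
    have tt: "ternary_tree t" "finite t" using t(1) by (auto simp: finite_trees_def)
    have "map_of_drawing (tree_drawing t) \<in> stack_triangulations (Suc k)" using t(1) unfolding Suc.IH by blast
    moreover have "m = map_of_drawing (insert_vertex (tree_drawing t) (otri (wt u)) (centre (wt u)))"
      using t'(2) t(4) tree_drawing_grow[OF tt(1) t(2,3)] by simp
    ultimately show "m \<in> stack_triangulations (Suc (Suc k))"
      unfolding stack_triangulations.simps(3) using leaf_face[OF tt t(2,3)] centre_otri[of u] by blast
  qed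
qed

lemma tree_drawing_inj: "inj_on (\<lambda>t. map_of_drawing (tree_drawing t)) {t. ternary_tree t}"
  using same_map_tree_inj by (intro inj_onI) (simp add: map_of_drawing_eq_iff)

section \<open>Stability of balls\<close>

definition trunc :: "nat \<Rightarrow> word set \<Rightarrow> word set" where
  "trunc h t = {u \<in> t. length u \<le> h}"

lemma trunc_internal:
  assumes "ternary_tree t" "ternary_tree t'" "trunc (Suc h) t = trunc (Suc h) t'" "length u \<le> h"
  shows "u \<in> internal_nodes t \<longleftrightarrow> u \<in> internal_nodes t'"
proof -
  have "u \<in> internal_nodes s \<longleftrightarrow> u @ [1] \<in> trunc (Suc h) s" if "ternary_tree s" for s
    unfolding internal_iff[OF that letters_mem(2)] using assms(4) by (simp add: trunc_def)
  then show ?thesis using assms(1-3) by simp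
qed

lemma corner_cases_append:
  assumes "z \<in> lists letters" "b \<in> corners (wt (w @ z))"
  shows "b \<in> corners (wt w) \<or> (\<exists>x. b = centre (wt (w @ x)) \<and> x \<in> lists letters)"
  using assms
proof (induction z rule: rev_induct)
  case (snoc i z)
  then have "i \<in> letters" "b \<in> corners (wt ((w @ z) @ [i]))" by auto
  then have "b = centre (wt (w @ z)) \<or> b \<in> corners (wt (w @ z))"
    unfolding corners_child[OF \<open>i \<in> letters\<close>] by (auto simp: corners_vtx)
  then show ?case using snoc by auto
qed simp

section \<open>Balls as sets of ends of short walks\<close>

lemma finite_neighbours:
  assumes t: "ternary_tree t" and f: "finite_degrees t"
  shows "finite {y. adj (tree_drawing t) x y}"
proof -
  have fc: "finite (corners T)" for T by (cases T) simp
  have "finite {v \<in> internal_nodes t. x = centre (wt v)}"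
  proof (cases "\<exists>v\<in>internal_nodes t. x = centre (wt v)")
    case True
    then obtain v where v: "v \<in> internal_nodes t" "x = centre (wt v)" by blast
    have "{v \<in> internal_nodes t. x = centre (wt v)} \<subseteq> {v}"
      using centre_inj internal_lists[OF t] v by blast
    then show ?thesis using finite_subset by blast
  next
    case False
    then have "{v \<in> internal_nodes t. x = centre (wt v)} = {}" by blast
    then show ?thesis by (simp only: finite.emptyI)
  qed
  moreover have "finite {v \<in> internal_nodes t. x \<in> corners (wt v)}" using f unfolding finite_degrees_def by blast
  moreover have "{y. adj (tree_drawing t) x y} \<subseteq> corners root_triangle
     \<union> (\<Union>v\<in>{v \<in> internal_nodes t. x = centre (wt v)}. corners (wt v))
     \<union> (\<lambda>v. centre (wt v)) ` {v \<in> internal_nodes t. x \<in> corners (wt v)}"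
    unfolding adj_tree_iff[OF t] by blast
  ultimately show ?thesis using finite_subset fc by (meson finite_UN_I finite_UnI finite_imageI)
qed

lemma finite_reach:
  assumes t: "ternary_tree t" and f: "finite_degrees t"
  shows "finite {x. (adj (tree_drawing t) ^^ n) 0 x}"
proof (induction n)
  case (Suc n)
  have "{x. (adj (tree_drawing t) ^^ Suc n) 0 x} = (\<Union>z\<in>{x. (adj (tree_drawing t) ^^ n) 0 x}. {y. adj (tree_drawing t) z y})"
    by (auto simp: OO_def)
  then show ?case using Suc finite_neighbours[OF t f] by auto
qed simp

definition reach :: "word set \<Rightarrow> nat \<Rightarrow> complex set" where
  "reach t r = {x. \<exists>n\<le>r. (adj (tree_drawing t) ^^ n) 0 x}"

lemma adj_in_verts: "adj D x y \<Longrightarrow> y \<in> verts D"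
  unfolding adj_def by blast

lemma reach_in_verts:
  assumes "(adj (tree_drawing t) ^^ n) 0 x" shows "x \<in> verts (tree_drawing t)"
proof (cases n)
  case 0
  then show ?thesis using assms by (simp add: verts_tree root_triangle_def)
next
  case (Suc m)
  then show ?thesis using assms adj_in_verts by (auto simp: OO_def)
qed

text \<open>\<open>graph_dist\<close> is a least number, meaningful only when some walk exists;
  connectedness provides one.\<close>

lemma ball_verts:
  assumes t: "ternary_tree t"
  shows "{v \<in> verts (tree_drawing t). graph_dist (tree_drawing t) (root_vertex (tree_drawing t)) v \<le> r} = reach t r"
proof (intro equalityI subsetI)
  fix v assume v: "v \<in> {v \<in> verts (tree_drawing t). graph_dist (tree_drawing t) (root_vertex (tree_drawing t)) v \<le> r}"
  have "symp (adj (tree_drawing t))" using adj_tree_sym[OF t] by (simp add: symp_def)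
  then have "(adj (tree_drawing t))\<^sup>*\<^sup>* 0 v"
    using connected_to_root[OF t] v by (metis (no_types, lifting) mem_Collect_eq sympD symp_rtranclp)
  then obtain n where "(adj (tree_drawing t) ^^ n) 0 v" using rtranclp_imp_relpowp by fast
  then have "(adj (tree_drawing t) ^^ graph_dist (tree_drawing t) 0 v) 0 v"
    unfolding graph_dist_def by (rule LeastI)
  then show "v \<in> reach t r" using v unfolding reach_def by auto
next
  fix v assume "v \<in> reach t r"
  then obtain n where n: "n \<le> r" "(adj (tree_drawing t) ^^ n) 0 v" unfolding reach_def by blast
  have "graph_dist (tree_drawing t) 0 v \<le> n" unfolding graph_dist_def using n(2) by (rule Least_le)
  then show "v \<in> {v \<in> verts (tree_drawing t). graph_dist (tree_drawing t) (root_vertex (tree_drawing t)) v \<le> r}"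
    using n reach_in_verts by auto
qed

text \<open>Makes the ends of a side independent of the tree.\<close>

lemma side_verts_corners:
  assumes "ternary_tree t" "e \<in> sides root_triangle"
  shows "e \<inter> verts (tree_drawing t) = e \<inter> corners root_triangle"
proof -
  obtain i j where "i \<in> letters" "j \<in> letters" "e \<inter> verts (tree_drawing t) = {vtx root_triangle i, vtx root_triangle j}"
    using side_verts[OF assms] by metis
  then have "e \<inter> verts (tree_drawing t) \<subseteq> corners root_triangle" by auto
  then show ?thesis unfolding verts_tree by blast
qed

lemma finite_bound:
  assumes "finite S" shows "\<exists>h. \<forall>v\<in>S. length v \<le> h"
  using assms by (auto intro: exI[of _ "Max (length ` S)"])

text \<open>The ball is finite, so the internal nodes with centre or a corner in it have lengths
  bounded by some h. A tree with the same top has no further such nodes deep down: a corner of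
  theirs is a corner of an ancestor that is itself too long for this, or the centre of a word that
  is too long. So the adjacencies at the ball, and with them the ball, agree.\<close>

theorem ball_stable:
  assumes t: "ternary_tree t" and f: "finite_degrees t"
  shows "\<exists>H. \<forall>t'. ternary_tree t' \<and> trunc H t' = trunc H t \<longrightarrow> map_ball (tree_drawing t') r = map_ball (tree_drawing t) r"
proof -
  define X where "X = reach t r"
  have "X = (\<Union>n\<in>{..r}. {x. (adj (tree_drawing t) ^^ n) 0 x})" unfolding X_def reach_def by blast
  then have fX: "finite X" using finite_reach[OF t f] by simp
  have X_verts: "x \<in> verts (tree_drawing t)" if "x \<in> X" for x
    using that reach_in_verts unfolding X_def reach_def by blast
  have "{v \<in> internal_nodes t. centre (wt v) \<in> X} = (\<lambda>v. centre (wt v)) -` X \<inter> internal_nodes t" by blast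
  moreover have "inj_on (\<lambda>v. centre (wt v)) (internal_nodes t)"
    using centre_inj internal_lists[OF t] by (intro inj_onI) blast
  ultimately have f1: "finite {v \<in> internal_nodes t. centre (wt v) \<in> X}"
    using fX finite_vimage_IntI by metis
  have f2: "finite (\<Union>b\<in>X. {v \<in> internal_nodes t. b \<in> corners (wt v)})"
    using fX f unfolding finite_degrees_def by blast
  obtain h where h: "\<forall>v\<in>{v \<in> internal_nodes t. centre (wt v) \<in> X} \<union> (\<Union>b\<in>X. {v \<in> internal_nodes t. b \<in> corners (wt v)}). length v \<le> h"
    using finite_bound[OF finite_UnI[OF f1 f2]] by blast
  have h1: "length v \<le> h" if "v \<in> internal_nodes t" "centre (wt v) \<in> X" for v using h that by blast
  have h2: "length v \<le> h" if "v \<in> internal_nodes t" "b \<in> X" "b \<in> corners (wt v)" for v b using h that by blast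
  show ?thesis
  proof (intro exI allI impI)
    \<comment> \<open>Equal truncations at height \<open>Suc (Suc h)\<close> give the same internal
      nodes up to length \<open>Suc h\<close>, one more than the bound h; the argument needs a
      shared node of this length.\<close>
    fix t' assume "ternary_tree t' \<and> trunc (Suc (Suc h)) t' = trunc (Suc (Suc h)) t"
    then have t': "ternary_tree t'" and tr: "trunc (Suc (Suc h)) t' = trunc (Suc (Suc h)) t" by simp_all
    have int: "u \<in> internal_nodes t' \<longleftrightarrow> u \<in> internal_nodes t" if "length u \<le> Suc h" for u
      using trunc_internal[OF t' t tr that] .
    have centre_iff: "v \<in> internal_nodes t' \<longleftrightarrow> v \<in> internal_nodes t"
      if v: "centre (wt v) \<in> X" "v \<in> lists letters" for v
    proof
      assume "v \<in> internal_nodes t" then show "v \<in> internal_nodes t'" using int[OF le_SucI[OF h1]] v(1) by blast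
    next
      assume "v \<in> internal_nodes t'"
      have "centre (wt v) \<notin> corners root_triangle"
      proof
        assume "centre (wt v) \<in> corners root_triangle"
        then have "on_boundary [] (centre (wt v))" by (rule root_corner_boundary)
        moreover have "centre (wt v) \<in> otri (wt [])" using subsetD[OF otri_append[OF v(2), of "[]"]] by simp
        ultimately show False using not_boundary_otri by blast
      qed
      then obtain w where "w \<in> internal_nodes t" "centre (wt v) = centre (wt w)"
        using X_verts[OF v(1)] unfolding verts_tree by blast
      then show "v \<in> internal_nodes t" using centre_inj v(2) internal_lists[OF t] by metis
    qed
    have corner_iff: "v \<in> internal_nodes t' \<longleftrightarrow> v \<in> internal_nodes t"
      if b: "b \<in> X" "b \<in> corners (wt v)" for v b
    proof
      assume "v \<in> internal_nodes t" then show "v \<in> internal_nodes t'" using int[OF le_SucI[OF h2]] b by blast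
    next
      assume v: "v \<in> internal_nodes t'"
      have vl: "v \<in> lists letters" using internal_lists[OF t' v] .
      show "v \<in> internal_nodes t"
      proof (rule ccontr)
        assume n: "v \<notin> internal_nodes t"
        then have lv: "Suc h < length v" using v int[of v] not_le by blast
        \<comment> \<open>The ancestor of v at length \<open>Suc h\<close> is internal in both trees
          and longer than any internal node of t incident to the ball.\<close>
        define w where "w = take (Suc h) v"
        define z where "z = drop (Suc h) v"
        have vz: "v = w @ z" and lw: "length w = Suc h" using lv by (simp_all add: w_def z_def)
        obtain i y where z: "z = i # y" using vz lw lv by (cases z) auto
        have "v \<in> t'" using v internal_subset by blast
        then have "w \<in> internal_nodes t'" using internal_prefix[OF t'] vz z by simp
        then have w: "w \<in> internal_nodes t" using int lw by simp
        have zl: "z \<in> lists letters" "w \<in> lists letters" using vl vz by auto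
        have "b \<notin> corners (wt w)" using h2[OF w b(1)] lw by auto
        then obtain x where x: "b = centre (wt (w @ x))" "x \<in> lists letters"
          using corner_cases_append[OF zl(1), of b w] b(2) vz by blast
        have "b \<notin> corners root_triangle"
        proof
          assume "b \<in> corners root_triangle"
          then have "on_boundary [] b" by (rule root_corner_boundary)
          moreover have "b \<in> otri (wt [])"
            using subsetD[OF otri_append[of "w @ x" "[]"], of b] zl x by auto
          ultimately show False using not_boundary_otri by blast
        qed
        then obtain w0 where w0: "w0 \<in> internal_nodes t" "b = centre (wt w0)"
          using X_verts[OF b(1)] unfolding verts_tree by blast
        then have "w @ x = w0" using centre_inj[of "w @ x" w0] x zl internal_lists[OF t w0(1)] by simp
        then show False using h1[OF w0(1)] w0(2) b(1) lw by auto
      qed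
    qed
    have adj_eq: "adj (tree_drawing t') x y \<longleftrightarrow> adj (tree_drawing t) x y" if x: "x \<in> X" for x y
    proof -
      have "v \<in> internal_nodes t' \<longleftrightarrow> v \<in> internal_nodes t"
        if "x = centre (wt v) \<or> x \<in> corners (wt v)" "v \<in> lists letters" for v
        using that x centre_iff[of v] corner_iff[of x v] by blast
      then have "(\<exists>v\<in>internal_nodes t'. x = centre (wt v) \<and> y \<in> corners (wt v) \<or> y = centre (wt v) \<and> x \<in> corners (wt v)) \<longleftrightarrow>
        (\<exists>v\<in>internal_nodes t. x = centre (wt v) \<and> y \<in> corners (wt v) \<or> y = centre (wt v) \<and> x \<in> corners (wt v))"
        using internal_lists[OF t] internal_lists[OF t'] by blast
      then show ?thesis unfolding adj_tree_iff[OF t] adj_tree_iff[OF t'] by simp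
    qed
    have reach_eq: "(adj (tree_drawing t') ^^ n) 0 x \<longleftrightarrow> (adj (tree_drawing t) ^^ n) 0 x" if "n \<le> r" for n x
      using that
    proof (induction n arbitrary: x)
      case (Suc n)
      have "z \<in> X" if "(adj (tree_drawing t) ^^ n) 0 z" for z
        using that Suc.prems unfolding X_def reach_def by (auto intro: exI[of _ n])
      then show ?case using Suc adj_eq by (auto simp: OO_def)
    qed simp
    have R: "reach t' r = X" unfolding X_def reach_def using reach_eq by blast
    \<comment> \<open>Stated for an arbitrary pair of trees, to be used in both directions.\<close>
    have E: "e \<in> edges (tree_drawing s')" "e \<inter> verts (tree_drawing s') \<subseteq> X"
      if e: "e \<in> edges (tree_drawing s)" "e \<inter> verts (tree_drawing s) \<subseteq> X"
        and s: "ternary_tree s" "ternary_tree s'"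
        and iff: "\<And>v. centre (wt v) \<in> X \<Longrightarrow> v \<in> lists letters \<Longrightarrow> v \<in> internal_nodes s \<Longrightarrow> v \<in> internal_nodes s'" for e s s'
    proof -
      from e(1) consider "e \<in> sides root_triangle" | v c where "e = spoke (wt v) c" "v \<in> internal_nodes s" "c \<in> letters"
        unfolding edges_tree by blast
      then have "e \<in> edges (tree_drawing s') \<and> e \<inter> verts (tree_drawing s') \<subseteq> X"
      proof cases
        case 1
        then show ?thesis using e(2) side_verts_corners[OF s(1) 1] side_verts_corners[OF s(2) 1]
          unfolding edges_tree by blast
      next
        case (2 v c)
        have "centre (wt v) \<in> X" using e(2) spoke_verts[OF s(1) 2(2,3)] 2(1) by blast
        then have "v \<in> internal_nodes s'" using iff internal_lists[OF s(1) 2(2)] 2(2) by blast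
        then show ?thesis using spoke_verts[OF s(2) _ 2(3), of v] spoke_verts[OF s(1) 2(2,3)] e(2) 2 unfolding edges_tree by blast
      qed
      then show "e \<in> edges (tree_drawing s')" "e \<inter> verts (tree_drawing s') \<subseteq> X" by simp_all
    qed
    have "{e \<in> edges (tree_drawing t'). e \<inter> verts (tree_drawing t') \<subseteq> X} = {e \<in> edges (tree_drawing t). e \<inter> verts (tree_drawing t) \<subseteq> X}"
      using E[of _ t' t] E[of _ t t'] centre_iff t t' by blast
    then show "map_ball (tree_drawing t') r = map_ball (tree_drawing t) r"
      unfolding map_ball_def Let_def ball_verts[OF t] ball_verts[OF t'] R X_def[symmetric]
      by (simp add: tree_drawing_def)
  qed
qed

section \<open>Generating function of finite trees\<close>

definition subtree :: "word set \<Rightarrow> nat \<Rightarrow> word set" where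
  "subtree t i = {w. i # w \<in> t}"

definition node :: "word set \<Rightarrow> word set \<Rightarrow> word set \<Rightarrow> word set" where
  "node a b c = insert [] ((#) 1 ` a \<union> (#) 2 ` b \<union> (#) 3 ` c)"

lemma subtree_node [simp]:
  "subtree (node a b c) (Suc 0) = a" "subtree (node a b c) 1 = a" "subtree (node a b c) 2 = b" "subtree (node a b c) 3 = c"
  by (auto simp: subtree_def node_def)

lemma tree_decomp:
  assumes "ternary_tree t"
  shows "u \<in> t \<longleftrightarrow> u = [] \<or> (\<exists>i\<in>letters. \<exists>w\<in>subtree t i. u = i # w)"
  using tree_root[OF assms] tree_lists[OF assms, of u] by (cases u) (auto simp: subtree_def)

lemma node_subtrees:
  assumes "ternary_tree t"
  shows "t = node (subtree t 1) (subtree t 2) (subtree t 3)"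
  using tree_decomp[OF assms] by (auto simp: node_def bex_letters set_eq_iff)

lemma ternary_node:
  assumes "ternary_tree a" "ternary_tree b" "ternary_tree c" shows "ternary_tree (node a b c)"
  unfolding ternary_tree_iff
proof (intro conjI allI impI ballI)
  have L: "a \<subseteq> lists letters" "b \<subseteq> lists letters" "c \<subseteq> lists letters"
    using tree_lists assms by blast+
  show "[] \<in> node a b c" by (simp add: node_def)
  show "node a b c \<subseteq> lists letters"
  proof
    fix x assume "x \<in> node a b c"
    then consider "x = []" | w where "x = 1 # w" "w \<in> a" | w where "x = 2 # w" "w \<in> b" | w where "x = 3 # w" "w \<in> c"
      by (auto simp: node_def)
    then show "x \<in> lists letters" using L by cases auto
  qed
  fix u i assume ui: "u @ [i] \<in> node a b c"
  have *: "u \<in> node a b c \<and> (\<forall>j\<in>letters. u @ [j] \<in> node a b c)"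
  proof (cases u)
    case Nil
    then show ?thesis using assms tree_root by (auto simp: node_def ball_letters)
  next
    case (Cons k w)
    have r: "w \<in> x \<and> (\<forall>j\<in>letters. w @ [j] \<in> x)" if "ternary_tree x" "w @ [i] \<in> x" for x
      using that unfolding ternary_tree_iff by blast
    from ui Cons consider "k = 1" "w @ [i] \<in> a" | "k = 2" "w @ [i] \<in> b" | "k = 3" "w @ [i] \<in> c"
      by (auto simp: node_def)
    then show ?thesis using r assms Cons by cases (auto simp: node_def)
  qed
  then show "u \<in> node a b c" by blast
  show "u @ [j] \<in> node a b c" if "j \<in> letters" for j using * that by blast
qed

lemma ternary_subtree:
  assumes t: "ternary_tree t" and i: "[] \<in> internal_nodes t" "i \<in> letters"
  shows "ternary_tree (subtree t i)"
  unfolding ternary_tree_iff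
proof (intro conjI allI impI ballI)
  have c: "[i] \<in> t" using internal_child[OF i] by simp
  then show "[] \<in> subtree t i" by (simp add: subtree_def)
  show "subtree t i \<subseteq> lists letters"
  proof
    fix w assume "w \<in> subtree t i"
    then show "w \<in> lists letters" using tree_lists[OF t, of "i # w"] by (simp add: subtree_def)
  qed
  fix u k assume "u @ [k] \<in> subtree t i"
  then have *: "(i # u) @ [k] \<in> t" by (simp add: subtree_def)
  then show "u \<in> subtree t i" using tree_parent[OF t *] by (simp add: subtree_def)
  show "u @ [j] \<in> subtree t i" if "j \<in> letters" for j
    using * t that unfolding ternary_tree_iff subtree_def by (metis append_Cons mem_Collect_eq)
qed

lemma internal_subtree:
  assumes t: "ternary_tree t" and i: "[] \<in> internal_nodes t" "i \<in> letters"
  shows "internal_nodes (subtree t i) = {w. i # w \<in> internal_nodes t}"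
  by (auto simp: internal_nodes_def subtree_def)

lemma internal_decomp:
  assumes t: "ternary_tree t" and i: "[] \<in> internal_nodes t"
  shows "internal_nodes t = insert [] ((#) 1 ` internal_nodes (subtree t 1) \<union> (#) 2 ` internal_nodes (subtree t 2)
     \<union> (#) 3 ` internal_nodes (subtree t 3))"
proof (intro set_eqI iffI)
  fix u assume u: "u \<in> internal_nodes t"
  show "u \<in> insert [] ((#) 1 ` internal_nodes (subtree t 1) \<union> (#) 2 ` internal_nodes (subtree t 2)
     \<union> (#) 3 ` internal_nodes (subtree t 3))"
  proof (cases u)
    case (Cons k w)
    then have "k \<in> letters" using internal_lists[OF t u] by simp
    then show ?thesis using u Cons internal_subtree[OF t i] by (elim letters_cases) auto
  qed simp
qed (use i in \<open>auto simp: internal_subtree[OF t i]\<close>)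

lemma finite_finite_trees: "finite (finite_trees k)"
proof (induction k)
  case 0 then show ?case by (simp add: finite_trees_0)
next
  case (Suc k)
  have "finite_trees (Suc k) \<subseteq> (\<Union>t\<in>finite_trees k. grow t ` t)"
  proof
    fix t' assume "t' \<in> finite_trees (Suc k)"
    then obtain t u where "t \<in> finite_trees k" "u \<in> t" "t' = grow t u" using finite_trees_Suc by metis
    then show "t' \<in> (\<Union>t\<in>finite_trees k. grow t ` t)" by blast
  qed
  moreover have "finite (\<Union>t\<in>finite_trees k. grow t ` t)" using Suc by (auto simp: finite_trees_def)
  ultimately show ?case using finite_subset by blast
qed

lemma finite_trees_node:
  assumes "a \<in> finite_trees i" "b \<in> finite_trees j" "c \<in> finite_trees l"
  shows "node a b c \<in> finite_trees (Suc (i + j + l))" "[] \<in> internal_nodes (node a b c)"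
proof -
  have t: "ternary_tree a" "ternary_tree b" "ternary_tree c" and f: "finite a" "finite b" "finite c"
    and cd: "card (internal_nodes a) = i" "card (internal_nodes b) = j" "card (internal_nodes c) = l"
    using assms by (auto simp: finite_trees_def)
  have tn: "ternary_tree (node a b c)" using ternary_node t by blast
  show n: "[] \<in> internal_nodes (node a b c)"
    unfolding internal_iff[OF tn letters_mem(2)] using tree_root[OF t(1)] by (simp add: node_def)
  have fi: "finite (internal_nodes a)" "finite (internal_nodes b)" "finite (internal_nodes c)"
    using f finite_internal by blast+
  have "internal_nodes (node a b c) = insert [] ((#) 1 ` internal_nodes a \<union> (#) 2 ` internal_nodes b \<union> (#) 3 ` internal_nodes c)"
    using internal_decomp[OF tn n] by simp
  also have "card \<dots> = Suc (card ((#) 1 ` internal_nodes a \<union> (#) 2 ` internal_nodes b \<union> (#) 3 ` internal_nodes c))"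
    using fi by (subst card_insert_disjoint) auto
  also have "card ((#) 1 ` internal_nodes a \<union> (#) 2 ` internal_nodes b \<union> (#) 3 ` internal_nodes c) = i + j + l"
  proof -
    have ci: "card ((#) x ` A) = card A" for x :: nat and A by (rule card_image) simp
    show ?thesis using fi by (subst card_Un_disjoint; (subst card_Un_disjoint)?) (auto simp: ci cd)
  qed
  finally have "card (internal_nodes (node a b c)) = Suc (i + j + l)" .
  moreover have "finite (node a b c)" using f by (simp add: node_def)
  ultimately show "node a b c \<in> finite_trees (Suc (i + j + l))" using tn by (simp add: finite_trees_def)
qed

lemma finite_trees_subtrees:
  assumes "t \<in> finite_trees k" "[] \<in> internal_nodes t"
  shows "\<exists>i j l. k = Suc (i + j + l) \<and> subtree t 1 \<in> finite_trees i \<and> subtree t 2 \<in> finite_trees j \<and> subtree t 3 \<in> finite_trees l"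
proof -
  have t: "ternary_tree t" "finite t" using assms(1) by (auto simp: finite_trees_def)
  have "finite (subtree t i)" for i
    using t(2) finite_vimageI[of t "(#) i"] by (simp add: subtree_def vimage_def)
  then have s: "subtree t i \<in> finite_trees (card (internal_nodes (subtree t i)))" if "i \<in> letters" for i
    using ternary_subtree[OF t(1) assms(2) that] by (simp add: finite_trees_def)
  have "node (subtree t 1) (subtree t 2) (subtree t 3) \<in> finite_trees (Suc (card (internal_nodes (subtree t 1))
     + card (internal_nodes (subtree t 2)) + card (internal_nodes (subtree t 3))))"
    by (intro finite_trees_node s) auto
  then have "k = Suc (card (internal_nodes (subtree t 1))
     + card (internal_nodes (subtree t 2)) + card (internal_nodes (subtree t 3)))"
    using node_subtrees[OF t(1)] assms(1) by (auto simp: finite_trees_def)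
  then show ?thesis using s[of 1] s[of 2] s[of 3] letters_mem by blast
qed

lemma finite_trees_disjoint: "t \<in> finite_trees i \<Longrightarrow> t \<in> finite_trees j \<Longrightarrow> i = j"
  by (simp add: finite_trees_def)

section \<open>Functional equation and coefficients of the generating function\<close>

definition tree_gf :: "(word set \<Rightarrow> bool) \<Rightarrow> real fps" where
  "tree_gf P = Abs_fps (\<lambda>k. real (card {t \<in> finite_trees k. P t}))"

lemma card_UN_Times:
  assumes "finite I" "\<And>i. i \<in> I \<Longrightarrow> finite (A i)" "\<And>i. i \<in> I \<Longrightarrow> finite (B i)"
    and "\<And>i j x. i \<in> I \<Longrightarrow> j \<in> I \<Longrightarrow> x \<in> A i \<Longrightarrow> x \<in> A j \<Longrightarrow> i = j"
  shows "card (\<Union>i\<in>I. A i \<times> B i) = (\<Sum>i\<in>I. card (A i) * card (B i))"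
proof -
  have "card (\<Union>i\<in>I. A i \<times> B i) = (\<Sum>i\<in>I. card (A i \<times> B i))"
    using assms by (intro card_UN_disjoint) auto
  then show ?thesis by (simp add: card_cartesian_product)
qed

text \<open>\<open>node\<close> is a bijection from triples of trees to trees with internal root,
  and the factor X counts the root. The index sets in the proof are nested like the Cauchy products
  on the right.\<close>

lemma tree_gf_node:
  "tree_gf (\<lambda>t. [] \<in> internal_nodes t \<and> P (subtree t 1) \<and> Q (subtree t 2) \<and> R (subtree t 3))
     = fps_X * (tree_gf P * (tree_gf Q * tree_gf R))"
proof (rule fps_ext)
  let ?S = "\<lambda>k. {t \<in> finite_trees k. [] \<in> internal_nodes t \<and> P (subtree t 1) \<and> Q (subtree t 2) \<and> R (subtree t 3)}"
  let ?A = "\<lambda>P k. {t \<in> finite_trees k. P t}"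
  fix n
  show "tree_gf (\<lambda>t. [] \<in> internal_nodes t \<and> P (subtree t 1) \<and> Q (subtree t 2) \<and> R (subtree t 3)) $ n
     = (fps_X * (tree_gf P * (tree_gf Q * tree_gf R))) $ n"
  proof (cases n)
    case 0
    have "?S 0 = {}" by (auto simp: finite_trees_0 internal_nodes_def)
    then show ?thesis using 0 by (simp only: tree_gf_def fps_nth_Abs_fps card.empty) simp
  next
    case (Suc k)
    let ?U = "\<Union>i\<in>{0..k}. ?A P i \<times> (\<Union>j\<in>{0..k - i}. ?A Q j \<times> ?A R (k - i - j))"
    have "bij_betw (\<lambda>(a, b, c). node a b c) ?U (?S (Suc k))"
    proof (rule bij_betw_imageI)
      show "inj_on (\<lambda>(a, b, c). node a b c) ?U"
      proof (rule inj_onI)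
        fix x y assume xy: "(\<lambda>(a, b, c). node a b c) x = (\<lambda>(a, b, c). node a b c) y"
        obtain a b c a' b' c' where e: "x = (a, b, c)" "y = (a', b', c')" by (cases x, cases y) auto
        have "subtree (node a b c) i = subtree (node a' b' c') i" for i using xy e by simp
        from this[of 1] this[of 2] this[of 3] show "x = y" using e by simp
      qed
      show "(\<lambda>(a, b, c). node a b c) ` ?U = ?S (Suc k)"
      proof (intro equalityI subsetI)
        fix t assume "t \<in> (\<lambda>(a, b, c). node a b c) ` ?U"
        then obtain a b c i j where *: "t = node a b c" "i \<le> k" "j \<le> k - i" "a \<in> ?A P i" "b \<in> ?A Q j" "c \<in> ?A R (k - i - j)"
          by auto
        then have "Suc (i + j + (k - i - j)) = Suc k" by simp
        then show "t \<in> ?S (Suc k)" using * finite_trees_node[of a i b j c "k - i - j"] by auto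
      next
        fix t assume t: "t \<in> ?S (Suc k)"
        then obtain i j l where *: "Suc k = Suc (i + j + l)" "subtree t 1 \<in> finite_trees i"
          "subtree t 2 \<in> finite_trees j" "subtree t 3 \<in> finite_trees l"
          using finite_trees_subtrees[of t "Suc k"] by auto
        have tn: "t = node (subtree t 1) (subtree t 2) (subtree t 3)"
          using t node_subtrees by (auto simp: finite_trees_def)
        have "l = k - i - j" "i \<le> k" "j \<le> k - i" using * by simp_all
        have "(subtree t 2, subtree t 3) \<in> (\<Union>j\<in>{0..k - i}. ?A Q j \<times> ?A R (k - i - j))"
          by (rule UN_I[of j]) (use * t \<open>l = k - i - j\<close> \<open>j \<le> k - i\<close> in auto)
        then have "(subtree t 1, subtree t 2, subtree t 3) \<in> ?U"
          by (intro UN_I[of i]) (use * t \<open>i \<le> k\<close> in auto)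
        then show "t \<in> (\<lambda>(a, b, c). node a b c) ` ?U" using tn by (metis (no_types, lifting) case_prod_conv image_eqI)
      qed
    qed
    then have "card (?S (Suc k)) = card ?U" by (rule bij_betw_same_card[symmetric])
    also have "card ?U = (\<Sum>i\<in>{0..k}. card (?A P i) * card (\<Union>j\<in>{0..k - i}. ?A Q j \<times> ?A R (k - i - j)))"
      using finite_finite_trees finite_trees_disjoint by (intro card_UN_Times) auto
    also have "\<dots> = (\<Sum>i\<in>{0..k}. card (?A P i) * (\<Sum>j\<in>{0..k - i}. card (?A Q j) * card (?A R (k - i - j))))"
      using finite_finite_trees finite_trees_disjoint by (intro sum.cong refl arg_cong2[of _ _ _ _ "(*)"] card_UN_Times) auto
    finally have "tree_gf (\<lambda>t. [] \<in> internal_nodes t \<and> P (subtree t 1) \<and> Q (subtree t 2) \<and> R (subtree t 3)) $ n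
       = (tree_gf P * (tree_gf Q * tree_gf R)) $ k"
      using Suc by (simp add: tree_gf_def fps_mult_nth)
    then show ?thesis using Suc by (simp only: fps_X_mult_nth) simp
  qed
qed

abbreviation "tree_series \<equiv> tree_gf (\<lambda>_. True)"

lemma tree_gf_add:
  assumes "\<And>t. P t \<longleftrightarrow> Q t \<or> R t" "\<And>t. \<not> (Q t \<and> R t)"
  shows "tree_gf P = tree_gf Q + tree_gf R"
proof (rule fps_ext)
  fix n
  have "{t \<in> finite_trees n. P t} = {t \<in> finite_trees n. Q t} \<union> {t \<in> finite_trees n. R t}" using assms by blast
  then have "card {t \<in> finite_trees n. P t} = card {t \<in> finite_trees n. Q t} + card {t \<in> finite_trees n. R t}"
    using assms(2) finite_finite_trees by (subst card_Un_disjoint[symmetric]) auto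
  then show "tree_gf P $ n = (tree_gf Q + tree_gf R) $ n" by (simp add: tree_gf_def)
qed

lemma tree_gf_leaf: "tree_gf (\<lambda>t. t = {[]}) = 1"
proof (rule fps_ext)
  fix n
  have "{t \<in> finite_trees n. t = {[]}} = (if n = 0 then {{[]}} else {})"
    using finite_trees_disjoint[of "{[]}" 0 n] by (auto simp: finite_trees_0)
  then show "tree_gf (\<lambda>t. t = {[]}) $ n = 1 $ n" by (simp add: tree_gf_def)
qed

lemma leaf_or_internal:
  assumes "ternary_tree t" shows "t = {[]} \<longleftrightarrow> [] \<notin> internal_nodes t"
proof
  assume "[] \<notin> internal_nodes t"
  moreover have "[] \<in> internal_nodes t" if "k # w \<in> t" for k w
    using internal_prefix[OF assms, of "[]" k w] that by simp
  ultimately show "t = {[]}" using tree_root[OF assms] by (metis (no_types, lifting) ext empty_iff equalityI insertE neq_Nil_conv singletonI subsetI)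
qed (auto simp: internal_nodes_def)

lemma tree_gf_cong: "(\<And>t. ternary_tree t \<Longrightarrow> finite t \<Longrightarrow> P t \<longleftrightarrow> Q t) \<Longrightarrow> tree_gf P = tree_gf Q"
proof -
  assume "\<And>t. ternary_tree t \<Longrightarrow> finite t \<Longrightarrow> P t \<longleftrightarrow> Q t"
  then have "{t \<in> finite_trees n. P t} = {t \<in> finite_trees n. Q t}" for n by (auto simp: finite_trees_def)
  then show ?thesis by (simp add: tree_gf_def)
qed

lemma tree_series_eq: "tree_series = 1 + fps_X * tree_series ^ 3"
proof -
  have "tree_series = tree_gf (\<lambda>t. [] \<notin> internal_nodes t) + tree_gf (\<lambda>t. [] \<in> internal_nodes t)"
    by (rule tree_gf_add) auto
  also have "tree_gf (\<lambda>t. [] \<notin> internal_nodes t) = 1"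
    using tree_gf_leaf tree_gf_cong[of "\<lambda>t. [] \<notin> internal_nodes t" "\<lambda>t. t = {[]}"] leaf_or_internal by simp
  also have "tree_gf (\<lambda>t. [] \<in> internal_nodes t) = fps_X * tree_series ^ 3"
    using tree_gf_node[of "\<lambda>_. True" "\<lambda>_. True" "\<lambda>_. True"] by (simp add: power3_eq_cube mult.assoc)
  finally show ?thesis .
qed

lemma tree_series_power: "tree_series ^ Suc l = tree_series ^ l + fps_X * tree_series ^ (l + 3)"
proof -
  have "tree_series ^ Suc l = tree_series ^ l * tree_series" by (simp add: mult.commute)
  also have "\<dots> = tree_series ^ l * (1 + fps_X * tree_series ^ 3)" using tree_series_eq by simp
  finally show ?thesis by (simp add: algebra_simps power_add)
qed

lemma tree_series_0: "(tree_series ^ l) $ 0 = 1"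
proof -
  have "tree_series $ 0 = 1" by (subst tree_series_eq) simp
  then show ?thesis by (simp add: fps_nth_power_0)
qed

text \<open>The numbers l / (3 M + l) times \<open>(3 M + l) choose M\<close> satisfy the recurrence
  of \<open>tree_series_power\<close>, written here for the coefficient M + 1. Multiplied by M + 1,
  all terms become multiples of \<open>n choose M\<close>, and what remains is (l + 1) n = l (n - M)
  + (l + 3) (M + 1).\<close>

lemma ballot_recurrence:
  fixes l M :: nat
  defines "n \<equiv> 3 * M + 3 + l"
  shows "real (l + 1) / real (n + 1) * real ((n + 1) choose (M + 1)) =
    real l / real n * real (n choose (M + 1)) + real (l + 3) / real n * real (n choose M)"
proof -
  have n: "0 < real n" by (simp add: n_def)
  have 1: "real (M + 1) * real ((n + 1) choose (M + 1)) = real (n + 1) * real (n choose M)"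
    using Suc_times_binomial_eq[of n M] by (metis Suc_eq_plus1 mult.commute of_nat_mult)
  have 2: "real (M + 1) * real (n choose (M + 1)) = (real n - real M) * real (n choose M)"
  proof -
    have "real ((n + 1) choose (M + 1)) = real (n choose M) + real (n choose (M + 1))" by simp
    then show ?thesis using 1 by (simp add: algebra_simps)
  qed
  have "real (M + 1) * (real (l + 1) / real (n + 1) * real ((n + 1) choose (M + 1)))
      = real (l + 1) / real (n + 1) * (real (M + 1) * real ((n + 1) choose (M + 1)))" by simp
  also have "\<dots> = real (l + 1) * real (n choose M)" unfolding 1 by simp
  also have "\<dots> = (real (l + 1) * real n / real n) * real (n choose M)" using n by simp
  also have "real (l + 1) * real n = real l * (real n - real M) + real (l + 3) * real (M + 1)"
    by (simp add: n_def algebra_simps)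
  also have "(real l * (real n - real M) + real (l + 3) * real (M + 1)) / real n * real (n choose M)
     = real l / real n * ((real n - real M) * real (n choose M)) + real (M + 1) * (real (l + 3) / real n * real (n choose M))"
    by (simp add: add_divide_distrib algebra_simps)
  also have "\<dots> = real (M + 1) * (real l / real n * real (n choose (M + 1)) + real (l + 3) / real n * real (n choose M))"
    unfolding 2[symmetric] by (simp add: algebra_simps add_divide_distrib)
  finally show ?thesis by (simp only: mult_left_cancel)
qed

text \<open>These are the Fuss-Catalan (Raney) numbers. Induction on M and, for fixed M, on l along
  the recurrence; at l = 0 both sides vanish for positive M. The hypothesis excludes just l = M = 0,
  where the coefficient is 1 but the formula reads 0 / 0.\<close>

lemma tree_series_coeff:
  "0 < l + M \<Longrightarrow> (tree_series ^ l) $ M = real l / real (3 * M + l) * real ((3 * M + l) choose M)"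
proof (induction M arbitrary: l)
  case 0
  then show ?case using tree_series_0 by simp
next
  case (Suc M)
  note IH = Suc.IH
  show ?case
  proof (induction l)
    case (Suc l)
    have "(tree_series ^ Suc l) $ Suc M = (tree_series ^ l) $ Suc M + (tree_series ^ (l + 3)) $ M"
      by (subst tree_series_power) (simp add: fps_X_mult_nth)
    also have "(tree_series ^ (l + 3)) $ M = real (l + 3) / real (3 * M + (l + 3)) * real ((3 * M + (l + 3)) choose M)"
      by (rule IH) simp
    finally show ?case using Suc.IH ballot_recurrence[of l M] by (simp add: algebra_simps)
  qed simp
qed

section \<open>Conditioning on the top of a finite tree\<close>

lemma subtree_trunc: "subtree (trunc (Suc h) t) i = trunc h (subtree t i)"
  by (auto simp: trunc_def subtree_def)

lemma trunc_0: "ternary_tree t \<Longrightarrow> trunc 0 t = {[]}"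
  using tree_root by (auto simp: trunc_def)

lemma ternary_trunc:
  assumes "ternary_tree t" shows "ternary_tree (trunc h t)"
  using assms unfolding ternary_tree_iff trunc_def by auto

lemma trunc_trunc [simp]: "trunc h (trunc h t) = trunc h t"
  by (auto simp: trunc_def)

lemma root_internal_trunc: "ternary_tree t \<Longrightarrow> [] \<in> internal_nodes (trunc (Suc h) t) \<longleftrightarrow> [] \<in> internal_nodes t"
  by (auto simp: internal_nodes_def trunc_def)

lemma trunc_Suc_leaf_iff:
  assumes "ternary_tree t"
  shows "trunc (Suc h) t = {[]} \<longleftrightarrow> t = {[]}"
  using leaf_or_internal[OF ternary_trunc[OF assms, of "Suc h"]] leaf_or_internal[OF assms] root_internal_trunc[OF assms]
  by blast

lemma trunc_Suc_iff:
  assumes s: "ternary_tree s" "trunc (Suc h) s = s" "[] \<in> internal_nodes s" and t: "ternary_tree t"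
  shows "trunc (Suc h) t = s \<longleftrightarrow> [] \<in> internal_nodes t \<and> trunc h (subtree t 1) = subtree s 1
     \<and> trunc h (subtree t 2) = subtree s 2 \<and> trunc h (subtree t 3) = subtree s 3"
    (is "?L \<longleftrightarrow> ?R")
proof
  assume ?L
  then show ?R using s(3) root_internal_trunc[OF t, of h] subtree_trunc[of h t] by metis
next
  assume ?R
  then show ?L
    using node_subtrees[OF ternary_trunc[OF t, of "Suc h"]] node_subtrees[OF s(1)] subtree_trunc[of h t] by metis
qed

lemma trunc_subtree:
  assumes "trunc (Suc h) s = s" shows "trunc h (subtree s i) = subtree s i"
  using subtree_trunc[of h s i] assms by simp

definition level :: "nat \<Rightarrow> word set \<Rightarrow> word set" where
  "level h t = {u \<in> t. length u = h}"

lemma finite_level: "ternary_tree t \<Longrightarrow> finite (level h t)"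
  by (rule finite_subset[OF _ finite_words[of h]]) (auto simp: level_def dest: tree_lists)

lemma level_0: "ternary_tree t \<Longrightarrow> level 0 t = {[]}"
  using tree_root by (auto simp: level_def)

lemma level_Suc:
  assumes "ternary_tree t"
  shows "level (Suc h) t = (#) 1 ` level h (subtree t 1) \<union> (#) 2 ` level h (subtree t 2) \<union> (#) 3 ` level h (subtree t 3)"
proof (intro set_eqI iffI)
  fix u assume "u \<in> level (Suc h) t"
  then have u: "u \<in> t" "length u = Suc h" by (auto simp: level_def)
  then obtain i w where iw: "i \<in> letters" "w \<in> subtree t i" "u = i # w" using tree_decomp[OF assms, of u] by auto
  then have "w \<in> level h (subtree t i)" using u by (simp add: level_def)
  with iw(1,3) show "u \<in> (#) 1 ` level h (subtree t 1) \<union> (#) 2 ` level h (subtree t 2) \<union> (#) 3 ` level h (subtree t 3)"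
    by (elim letters_cases) auto
qed (auto simp: level_def subtree_def)

lemma card_level_Suc:
  assumes t: "ternary_tree t" and i: "[] \<in> internal_nodes t"
  shows "card (level (Suc h) t) = card (level h (subtree t 1)) + card (level h (subtree t 2)) + card (level h (subtree t 3))"
proof -
  have f: "finite (level h (subtree t i))" if "i \<in> letters" for i
    using finite_level ternary_subtree[OF t i that] by blast
  have ci: "card ((#) x ` A) = card A" for x :: nat and A by (rule card_image) simp
  have "card (level (Suc h) t) = card ((#) 1 ` level h (subtree t 1) \<union> (#) 2 ` level h (subtree t 2)) + card ((#) 3 ` level h (subtree t 3))"
    unfolding level_Suc[OF t] by (rule card_Un_disjoint) (use f[OF letters_mem(2)] f[OF letters_mem(3)] f[OF letters_mem(4)] in auto)
  also have "card ((#) 1 ` level h (subtree t 1) \<union> (#) 2 ` level h (subtree t 2)) = card ((#) 1 ` level h (subtree t 1)) + card ((#) 2 ` level h (subtree t 2))"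
    by (rule card_Un_disjoint) (use f[OF letters_mem(2)] f[OF letters_mem(3)] in auto)
  finally show ?thesis by (simp add: ci)
qed

text \<open>The probability that a critical Galton-Watson tree coincides with a given one up to height \<open>h\<close>.\<close>

primrec weight :: "nat \<Rightarrow> word set \<Rightarrow> real" where
  "weight 0 s = 1"
| "weight (Suc h) s = (if [] \<in> internal_nodes s
     then 1/3 * weight h (subtree s 1) * weight h (subtree s 2) * weight h (subtree s 3) else 2/3)"

text \<open>k is the number of internal nodes of s. A node at height h may carry any tree, which
  gives a factor T; a leaf of smaller height stays a leaf. Both formulas follow the same recursion
  at the root, and the factor 2/3 lowers the exponent of 3/2 by one without a subtraction.\<close>

lemma cylinder_gf:
  assumes "ternary_tree s" "trunc h s = s"
  shows "\<exists>k. tree_gf (\<lambda>t. trunc h t = s) = fps_X ^ k * tree_series ^ card (level h s)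
     \<and> weight h s = (4/27) ^ k * (3/2) ^ card (level h s) * (2/3)"
  using assms
proof (induction h arbitrary: s)
  case 0
  then have s: "s = {[]}" using trunc_0 by metis
  have "tree_gf (\<lambda>t. trunc 0 t = s) = tree_series"
    by (rule tree_gf_cong) (simp add: trunc_0 s)
  moreover have "card (level 0 s) = 1" using level_0[OF 0(1)] by simp
  ultimately show ?case by (intro exI[of _ 0]) simp
next
  case (Suc h)
  show ?case
  proof (cases "[] \<in> internal_nodes s")
    case False
    then have s: "s = {[]}" using leaf_or_internal Suc.prems(1) by blast
    have "tree_gf (\<lambda>t. trunc (Suc h) t = s) = tree_gf (\<lambda>t. t = {[]})"
      unfolding s by (rule tree_gf_cong) (simp add: trunc_Suc_leaf_iff)
    moreover have "level (Suc h) s = {}" by (auto simp: s level_def)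
    ultimately show ?thesis using False by (intro exI[of _ 0]) (simp add: tree_gf_leaf)
  next
    case True
    define l where "l = (\<lambda>i. card (level h (subtree s i)))"
    have IH: "\<exists>k. tree_gf (\<lambda>t. trunc h t = subtree s i) = fps_X ^ k * tree_series ^ l i
       \<and> weight h (subtree s i) = (4/27) ^ k * (3/2) ^ l i * (2/3)" if "i \<in> letters" for i
      unfolding l_def by (rule Suc.IH[OF ternary_subtree[OF Suc.prems(1) True that] trunc_subtree[OF Suc.prems(2)]])
    obtain k1 k2 k3 where k: "tree_gf (\<lambda>t. trunc h t = subtree s 1) = fps_X ^ k1 * tree_series ^ l 1"
      "weight h (subtree s 1) = (4/27) ^ k1 * (3/2) ^ l 1 * (2/3)"
      "tree_gf (\<lambda>t. trunc h t = subtree s 2) = fps_X ^ k2 * tree_series ^ l 2"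
      "weight h (subtree s 2) = (4/27) ^ k2 * (3/2) ^ l 2 * (2/3)"
      "tree_gf (\<lambda>t. trunc h t = subtree s 3) = fps_X ^ k3 * tree_series ^ l 3"
      "weight h (subtree s 3) = (4/27) ^ k3 * (3/2) ^ l 3 * (2/3)"
      using IH[OF letters_mem(2)] IH[OF letters_mem(3)] IH[OF letters_mem(4)] by metis
    have c: "card (level (Suc h) s) = l 1 + l 2 + l 3"
      using card_level_Suc[OF Suc.prems(1) True] by (simp add: l_def)
    have "tree_gf (\<lambda>t. trunc (Suc h) t = s) = tree_gf (\<lambda>t. [] \<in> internal_nodes t \<and> trunc h (subtree t 1) = subtree s 1
     \<and> trunc h (subtree t 2) = subtree s 2 \<and> trunc h (subtree t 3) = subtree s 3)"
      by (rule tree_gf_cong) (rule trunc_Suc_iff[OF Suc.prems True])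
    also have "\<dots> = fps_X ^ Suc (k1 + k2 + k3) * tree_series ^ card (level (Suc h) s)"
      unfolding tree_gf_node[of "\<lambda>u. trunc h u = subtree s 1" "\<lambda>u. trunc h u = subtree s 2" "\<lambda>u. trunc h u = subtree s 3"] k c
      by (simp add: power_add mult_ac)
    finally have gf: "tree_gf (\<lambda>t. trunc (Suc h) t = s) = fps_X ^ Suc (k1 + k2 + k3) * tree_series ^ card (level (Suc h) s)" .
    have "weight (Suc h) s = (4/27) ^ Suc (k1 + k2 + k3) * (3/2) ^ card (level (Suc h) s) * (2/3)"
      using True unfolding weight.simps k c by (simp add: power_add)
    with gf show ?thesis by blast
  qed
qed

lemma tree_series_pos: "0 < l \<Longrightarrow> 0 < (tree_series ^ l) $ M"
  by (simp add: tree_series_coeff)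

text \<open>The absorption identity between \<open>n choose M\<close> and
  \<open>(n - 1) choose M\<close> makes the quotient a rational function of M; 3/2 is the ratio of
  its leading coefficients.\<close>

lemma tree_series_ratio_step:
  assumes "0 < l"
  shows "(\<lambda>M. (tree_series ^ Suc l) $ M / (tree_series ^ l) $ M) \<longlonglongrightarrow> real (Suc l) / real l * (3/2)"
proof -
  have eq: "(tree_series ^ Suc l) $ M / (tree_series ^ l) $ M
     = real (Suc l) / real l * ((3 * real M + real l) / (2 * real M + real l + 1))" for M
  proof -
    let ?n = "3 * M + Suc l"
    have "(?n - M) * (?n choose M) = ?n * ((?n - 1) choose M)" by (rule binomial_absorb_comp)
    moreover have "?n - M = 2 * M + Suc l" "?n - 1 = 3 * M + l" by simp_all
    ultimately have "(2 * M + Suc l) * (?n choose M) = ?n * ((3 * M + l) choose M)" by (simp only:)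
    then have "real (2 * M + Suc l) * real (?n choose M) = real ?n * real ((3 * M + l) choose M)"
      by (simp only: of_nat_mult[symmetric])
    then have "real (?n choose M) = real ?n * real ((3 * M + l) choose M) / real (2 * M + Suc l)"
      by (simp add: nonzero_eq_divide_eq mult.commute)
    then have "(tree_series ^ Suc l) $ M = real (Suc l) * real ((3 * M + l) choose M) / real (2 * M + Suc l)"
      using tree_series_coeff[of "Suc l" M] by simp
    moreover have "(tree_series ^ l) $ M = real l / real (3 * M + l) * real ((3 * M + l) choose M)"
      using tree_series_coeff[of l M] assms by simp
    moreover have "a * c / b / (p / q * c) = a / p * (q / b)" if "0 < c" for a b c p q :: real
      using that by simp
    moreover have "0 < real ((3 * M + l) choose M)" by simp
    ultimately have "(tree_series ^ Suc l) $ M / (tree_series ^ l) $ M = real (Suc l) / real l * (real (3 * M + l) / real (2 * M + Suc l))"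
      by presburger
    then show ?thesis by (simp add: add_ac)
  qed
  have "(\<lambda>M. (3 * real M + real l) / (2 * real M + real l + 1)) \<longlonglongrightarrow> 3/2"
    by real_asymp
  then show ?thesis unfolding eq by (intro tendsto_mult tendsto_const)
qed

text \<open>A telescoping product of the quotients of \<open>tree_series_ratio_step\<close>, in
  which the fractions (j + 1) / j collapse.\<close>

lemma tree_series_ratio:
  "(\<lambda>M. (tree_series ^ Suc l) $ M / tree_series $ M) \<longlonglongrightarrow> real (Suc l) * (3/2) ^ l"
proof (induction l)
  case 0
  have "(tree_series ^ Suc 0) $ M / tree_series $ M = 1" for M using tree_series_pos[of 1 M] by simp
  then show ?case by simp
next
  case (Suc l)
  have eq: "(tree_series ^ Suc (Suc l)) $ M / tree_series $ M
     = (tree_series ^ Suc (Suc l)) $ M / (tree_series ^ Suc l) $ M * ((tree_series ^ Suc l) $ M / tree_series $ M)" for M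
    using tree_series_pos[of "Suc l" M] by simp
  have "(\<lambda>M. (tree_series ^ Suc (Suc l)) $ M / (tree_series ^ Suc l) $ M * ((tree_series ^ Suc l) $ M / tree_series $ M))
     \<longlonglongrightarrow> (real (Suc (Suc l)) / real (Suc l) * (3/2)) * (real (Suc l) * (3/2) ^ l)"
    by (intro tendsto_mult tree_series_ratio_step Suc) simp
  then have "(\<lambda>M. (tree_series ^ Suc (Suc l)) $ M / tree_series $ M)
     \<longlonglongrightarrow> (real (Suc (Suc l)) / real (Suc l) * (3/2)) * (real (Suc l) * (3/2) ^ l)"
    by (simp only: eq[symmetric])
  moreover have "(real (Suc (Suc l)) / real (Suc l) * (3/2)) * (real (Suc l) * (3/2) ^ l) = real (Suc (Suc l)) * (3/2 :: real) ^ Suc l"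
    by (simp del: of_nat_Suc)
  ultimately show ?case by (simp only:)
qed

text \<open>Coefficient M + 1 of T is coefficient M of T^3, and the ratio of T^3 to T has limit 3
  (3/2)^2 = 27/4; each shift by one contributes the inverse.\<close>

lemma tree_series_shift:
  "(\<lambda>M. tree_series $ M / tree_series $ (M + k)) \<longlonglongrightarrow> (4/27) ^ k"
proof (induction k)
  case 0
  have "tree_series $ M / tree_series $ (M + 0) = 1" for M using tree_series_pos[of 1 M] by simp
  then show ?case by simp
next
  case (Suc k)
  have s: "tree_series $ Suc M = (tree_series ^ 3) $ M" for M
    by (subst tree_series_eq) (simp add: fps_X_mult_nth)
  have "(\<lambda>M. (tree_series ^ 3) $ M / tree_series $ M) \<longlonglongrightarrow> 27/4"
    using tree_series_ratio[of 2] by (simp add: numeral_3_eq_3 eval_nat_numeral)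
  then have "(\<lambda>M. inverse ((tree_series ^ 3) $ M / tree_series $ M)) \<longlonglongrightarrow> inverse (27/4)"
    by (intro tendsto_inverse) simp_all
  then have "(\<lambda>M. tree_series $ M / tree_series $ Suc M) \<longlonglongrightarrow> 4/27"
    by (simp add: s)
  then have "(\<lambda>M. tree_series $ (M + k) / tree_series $ Suc (M + k)) \<longlonglongrightarrow> 4/27"
    by (rule LIMSEQ_ignore_initial_segment)
  then have "(\<lambda>M. (tree_series $ M / tree_series $ (M + k)) * (tree_series $ (M + k) / tree_series $ Suc (M + k)))
     \<longlonglongrightarrow> (4/27) ^ k * (4/27)"
    by (intro tendsto_mult Suc)
  moreover have eq: "(tree_series $ M / tree_series $ (M + k)) * (tree_series $ (M + k) / tree_series $ Suc (M + k))
     = tree_series $ M / tree_series $ (M + Suc k)" for M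
    using tree_series_pos[of 1 "M + k"] by simp
  ultimately have "(\<lambda>M. tree_series $ M / tree_series $ (M + Suc k)) \<longlonglongrightarrow> (4/27) ^ k * (4/27)"
    by (simp only: eq)
  then show ?case by (simp add: mult.commute)
qed

theorem cylinder_limit:
  assumes s: "ternary_tree s" "trunc h s = s"
  shows "(\<lambda>N. real (card {t \<in> finite_trees N. trunc h t = s}) / real (card (finite_trees N)))
     \<longlonglongrightarrow> real (card (level h s)) * weight h s"
proof -
  obtain k where k: "tree_gf (\<lambda>t. trunc h t = s) = fps_X ^ k * tree_series ^ card (level h s)"
     "weight h s = (4/27) ^ k * (3/2) ^ card (level h s) * (2/3)"
    using cylinder_gf[OF s] by blast
  let ?l = "card (level h s)"
  have e: "real (card {t \<in> finite_trees N. trunc h t = s}) / real (card (finite_trees N)) =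
     (fps_X ^ k * tree_series ^ ?l) $ N / tree_series $ N" for N
    unfolding k(1)[symmetric] by (simp add: tree_gf_def)
  have lim: "(\<lambda>M. (tree_series ^ ?l) $ M / tree_series $ M) \<longlonglongrightarrow> real ?l * (3/2) ^ ?l * (2/3)"
  proof (cases ?l)
    \<comment> \<open>Without nodes at height h the only tree with this top is s itself: T^0 = 1 has
      no nonzero coefficient for large M.\<close>
    case 0
    have "\<forall>\<^sub>F M in sequentially. (tree_series ^ ?l) $ M / tree_series $ M = 0"
      using eventually_gt_at_top[of 0] by eventually_elim (simp add: 0)
    then show ?thesis using 0 by (simp add: tendsto_eventually)
  next
    case (Suc l)
    then show ?thesis using tree_series_ratio[of l] by simp
  qed
  have "(\<lambda>M. (tree_series ^ ?l) $ M / tree_series $ M * (tree_series $ M / tree_series $ (M + k)))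
    \<longlonglongrightarrow> real ?l * (3/2) ^ ?l * (2/3) * (4/27) ^ k"
    by (intro tendsto_mult lim tree_series_shift)
  moreover have eq: "(tree_series ^ ?l) $ M / tree_series $ M * (tree_series $ M / tree_series $ (M + k))
     = (fps_X ^ k * tree_series ^ ?l) $ (M + k) / tree_series $ (M + k)" for M
    using tree_series_pos[of 1 M] by (simp add: fps_X_power_mult_nth)
  ultimately have "(\<lambda>M. (fps_X ^ k * tree_series ^ ?l) $ (M + k) / tree_series $ (M + k)) \<longlonglongrightarrow> real ?l * (3/2) ^ ?l * (2/3) * (4/27) ^ k"
    by (simp only: eq)
  also have "real ?l * (3/2) ^ ?l * (2/3) * (4/27) ^ k = real ?l * weight h s" by (simp add: k(2))
  finally have "(\<lambda>M. (fps_X ^ k * tree_series ^ ?l) $ (M + k) / tree_series $ (M + k)) \<longlonglongrightarrow> real ?l * weight h s" .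
  \<comment> \<open>The limit was taken along N = M + k, since the factor X^k shifts the
    coefficients.\<close>
  then show ?thesis unfolding e by (rule LIMSEQ_offset)
qed

section \<open>Galton-Watson trees\<close>

lemma space_tree_space [simp]: "space tree_space = {t. ternary_tree t}"
  by (auto simp: tree_space_def space_measure_of_conv)

lemma sets_tree_space_mem [measurable]: "{t \<in> space tree_space. u \<in> t} \<in> sets tree_space"
proof -
  have "{t. ternary_tree t \<and> u \<in> t} \<in> sets tree_space"
    unfolding tree_space_def by (rule in_measure_of) auto
  then show ?thesis by simp
qed

lemma pred_tree_mem [measurable]: "Measurable.pred tree_space (\<lambda>t. u \<in> t)"
  using sets_tree_space_mem by (simp add: pred_def)

lemma measurable_tree_space:
  assumes "\<And>x. x \<in> space M \<Longrightarrow> ternary_tree (f x)" "\<And>u. {x \<in> space M. u \<in> f x} \<in> sets M"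
  shows "f \<in> measurable M tree_space"
  unfolding tree_space_def
proof (rule measurable_measure_of)
  fix y assume "y \<in> range (\<lambda>u. {t. ternary_tree t \<and> u \<in> t})"
  then obtain u where "y = {t. ternary_tree t \<and> u \<in> t}" by blast
  then have "f -` y \<inter> space M = {x \<in> space M. u \<in> f x}" using assms(1) by auto
  then show "f -` y \<inter> space M \<in> sets M" using assms(2) by simp
qed (use assms(1) in auto)

text \<open>A countable conjunction of membership events, the first conjunct being constant; in this
  form cylinders are measurable.\<close>

lemma trunc_eq_iff: "trunc h t = s \<longleftrightarrow> trunc h s = s \<and> (\<forall>u\<in>{u. length u \<le> h}. u \<in> t \<longleftrightarrow> u \<in> s)"
  unfolding trunc_def by blast

lemma pred_trunc [measurable]: "Measurable.pred tree_space (\<lambda>t. trunc h t = s)"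
  by (subst trunc_eq_iff) measurable

lemma pred_internal [measurable]: "Measurable.pred tree_space (\<lambda>t. u \<in> internal_nodes t)"
proof -
  have "Measurable.pred tree_space (\<lambda>t. u \<in> t \<and> (\<forall>i\<in>letters. u @ [i] \<in> t))" by measurable
  then show ?thesis unfolding internal_nodes_def letters_def by simp
qed

text \<open>Replaces the quantifier over all points by one over corners of words, and finiteness by
  a bound on lengths: a countable combination of events, as measurability requires.\<close>

lemma finite_degrees_iff:
  assumes t: "ternary_tree t"
  shows "finite_degrees t \<longleftrightarrow> (\<forall>w i. w \<in> lists letters \<and> i \<in> letters \<longrightarrow>
     (\<exists>N. \<forall>v. N \<le> length v \<and> v \<in> lists letters \<and> vtx (wt w) i \<in> corners (wt v) \<longrightarrow> v \<notin> internal_nodes t))"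
    (is "_ \<longleftrightarrow> ?R")
proof
  assume f: "finite_degrees t"
  show ?R
  proof (intro allI impI)
    fix w i assume "w \<in> lists letters \<and> i \<in> letters"
    have "finite {v \<in> internal_nodes t. vtx (wt w) i \<in> corners (wt v)}" using f unfolding finite_degrees_def by blast
    then obtain h where h: "\<forall>v\<in>{v \<in> internal_nodes t. vtx (wt w) i \<in> corners (wt v)}. length v \<le> h" using finite_bound by blast
    show "\<exists>N. \<forall>v. N \<le> length v \<and> v \<in> lists letters \<and> vtx (wt w) i \<in> corners (wt v) \<longrightarrow> v \<notin> internal_nodes t"
      using h by (intro exI[of _ "Suc h"]) force
  qed
next
  assume R: ?R
  show "finite_degrees t" unfolding finite_degrees_def
  proof
    fix b
    show "finite {v \<in> internal_nodes t. b \<in> corners (wt v)}"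
    proof (cases "\<exists>w i. w \<in> lists letters \<and> i \<in> letters \<and> b = vtx (wt w) i")
      case True
      then obtain N where N: "\<forall>v. N \<le> length v \<and> v \<in> lists letters \<and> b \<in> corners (wt v) \<longrightarrow> v \<notin> internal_nodes t"
        using R by blast
      have "{v \<in> internal_nodes t. b \<in> corners (wt v)} \<subseteq> {w. w \<in> lists letters \<and> length w \<le> N}"
      proof
        fix v assume v: "v \<in> {v \<in> internal_nodes t. b \<in> corners (wt v)}"
        then have "v \<in> lists letters" using internal_lists[OF t] by blast
        then show "v \<in> {w. w \<in> lists letters \<and> length w \<le> N}" using v N by force
      qed
      then show ?thesis using finite_words finite_subset by blast
    next
      case False
      have "{v \<in> internal_nodes t. b \<in> corners (wt v)} = {}"
      proof (rule ccontr)
        assume "{v \<in> internal_nodes t. b \<in> corners (wt v)} \<noteq> {}"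
        then obtain v where v: "v \<in> internal_nodes t" "b \<in> corners (wt v)" by blast
        then obtain i where "i \<in> letters" "b = vtx (wt v) i" by (auto simp: corners_vtx)
        then show False using False internal_lists[OF t v(1)] by blast
      qed
      then show ?thesis by (simp only: finite.emptyI)
    qed
  qed
qed

lemma sets_finite_degrees: "{t \<in> space tree_space. finite_degrees t} \<in> sets tree_space"
proof -
  have "{t \<in> space tree_space. \<forall>w i. w \<in> lists letters \<and> i \<in> letters \<longrightarrow>
     (\<exists>N. \<forall>v. N \<le> length v \<and> v \<in> lists letters \<and> vtx (wt w) i \<in> corners (wt v) \<longrightarrow> v \<notin> internal_nodes t)} \<in> sets tree_space"
    by measurable
  also have "{t \<in> space tree_space. \<forall>w i. w \<in> lists letters \<and> i \<in> letters \<longrightarrow>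
     (\<exists>N. \<forall>v. N \<le> length v \<and> v \<in> lists letters \<and> vtx (wt w) i \<in> corners (wt v) \<longrightarrow> v \<notin> internal_nodes t)}
      = {t \<in> space tree_space. finite_degrees t}"
    by (intro Collect_cong conj_cong refl) (simp only: finite_degrees_iff space_tree_space mem_Collect_eq)
  finally show ?thesis .
qed

lemma (in product_prob_space) measure_PiM_Collect:
  assumes X: "J \<subseteq> I" "finite J" "\<And>i. i \<in> J \<Longrightarrow> X i \<in> sets (M i)"
  shows "measure (Pi\<^sub>M I M) {x\<in>space (Pi\<^sub>M I M). \<forall>i\<in>J. x i \<in> X i} = (\<Prod>i\<in>J. measure (M i) (X i))"
  using emeasure_PiM_Collect[OF assms]
  unfolding emeasure_eq_measure M.emeasure_eq_measure
  by (simp add: prod_ennreal measure_nonneg prod_nonneg)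

section \<open>The offspring law and the law of its tree\<close>

lemma space_offspring_law [simp]: "space offspring_law = {0, 3}"
  and sets_offspring_law [simp]: "sets offspring_law = Pow {0, 3}"
  by (simp_all add: offspring_law_def space_point_measure sets_point_measure)

lemma emeasure_offspring_law:
  "emeasure offspring_law {0} = ennreal (2/3)" "emeasure offspring_law {3} = ennreal (1/3)"
proof -
  have "(2::ennreal) / 3 = ennreal (2/3)" "(1::ennreal) / 3 = ennreal (1/3)"
    using divide_ennreal[of 2 3] divide_ennreal[of 1 3] by (simp_all add: ennreal_1[symmetric] del: ennreal_1)
  then show "emeasure offspring_law {0} = ennreal (2/3)" "emeasure offspring_law {3} = ennreal (1/3)"
    by (simp_all add: offspring_law_def emeasure_point_measure_finite)
qed

lemma measure_offspring_law:
  "measure offspring_law {0} = 2/3" "measure offspring_law {3} = 1/3"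
  by (simp_all add: measure_def emeasure_offspring_law)

lemma prob_space_offspring_law: "prob_space offspring_law"
proof
  have "emeasure offspring_law (space offspring_law) = emeasure offspring_law {0} + emeasure offspring_law {3}"
    by (subst plus_emeasure) (auto simp: insert_commute)
  also have "\<dots> = ennreal (2/3 + 1/3)" unfolding emeasure_offspring_law by (simp add: ennreal_plus[symmetric] del: ennreal_plus)
  finally show "emeasure offspring_law (space offspring_law) = 1" by simp
qed

interpretation offspring: product_prob_space "\<lambda>_. offspring_law" UNIV
  using prob_space_offspring_law by (simp add: product_prob_space_def product_prob_space_axioms_def product_sigma_finite_def prob_space_imp_sigma_finite)

abbreviation offspring_space :: "(word \<Rightarrow> nat) measure" where
  "offspring_space \<equiv> \<Pi>\<^sub>M u\<in>UNIV. offspring_law"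

lemma offspring_values: "\<nu> \<in> space offspring_space \<Longrightarrow> \<nu> u = 0 \<or> \<nu> u = 3"
  by (auto simp: space_PiM PiE_iff)

lemma offspring_tree_Nil: "[] \<in> offspring_tree \<nu>"
  by (simp add: offspring_tree_def)

lemma offspring_tree_snoc: "u @ [i] \<in> offspring_tree \<nu> \<longleftrightarrow> u \<in> offspring_tree \<nu> \<and> 1 \<le> i \<and> i \<le> \<nu> u"
  by (auto simp: offspring_tree_def nth_append less_Suc_eq)

lemma letters_iff: "i \<in> letters \<longleftrightarrow> 1 \<le> i \<and> i \<le> 3"
  by (auto simp: letters_def)

lemma offspring_tree_snoc':
  assumes "\<nu> \<in> space offspring_space"
  shows "u @ [i] \<in> offspring_tree \<nu> \<longleftrightarrow> u \<in> offspring_tree \<nu> \<and> \<nu> u = 3 \<and> i \<in> letters"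
  using offspring_values[OF assms, of u] unfolding offspring_tree_snoc letters_iff by auto

lemma ternary_offspring_tree:
  assumes "\<nu> \<in> space offspring_space" shows "ternary_tree (offspring_tree \<nu>)"
  unfolding ternary_tree_iff
proof (intro conjI allI impI ballI)
  show "offspring_tree \<nu> \<subseteq> lists letters"
  proof
    fix u assume "u \<in> offspring_tree \<nu>"
    then show "u \<in> lists letters"
      by (induction u rule: rev_induct) (auto simp: offspring_tree_snoc'[OF assms])
  qed
qed (auto simp: offspring_tree_Nil offspring_tree_snoc'[OF assms])

lemma measurable_offspring_tree [measurable]: "offspring_tree \<in> measurable offspring_space tree_space"
proof (rule measurable_tree_space[OF ternary_offspring_tree])
  fix u
  have "{\<nu> \<in> space offspring_space. u \<in> offspring_tree \<nu>} =
     {\<nu> \<in> space offspring_space. \<forall>i\<in>{..<length u}. \<nu> (take i u) \<in> {k \<in> {0, 3}. 1 \<le> u ! i \<and> u ! i \<le> k}}"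
    using offspring_values by (auto simp: offspring_tree_def)
  also have "\<dots> \<in> sets offspring_space"
  proof (rule sets.sets_Collect_finite_All)
    fix i
    have "(\<lambda>\<nu>. \<nu> (take i u)) \<in> measurable offspring_space offspring_law" by measurable
    then have "(\<lambda>\<nu>. \<nu> (take i u)) -` {k \<in> {0, 3}. 1 \<le> u ! i \<and> u ! i \<le> k} \<inter> space offspring_space \<in> sets offspring_space"
      by (rule measurable_sets) auto
    moreover have "(\<lambda>\<nu>. \<nu> (take i u)) -` A \<inter> space offspring_space = {\<nu> \<in> space offspring_space. \<nu> (take i u) \<in> A}" for A
      by blast
    ultimately show "{\<nu> \<in> space offspring_space. \<nu> (take i u) \<in> {k \<in> {0, 3}. 1 \<le> u ! i \<and> u ! i \<le> k}} \<in> sets offspring_space"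
      by (simp only:)
  qed simp
  finally show "{\<nu> \<in> space offspring_space. u \<in> offspring_tree \<nu>} \<in> sets offspring_space" .
qed

lemma prob_space_galton_watson: "prob_space galton_watson"
  unfolding galton_watson_def by (rule offspring.prob_space_distr) measurable

lemma sets_galton_watson [measurable_cong, simp]: "sets galton_watson = sets tree_space"
  by (simp add: galton_watson_def)

lemma space_galton_watson [simp]: "space galton_watson = {t. ternary_tree t}"
  by (simp add: galton_watson_def)

text \<open>The recursion through subtrees, unfolded into one factor per node of height less than h;
  this is the form that the independence of the offspring numbers produces.\<close>

lemma weight_prod:
  assumes "ternary_tree s"
  shows "weight h s = (\<Prod>u\<in>{u \<in> s. length u < h}. if u \<in> internal_nodes s then 1/3 else 2/3)"
  using assms
proof (induction h arbitrary: s)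
  case (Suc h)
  show ?case
  proof (cases "[] \<in> internal_nodes s")
    case False
    then have "s = {[]}" using leaf_or_internal[OF Suc.prems] by simp
    then have "{u \<in> s. length u < Suc h} = {[]}" by auto
    then show ?thesis using False by simp
  next
    case True
    let ?f = "\<lambda>s u. if u \<in> internal_nodes s then 1/3 else 2/3 :: real"
    let ?S = "\<lambda>i. {u \<in> subtree s i. length u < h}"
    have t: "ternary_tree (subtree s i)" if "i \<in> letters" for i using ternary_subtree[OF Suc.prems True that] .
    have fin: "finite (?S i)" if "i \<in> letters" for i
      by (rule finite_subset[OF _ finite_words[of h]]) (auto dest: tree_lists[OF t[OF that]])
    have eq: "{u \<in> s. length u < Suc h} = insert [] ((#) 1 ` ?S 1 \<union> ((#) 2 ` ?S 2 \<union> (#) 3 ` ?S 3))"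
      using tree_decomp[OF Suc.prems] by (auto simp: bex_letters)
    have p: "(\<Prod>u\<in>(#) i ` ?S i. ?f s u) = weight h (subtree s i)" if "i \<in> letters" for i
      unfolding Suc.IH[OF t[OF that]]
      by (subst prod.reindex) (auto simp: internal_subtree[OF Suc.prems True that])
    have "(\<Prod>u\<in>{u \<in> s. length u < Suc h}. ?f s u) = 1/3 * (\<Prod>u\<in>(#) 1 ` ?S 1 \<union> ((#) 2 ` ?S 2 \<union> (#) 3 ` ?S 3). ?f s u)"
      unfolding eq using fin True by (subst prod.insert) auto
    also have "(\<Prod>u\<in>(#) 1 ` ?S 1 \<union> ((#) 2 ` ?S 2 \<union> (#) 3 ` ?S 3). ?f s u) =
       (\<Prod>u\<in>(#) 1 ` ?S 1. ?f s u) * (\<Prod>u\<in>(#) 2 ` ?S 2 \<union> (#) 3 ` ?S 3. ?f s u)"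
      by (rule prod.union_disjoint) (use fin in auto)
    also have "(\<Prod>u\<in>(#) 2 ` ?S 2 \<union> (#) 3 ` ?S 3. ?f s u) = (\<Prod>u\<in>(#) 2 ` ?S 2. ?f s u) * (\<Prod>u\<in>(#) 3 ` ?S 3. ?f s u)"
      by (rule prod.union_disjoint) (use fin in auto)
    finally show ?thesis using True unfolding p[OF letters_mem(2)] p[OF letters_mem(3)] p[OF letters_mem(4)] by simp
  qed
qed simp

text \<open>Only offspring numbers at nodes of s of height less than h are prescribed; those at
  height h are left free, since truncation hides their children.\<close>

lemma offspring_trunc_iff:
  assumes \<nu>: "\<nu> \<in> space offspring_space" and s: "ternary_tree s" "trunc h s = s"
  shows "trunc h (offspring_tree \<nu>) = s \<longleftrightarrow>
     (\<forall>u\<in>{u \<in> s. length u < h}. \<nu> u \<in> (if u \<in> internal_nodes s then {3} else {0}))"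
proof
  assume t: "trunc h (offspring_tree \<nu>) = s"
  show "\<forall>u\<in>{u \<in> s. length u < h}. \<nu> u \<in> (if u \<in> internal_nodes s then {3} else {0})"
  proof
    fix u assume u: "u \<in> {u \<in> s. length u < h}"
    have "u \<in> internal_nodes s \<longleftrightarrow> u @ [1] \<in> s" using internal_iff[OF s(1) letters_mem(2)] .
    also have "\<dots> \<longleftrightarrow> u @ [1] \<in> offspring_tree \<nu>" using u t by (auto simp: trunc_def)
    also have "\<dots> \<longleftrightarrow> \<nu> u = 3" using u t offspring_tree_snoc'[OF \<nu>, of u 1] by (auto simp: trunc_def)
    finally show "\<nu> u \<in> (if u \<in> internal_nodes s then {3} else {0})" using offspring_values[OF \<nu>, of u] by auto
  qed
next
  assume a: "\<forall>u\<in>{u \<in> s. length u < h}. \<nu> u \<in> (if u \<in> internal_nodes s then {3} else {0})"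
  have "u \<in> offspring_tree \<nu> \<longleftrightarrow> u \<in> s" if "length u \<le> h" for u
    using that
  proof (induction u rule: rev_induct)
    case Nil
    then show ?case using tree_root[OF s(1)] offspring_tree_Nil by simp
  next
    case (snoc i u)
    have "u @ [i] \<in> s \<longleftrightarrow> u \<in> s \<and> u \<in> internal_nodes s \<and> i \<in> letters"
      using internal_prefix[OF s(1), of u i "[]"] tree_lists[OF s(1), of "u @ [i]"] internal_child[of u s i] tree_parent[OF s(1), of u i] by auto
    moreover have "u @ [i] \<in> offspring_tree \<nu> \<longleftrightarrow> u \<in> s \<and> \<nu> u = 3 \<and> i \<in> letters"
      using offspring_tree_snoc'[OF \<nu>, of u i] snoc by simp
    moreover have "\<nu> u = 3 \<longleftrightarrow> u \<in> internal_nodes s" if "u \<in> s"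
    proof -
      have "\<nu> u \<in> (if u \<in> internal_nodes s then {3} else {0})" using a[THEN bspec, of u] that snoc.prems by simp
      then show ?thesis by (simp split: if_splits)
    qed
    ultimately show ?case by blast
  qed
  then show "trunc h (offspring_tree \<nu>) = s" using trunc_eq_iff[of h "offspring_tree \<nu>" s] s(2) by blast
qed

lemma galton_watson_trunc:
  assumes s: "ternary_tree s" "trunc h s = s"
  shows "measure galton_watson {t \<in> space tree_space. trunc h t = s} = weight h s"
proof -
  let ?X = "\<lambda>u. if u \<in> internal_nodes s then {3} else {0 :: nat}"
  have "measure galton_watson {t \<in> space tree_space. trunc h t = s} =
     measure offspring_space (offspring_tree -` {t \<in> space tree_space. trunc h t = s} \<inter> space offspring_space)"
    unfolding galton_watson_def by (rule measure_distr) measurable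
  also have "offspring_tree -` {t \<in> space tree_space. trunc h t = s} \<inter> space offspring_space =
     {\<nu> \<in> space offspring_space. \<forall>u\<in>{u \<in> s. length u < h}. \<nu> u \<in> ?X u}"
  proof (intro set_eqI iffI)
    fix \<nu> assume "\<nu> \<in> offspring_tree -` {t \<in> space tree_space. trunc h t = s} \<inter> space offspring_space"
    then have "\<nu> \<in> space offspring_space" "trunc h (offspring_tree \<nu>) = s" by simp_all
    then show "\<nu> \<in> {\<nu> \<in> space offspring_space. \<forall>u\<in>{u \<in> s. length u < h}. \<nu> u \<in> ?X u}"
      using offspring_trunc_iff[OF _ s] by blast
  next
    fix \<nu> assume "\<nu> \<in> {\<nu> \<in> space offspring_space. \<forall>u\<in>{u \<in> s. length u < h}. \<nu> u \<in> ?X u}"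
    then have "\<nu> \<in> space offspring_space" "trunc h (offspring_tree \<nu>) = s"
      using offspring_trunc_iff[OF _ s] by blast+
    then show "\<nu> \<in> offspring_tree -` {t \<in> space tree_space. trunc h t = s} \<inter> space offspring_space"
      using ternary_offspring_tree by simp
  qed
  also have "measure offspring_space \<dots> = (\<Prod>u\<in>{u \<in> s. length u < h}. measure offspring_law (?X u))"
  proof (rule offspring.measure_PiM_Collect)
    show "finite {u \<in> s. length u < h}"
      by (rule finite_subset[OF _ finite_words[of h]]) (auto dest: tree_lists[OF s(1)])
  qed auto
  also have "\<dots> = weight h s"
    unfolding weight_prod[OF s(1)] by (intro prod.cong refl) (auto simp: measure_offspring_law)
  finally show ?thesis .
qed

text \<open>u is in the tree exactly when each of its proper prefixes, as many as its length, has
  three children.\<close>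

lemma galton_watson_mem:
  assumes u: "u \<in> lists letters"
  shows "measure galton_watson {t \<in> space tree_space. u \<in> t} = (1/3) ^ length u"
proof -
  have "measure galton_watson {t \<in> space tree_space. u \<in> t} =
     measure offspring_space (offspring_tree -` {t \<in> space tree_space. u \<in> t} \<inter> space offspring_space)"
    unfolding galton_watson_def by (rule measure_distr) measurable
  also have "offspring_tree -` {t \<in> space tree_space. u \<in> t} \<inter> space offspring_space =
     {\<nu> \<in> space offspring_space. \<forall>w\<in>(\<lambda>i. take i u) ` {..<length u}. \<nu> w \<in> {3}}"
  proof (intro set_eqI iffI)
    fix \<nu> assume "\<nu> \<in> offspring_tree -` {t \<in> space tree_space. u \<in> t} \<inter> space offspring_space"
    then have *: "\<nu> \<in> space offspring_space" "u \<in> offspring_tree \<nu>" by auto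
    have "\<nu> (take i u) = 3" if "i < length u" for i
    proof -
      have "1 \<le> \<nu> (take i u)" using *(2) that unfolding offspring_tree_def by (metis (mono_tags, lifting) le_trans mem_Collect_eq)
      then show ?thesis using offspring_values[OF *(1), of "take i u"] by auto
    qed
    then show "\<nu> \<in> {\<nu> \<in> space offspring_space. \<forall>w\<in>(\<lambda>i. take i u) ` {..<length u}. \<nu> w \<in> {3}}" using * by auto
  next
    fix \<nu> assume "\<nu> \<in> {\<nu> \<in> space offspring_space. \<forall>w\<in>(\<lambda>i. take i u) ` {..<length u}. \<nu> w \<in> {3}}"
    then have *: "\<nu> \<in> space offspring_space" "\<And>i. i < length u \<Longrightarrow> \<nu> (take i u) = 3" by auto
    have "u ! i \<in> letters" if "i < length u" for i using u that nth_mem by blast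
    then have "u \<in> offspring_tree \<nu>" unfolding offspring_tree_def using *(2) by (simp add: letters_iff)
    then show "\<nu> \<in> offspring_tree -` {t \<in> space tree_space. u \<in> t} \<inter> space offspring_space"
      using *(1) ternary_offspring_tree by simp
  qed
  also have "measure offspring_space \<dots> = (\<Prod>w\<in>(\<lambda>i. take i u) ` {..<length u}. measure offspring_law {3})"
    by (rule offspring.measure_PiM_Collect) auto
  also have "\<dots> = (1/3) ^ card ((\<lambda>i. take i u) ` {..<length u})" by (simp add: measure_offspring_law)
  also have "card ((\<lambda>i. take i u) ` {..<length u}) = length u"
  proof -
    have "inj_on (\<lambda>i. take i u) {..<length u}"
    proof (rule inj_onI)
      fix i j assume "i \<in> {..<length u}" "j \<in> {..<length u}" "take i u = take j u"
      then have "length (take i u) = length (take j u)" "i < length u" "j < length u" by simp_all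
      then show "i = j" by simp
    qed
    then show ?thesis by (simp add: card_image)
  qed
  finally show ?thesis .
qed

section \<open>The infinite tree\<close>

abbreviation letter_law :: "nat measure" where
  "letter_law \<equiv> uniform_count_measure letters"

lemma space_letter_law [simp]: "space letter_law = letters"
  by (simp add: space_uniform_count_measure)

lemma sets_letter_law [simp]: "sets letter_law = Pow letters"
  by (simp add: sets_uniform_count_measure)

lemma prob_space_letter_law: "prob_space letter_law"
  by (rule prob_space_uniform_count_measure) (auto simp: letters_def)

lemma measure_letter_law: "i \<in> letters \<Longrightarrow> measure letter_law {i} = 1/3"
  by (subst measure_uniform_count_measure) (auto simp: letters_def)

interpretation spine: product_prob_space "\<lambda>_. letter_law" UNIV
  using prob_space_letter_law by (simp add: product_prob_space_def product_prob_space_axioms_def product_sigma_finite_def prob_space_imp_sigma_finite)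

interpretation forest: product_prob_space "\<lambda>_. galton_watson" UNIV
  using prob_space_galton_watson by (simp add: product_prob_space_def product_prob_space_axioms_def product_sigma_finite_def prob_space_imp_sigma_finite)

abbreviation spine_space :: "(nat \<Rightarrow> nat) measure" where
  "spine_space \<equiv> \<Pi>\<^sub>M k\<in>UNIV. letter_law"

abbreviation forest_space :: "(word \<Rightarrow> word set) measure" where
  "forest_space \<equiv> \<Pi>\<^sub>M v\<in>UNIV. galton_watson"

interpretation spine_forest: pair_prob_space spine_space forest_space ..

lemma spine_values: "X \<in> space spine_space \<Longrightarrow> X k \<in> letters"
  by (auto simp: space_PiM PiE_iff)

lemma forest_values: "\<tau> \<in> space forest_space \<Longrightarrow> ternary_tree (\<tau> v)"
  by (auto simp: space_PiM PiE_iff)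

lemma length_spine [simp]: "length (spine X k) = k"
  by (simp add: spine_def)

lemma nth_spine [simp]: "i < k \<Longrightarrow> spine X k ! i = X i"
  by (simp add: spine_def)

lemma take_spine: "i \<le> k \<Longrightarrow> take i (spine X k) = spine X i"
  by (simp add: spine_def take_map)

lemma spine_eq_iff: "length v = k \<Longrightarrow> spine X k = v \<longleftrightarrow> (\<forall>i\<in>{..<k}. X i = v ! i)"
  by (auto simp: list_eq_iff_nth_eq)

lemma spine_lists: "X \<in> space spine_space \<Longrightarrow> spine X k \<in> lists letters"
  using spine_values by (auto simp: spine_def)

section \<open>Membership in the grafted tree\<close>

lemma spine_diverge:
  assumes "spine X k @ j # w = spine X k' @ j' # w'" "j \<noteq> X k" "j' \<noteq> X k'"
  shows "k = k' \<and> j = j' \<and> w = w'"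
proof -
  have ge: "\<not> k < k'" if "spine X k @ j # w = spine X k' @ j' # w'" "j \<noteq> X k" for k k' j j' w w'
  proof
    assume "k < k'"
    then have "(spine X k' @ j' # w') ! k = X k" by (simp add: nth_append)
    moreover have "(spine X k @ j # w) ! k = j" using nth_append_length[of "spine X k" j w] by simp
    ultimately show False using that by simp
  qed
  have "k = k'" using ge[OF assms(1,2)] ge[OF assms(1)[symmetric] assms(3)] by simp
  then show ?thesis using assms(1) by simp
qed

lemma spine_mem_grafted: "spine X k \<in> grafted_tree X \<tau>"
  by (auto simp: grafted_tree_def)

lemma mem_grafted_diverge:
  assumes "j \<noteq> X k"
  shows "spine X k @ j # w \<in> grafted_tree X \<tau> \<longleftrightarrow> j \<in> letters \<and> w \<in> \<tau> (spine X k @ [j])"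
proof
  assume "spine X k @ j # w \<in> grafted_tree X \<tau>"
  then consider m where "spine X k @ j # w = spine X m"
    | k' j' w' where "spine X k @ j # w = spine X k' @ [j'] @ w'" "j' \<in> letters - {X k'}" "w' \<in> \<tau> (spine X k' @ [j'])"
    unfolding grafted_tree_def letters_def[symmetric] by blast
  then show "j \<in> letters \<and> w \<in> \<tau> (spine X k @ [j])"
  proof cases
    case (1 m)
    have "length (spine X k @ j # w) = length (spine X m)" by (simp only: 1)
    then have "k < m" by simp
    then have "(spine X k @ j # w) ! k = X k" unfolding 1 by simp
    then show ?thesis using assms nth_append_length[of "spine X k" j w] by simp
  next
    case (2 k' j' w')
    then show ?thesis using spine_diverge[of X k j w k' j' w'] assms by auto
  qed
next
  assume "j \<in> letters \<and> w \<in> \<tau> (spine X k @ [j])"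
  then have "spine X k @ [j] @ w \<in> {spine X k @ [j] @ w |k j w. j \<in> {1, 2, 3} - {X k} \<and> w \<in> \<tau> (spine X k @ [j])}"
    using assms unfolding letters_def[symmetric] by blast
  then show "spine X k @ j # w \<in> grafted_tree X \<tau>" unfolding grafted_tree_def by simp
qed

lemma spine_cases:
  obtains "u = spine X (length u)" | k j w where "u = spine X k @ j # w" "j \<noteq> X k" "k < length u"
proof (cases "u = spine X (length u)")
  case False
  then obtain i where i: "i < length u" "u ! i \<noteq> X i"
    by (metis length_spine list_eq_iff_nth_eq nth_spine)
  define k where "k = (LEAST i. i < length u \<and> u ! i \<noteq> X i)"
  have k: "k < length u" "u ! k \<noteq> X k" using LeastI[of "\<lambda>i. i < length u \<and> u ! i \<noteq> X i" i] i by (auto simp: k_def)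
  have "u ! m = X m" if "m < k" for m
    using not_less_Least[of m "\<lambda>i. i < length u \<and> u ! i \<noteq> X i"] that k(1) by (auto simp: k_def)
  then have "take k u = spine X k" using k(1) by (auto simp: list_eq_iff_nth_eq)
  then have "u = spine X k @ (u ! k) # drop (Suc k) u" using id_take_nth_drop[OF k(1)] by simp
  then show ?thesis using that(2) k by blast
qed (rule that(1))

text \<open>A word is on the spine or leaves it at a unique position k below its length. The
  quantifiers over j and w in the definition are replaced by parts of u, so that membership is a
  finite combination of measurable conditions.\<close>

lemma mem_grafted_iff:
  "u \<in> grafted_tree X \<tau> \<longleftrightarrow> u = spine X (length u) \<or>
     (\<exists>k\<in>{..<length u}. take k u = spine X k \<and> u ! k \<noteq> X k \<and> u ! k \<in> letters \<and> drop (Suc k) u \<in> \<tau> (take (Suc k) u))"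
    (is "_ \<longleftrightarrow> _ \<or> ?R")
proof (cases rule: spine_cases[of u X])
  case 1
  then show ?thesis using spine_mem_grafted by metis
next
  case (2 k j w)
  have n: "u ! k = j" using 2(1) nth_append_length[of "spine X k" j w] by simp
  have t: "take k u = spine X k" "take (Suc k) u = spine X k @ [j]" "drop (Suc k) u = w" using 2(1) by simp_all
  have ns: "u \<noteq> spine X (length u)" using n 2 by (metis nth_spine)
  have "?R \<longleftrightarrow> j \<in> letters \<and> w \<in> \<tau> (spine X k @ [j])"
  proof
    assume ?R
    then obtain m where m: "m < length u" "take m u = spine X m" "u ! m \<noteq> X m" "u ! m \<in> letters" "drop (Suc m) u \<in> \<tau> (take (Suc m) u)"
      by blast
    have "u = spine X m @ u ! m # drop (Suc m) u" using id_take_nth_drop[OF m(1)] m(2) by simp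
    then have "m = k" using spine_diverge[of X m "u ! m" "drop (Suc m) u" k j w] 2 m(3) by simp
    then show "j \<in> letters \<and> w \<in> \<tau> (spine X k @ [j])" using m t n by simp
  next
    assume "j \<in> letters \<and> w \<in> \<tau> (spine X k @ [j])"
    then show ?R using 2 n t by (intro bexI[of _ k]) auto
  qed
  then show ?thesis using ns mem_grafted_diverge[of j X k w \<tau>, OF 2(2)] 2(1) by simp
qed

lemma ternary_grafted_tree:
  assumes X: "X \<in> space spine_space" and \<tau>: "\<tau> \<in> space forest_space"
  shows "ternary_tree (grafted_tree X \<tau>)"
  unfolding ternary_tree_iff
proof (intro conjI allI impI)
  show "[] \<in> grafted_tree X \<tau>" using spine_mem_grafted[of X 0 \<tau>] by (simp add: spine_def)
  show "grafted_tree X \<tau> \<subseteq> lists letters"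
  proof
    fix u assume u: "u \<in> grafted_tree X \<tau>"
    show "u \<in> lists letters"
    proof (cases rule: spine_cases[of u X])
      case 1 then show ?thesis using spine_lists[OF X] by metis
    next
      case (2 k j w)
      then have "j \<in> letters" "w \<in> \<tau> (spine X k @ [j])" using u mem_grafted_diverge[of j X k, OF 2(2)] by auto
      then show ?thesis using 2(1) spine_lists[OF X, of k] tree_lists[OF forest_values[OF \<tau>]] by fastforce
    qed
  qed
  have child: "spine X k @ [j] \<in> grafted_tree X \<tau>" if "j \<in> letters" for j k
  proof (cases "j = X k")
    case True
    then have "spine X k @ [j] = spine X (Suc k)" by (simp add: spine_def)
    then show ?thesis using spine_mem_grafted by metis
  next
    case False
    then show ?thesis using mem_grafted_diverge[of j X k "[]" \<tau>, OF False] that tree_root[OF forest_values[OF \<tau>]] by simp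
  qed
  fix u i assume ui: "u @ [i] \<in> grafted_tree X \<tau>"
  have "u \<in> grafted_tree X \<tau> \<and> (\<forall>j\<in>letters. u @ [j] \<in> grafted_tree X \<tau>)"
  proof (cases rule: spine_cases[of u X])
    case 1
    then show ?thesis using spine_mem_grafted child by metis
  next
    case (2 k j w)
    have m: "j \<in> letters" "w @ [i] \<in> \<tau> (spine X k @ [j])"
      using ui mem_grafted_diverge[of j X k "w @ [i]" \<tau>, OF 2(2)] 2(1) by auto
    have "w \<in> \<tau> (spine X k @ [j]) \<and> (\<forall>i\<in>letters. w @ [i] \<in> \<tau> (spine X k @ [j]))"
      using m(2) forest_values[OF \<tau>] unfolding ternary_tree_iff by blast
    then show ?thesis using mem_grafted_diverge[of j X k, OF 2(2)] m(1) 2(1) by simp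
  qed
  then show "u \<in> grafted_tree X \<tau>" "\<forall>j\<in>letters. u @ [j] \<in> grafted_tree X \<tau>" by blast+
qed

lemma pred_spine [measurable]: "Measurable.pred spine_space (\<lambda>X. spine X k = v)"
proof (cases "length v = k")
  case True
  have "Measurable.pred spine_space (\<lambda>X. X i = v ! i)" for i
  proof -
    have "(\<lambda>X. X i) \<in> measurable spine_space letter_law" by measurable
    then have "(\<lambda>X. X i) -` ({v ! i} \<inter> letters) \<inter> space spine_space \<in> sets spine_space" by (rule measurable_sets) simp
    moreover have "(\<lambda>X. X i) -` ({v ! i} \<inter> letters) \<inter> space spine_space = {X \<in> space spine_space. X i = v ! i}"
      using spine_values by auto
    ultimately show ?thesis by (simp add: pred_def)
  qed
  then show ?thesis unfolding spine_eq_iff[OF True] by measurable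
next
  case False
  then have "spine X k = v \<longleftrightarrow> False" for X by auto
  then show ?thesis by simp
qed

lemma pred_letter [measurable]: "Measurable.pred spine_space (\<lambda>X. i = X k)"
proof -
  have "(\<lambda>X. X k) \<in> measurable spine_space letter_law" by measurable
  then have "(\<lambda>X. X k) -` ({i} \<inter> letters) \<inter> space spine_space \<in> sets spine_space" by (rule measurable_sets) simp
  moreover have "(\<lambda>X. X k) -` ({i} \<inter> letters) \<inter> space spine_space = {X \<in> space spine_space. i = X k}"
    using spine_values by auto
  ultimately show ?thesis by (simp add: pred_def)
qed

lemma pred_forest [measurable]: "Measurable.pred forest_space (\<lambda>\<tau>. w \<in> \<tau> v)"
proof -
  have "(\<lambda>\<tau>. \<tau> v) \<in> measurable forest_space tree_space"
    using measurable_component_singleton[of v UNIV "\<lambda>_. galton_watson"] by (simp add: measurable_cong_sets[OF refl sets_galton_watson])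
  then show ?thesis by (rule measurable_compose) measurable
qed

lemma measurable_grafted_tree [measurable]:
  "(\<lambda>(X, \<tau>). grafted_tree X \<tau>) \<in> measurable (spine_space \<Otimes>\<^sub>M forest_space) tree_space"
proof (rule measurable_tree_space)
  show "ternary_tree (case x of (X, \<tau>) \<Rightarrow> grafted_tree X \<tau>)" if "x \<in> space (spine_space \<Otimes>\<^sub>M forest_space)" for x
    using that ternary_grafted_tree by (auto simp: space_pair_measure)
  have "Measurable.pred (spine_space \<Otimes>\<^sub>M forest_space) (\<lambda>x. u = spine (fst x) (length u) \<or>
     (\<exists>k\<in>{..<length u}. take k u = spine (fst x) k \<and> u ! k \<noteq> fst x k \<and> u ! k \<in> letters \<and> drop (Suc k) u \<in> snd x (take (Suc k) u)))" for u
    unfolding eq_commute[of _ "spine _ _"] by measurable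
  then show "{x \<in> space (spine_space \<Otimes>\<^sub>M forest_space). u \<in> (case x of (X, \<tau>) \<Rightarrow> grafted_tree X \<tau>)} \<in> sets (spine_space \<Otimes>\<^sub>M forest_space)" for u
    unfolding pred_def case_prod_beta mem_grafted_iff .
qed

lemma prob_space_P_ter_inf: "prob_space P_ter_inf"
  unfolding P_ter_inf_def letters_def[symmetric] by (rule spine_forest.P.prob_space_distr) measurable

lemma sets_P_ter_inf [measurable_cong, simp]: "sets P_ter_inf = sets tree_space"
  by (simp add: P_ter_inf_def letters_def)

lemma space_P_ter_inf [simp]: "space P_ter_inf = {t. ternary_tree t}"
  by (simp add: P_ter_inf_def letters_def)

section \<open>The law of the top of the infinite tree\<close>

definition subtree_at :: "word set \<Rightarrow> word \<Rightarrow> word set" where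
  "subtree_at s p = {w. p @ w \<in> s}"

lemma subtree_at_Cons: "subtree_at s (i # p) = subtree_at (subtree s i) p"
  by (simp add: subtree_at_def subtree_def)

lemma ternary_subtree_at:
  assumes "ternary_tree s" "p \<in> s" shows "ternary_tree (subtree_at s p)"
  unfolding ternary_tree_iff
proof (intro conjI allI impI ballI)
  show "[] \<in> subtree_at s p" using assms(2) by (simp add: subtree_at_def)
  show "subtree_at s p \<subseteq> lists letters"
  proof
    fix w assume "w \<in> subtree_at s p"
    then show "w \<in> lists letters" using tree_lists[OF assms(1), of "p @ w"] by (simp add: subtree_at_def)
  qed
  fix u k assume "u @ [k] \<in> subtree_at s p"
  then have *: "(p @ u) @ [k] \<in> s" by (simp add: subtree_at_def)
  then show "u \<in> subtree_at s p" using tree_parent[OF assms(1) *] by (simp add: subtree_at_def)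
  have "\<forall>j\<in>letters. (p @ u) @ [j] \<in> s" using * assms(1) unfolding ternary_tree_iff by blast
  then show "u @ [j] \<in> subtree_at s p" if "j \<in> letters" for j using that by (simp add: subtree_at_def)
qed

text \<open>The nodes that hang off the path from the root to v: the places where trees are grafted
  before the spine reaches v.\<close>

fun siblings :: "word \<Rightarrow> word set" where
  "siblings [] = {}"
| "siblings (i # v) = (\<lambda>j. [j]) ` (letters - {i}) \<union> (#) i ` siblings v"

lemma siblings_iff: "p \<in> siblings v \<longleftrightarrow> (\<exists>k<length v. \<exists>j\<in>letters - {v ! k}. p = take k v @ [j])"
proof (induction v arbitrary: p)
  case (Cons i v)
  have "p \<in> siblings (i # v) \<longleftrightarrow> (\<exists>j\<in>letters - {i}. p = [j]) \<or> (\<exists>q. q \<in> siblings v \<and> p = i # q)" by auto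
  also have "\<dots> \<longleftrightarrow> (\<exists>k<length (i # v). \<exists>j\<in>letters - {(i # v) ! k}. p = take k (i # v) @ [j])"
    unfolding Cons.IH by (auto simp: Ex_less_Suc2)
  finally show ?case .
qed simp

lemma finite_siblings: "finite (siblings v)"
  by (induction v) auto

text \<open>Each of the h proper prefixes of v is internal and contributes 1/3 to the weight of s;
  the other factors come from the subtrees hanging off the path.\<close>

lemma weight_spine:
  assumes "ternary_tree s" "trunc h s = s" "v \<in> level h s"
  shows "(1/3) ^ h * (\<Prod>p\<in>siblings v. weight (h - length p) (subtree_at s p)) = weight h s"
  using assms
proof (induction h arbitrary: s v)
  case 0
  then show ?case by (simp add: level_def)
next
  case (Suc h)
  have v: "v \<in> s" "length v = Suc h" using Suc.prems(3) by (auto simp: level_def)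
  then obtain i v' where iv: "v = i # v'" by (cases v) auto
  have r: "[] \<in> internal_nodes s" using internal_prefix[OF Suc.prems(1), of "[]" i v'] v iv by simp
  have i: "i \<in> letters" using tree_lists[OF Suc.prems(1) v(1)] iv by simp
  have v': "v' \<in> level h (subtree s i)" using v iv by (simp add: level_def subtree_def)
  have IH: "(1/3) ^ h * (\<Prod>p\<in>siblings v'. weight (h - length p) (subtree_at (subtree s i) p)) = weight h (subtree s i)"
    by (rule Suc.IH[OF ternary_subtree[OF Suc.prems(1) r i] trunc_subtree[OF Suc.prems(2)] v'])
  let ?f = "\<lambda>p. weight (Suc h - length p) (subtree_at s p)"
  have "(\<Prod>p\<in>siblings v. ?f p) = (\<Prod>p\<in>(\<lambda>j. [j]) ` (letters - {i}). ?f p) * (\<Prod>p\<in>(#) i ` siblings v'. ?f p)"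
    unfolding iv siblings.simps by (rule prod.union_disjoint) (auto simp: finite_siblings)
  also have "(\<Prod>p\<in>(\<lambda>j. [j]) ` (letters - {i}). ?f p) = (\<Prod>j\<in>letters - {i}. weight h (subtree s j))"
    by (subst prod.reindex) (auto simp: inj_on_def subtree_at_def subtree_def)
  also have "(\<Prod>p\<in>(#) i ` siblings v'. ?f p) = (\<Prod>p\<in>siblings v'. weight (h - length p) (subtree_at (subtree s i) p))"
    by (subst prod.reindex) (auto simp: subtree_at_Cons)
  finally have "(1/3) ^ Suc h * (\<Prod>p\<in>siblings v. ?f p) =
      1/3 * ((\<Prod>j\<in>letters - {i}. weight h (subtree s j)) * weight h (subtree s i))"
    by (simp add: IH[symmetric])
  also have "(\<Prod>j\<in>letters - {i}. weight h (subtree s j)) * weight h (subtree s i) = (\<Prod>j\<in>letters. weight h (subtree s j))"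
    using prod.remove[OF finite_letters i, of "\<lambda>j. weight h (subtree s j)"] by (simp add: mult.commute)
  finally show ?case using r by (simp add: letters_def)
qed

text \<open>Once the spine is known up to height h, the top of the tree is assembled from the trees
  grafted along it. The event becomes a condition on finitely many independent trees, each truncated
  at the remaining height.\<close>

lemma grafted_trunc_iff:
  assumes X: "X \<in> space spine_space" and \<tau>: "\<tau> \<in> space forest_space"
    and s: "ternary_tree s" "trunc h s = s" and v: "v \<in> level h s" "spine X h = v"
  shows "trunc h (grafted_tree X \<tau>) = s \<longleftrightarrow> (\<forall>p\<in>siblings v. trunc (h - length p) (\<tau> p) = subtree_at s p)"
proof -
  have lv: "length v = h" "v \<in> s" using v by (auto simp: level_def)
  have take_v: "take k v = spine X k" "v ! k = X k" if "k < h" for k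
    using v(2) that take_spine[of k h X] by auto
  have sl: "length u \<le> h" if "u \<in> s" for u using s(2) that unfolding trunc_def by blast
  have sib: "p \<in> siblings v \<longleftrightarrow> (\<exists>k<h. \<exists>j\<in>letters - {X k}. p = spine X k @ [j])" for p
    unfolding siblings_iff lv(1) using take_v by auto
  show ?thesis
  proof
    assume t: "trunc h (grafted_tree X \<tau>) = s"
    have mem: "u \<in> s \<longleftrightarrow> u \<in> grafted_tree X \<tau>" if "length u \<le> h" for u using t that unfolding trunc_def by blast
    show "\<forall>p\<in>siblings v. trunc (h - length p) (\<tau> p) = subtree_at s p"
    proof
      fix p assume "p \<in> siblings v"
      then obtain k j where k: "k < h" "j \<in> letters" "j \<noteq> X k" "p = spine X k @ [j]" unfolding sib by blast
      have "w \<in> trunc (h - length p) (\<tau> p) \<longleftrightarrow> p @ w \<in> s" for w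
      proof (cases "length w \<le> h - length p")
        case True
        then have "length (p @ w) \<le> h" using k by simp
        then have "p @ w \<in> s \<longleftrightarrow> w \<in> \<tau> p"
          using mem[of "p @ w"] mem_grafted_diverge[of j X k w \<tau>, OF k(3)] k by simp
        then show ?thesis using True by (simp add: trunc_def)
      next
        case False
        then have "\<not> length (p @ w) \<le> h" using k by simp
        then show ?thesis using False sl[of "p @ w"] by (auto simp: trunc_def)
      qed
      then show "trunc (h - length p) (\<tau> p) = subtree_at s p" unfolding subtree_at_def by blast
    qed
  next
    assume a: "\<forall>p\<in>siblings v. trunc (h - length p) (\<tau> p) = subtree_at s p"
    have "u \<in> grafted_tree X \<tau> \<longleftrightarrow> u \<in> s" if u: "length u \<le> h" for u
    proof (cases rule: spine_cases[of u X])
      case 1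
      have "u = take (length u) v" using 1 take_spine[OF u, of X] v(2) by simp
      moreover have "take (length u) v \<in> s"
        using tree_prefix[OF s(1), of "take (length u) v" "drop (length u) v"] lv(2) by simp
      ultimately have "u \<in> s" by metis
      then show ?thesis using 1 spine_mem_grafted by metis
    next
      case (2 k j w)
      show ?thesis
      proof (cases "j \<in> letters")
        case True
        define p where "p = spine X k @ [j]"
        have up: "u = p @ w" using 2(1) by (simp add: p_def)
        have "k < h" using 2(3) u by simp
        then have "p \<in> siblings v" unfolding sib p_def using True 2(2) by blast
        then have e: "trunc (h - length p) (\<tau> p) = subtree_at s p" using a by blast
        have "u \<in> grafted_tree X \<tau> \<longleftrightarrow> w \<in> \<tau> p"
          using mem_grafted_diverge[of j X k w \<tau>, OF 2(2)] 2(1) True by (simp add: p_def)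
        also have "\<dots> \<longleftrightarrow> w \<in> trunc (h - length p) (\<tau> p)" using u up by (auto simp: trunc_def)
        also have "\<dots> \<longleftrightarrow> u \<in> s" unfolding e up by (simp add: subtree_at_def)
        finally show ?thesis .
      next
        case False
        have "u \<notin> grafted_tree X \<tau>" using mem_grafted_diverge[of j X k w \<tau>, OF 2(2)] 2(1) False by simp
        moreover have "u \<notin> s" using tree_lists[OF s(1), of u] 2(1) False by auto
        ultimately show ?thesis by simp
      qed
    qed
    then show "trunc h (grafted_tree X \<tau>) = s" using trunc_eq_iff[of h "grafted_tree X \<tau>" s] s(2) by blast
  qed
qed

lemma measure_pair_Times:
  assumes "A \<in> sets spine_space" "B \<in> sets forest_space"
  shows "measure (spine_space \<Otimes>\<^sub>M forest_space) (A \<times> B) = measure spine_space A * measure forest_space B"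
  using forest.P.emeasure_pair_measure_Times[OF assms] by (simp add: measure_def enn2real_mult)

lemma measure_spine:
  assumes "v \<in> lists letters" "length v = h"
  shows "measure spine_space {X \<in> space spine_space. spine X h = v} = (1/3) ^ h"
proof -
  have l: "v ! i \<in> letters" if "i < h" for i using assms that by auto
  have "{X \<in> space spine_space. spine X h = v} = {X \<in> space spine_space. \<forall>i\<in>{..<h}. X i \<in> {v ! i}}"
    unfolding spine_eq_iff[OF assms(2)] by simp
  also have "measure spine_space \<dots> = (\<Prod>i\<in>{..<h}. measure letter_law {v ! i})"
    by (rule spine.measure_PiM_Collect) (use l in auto)
  also have "\<dots> = (\<Prod>i\<in>{..<h}. 1/3)" by (intro prod.cong refl measure_letter_law l) simp
  finally show ?thesis by simp
qed

lemma siblings_in_tree: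
  assumes s: "ternary_tree s" and v: "v \<in> s" and p: "p \<in> siblings v" shows "p \<in> s"
proof -
  obtain k j where k: "k < length v" "j \<in> letters" "p = take k v @ [j]" using p unfolding siblings_iff by blast
  have "take k v @ v ! k # drop (Suc k) v \<in> s" using id_take_nth_drop[OF k(1)] v by simp
  then have "take k v \<in> internal_nodes s" by (rule internal_prefix[OF s])
  then show ?thesis using internal_child k by blast
qed

lemma sets_forest_component:
  assumes "T \<in> sets galton_watson" shows "{\<tau> \<in> space forest_space. \<tau> p \<in> T} \<in> sets forest_space"
proof -
  have "(\<lambda>\<tau>. \<tau> p) -` T \<inter> space forest_space \<in> sets forest_space"
    using measurable_sets[OF measurable_component_singleton[of p UNIV "\<lambda>_. galton_watson", OF UNIV_I] assms] .
  moreover have "(\<lambda>\<tau>. \<tau> p) -` T \<inter> space forest_space = {\<tau> \<in> space forest_space. \<tau> p \<in> T}" by blast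
  ultimately show ?thesis by (simp only:)
qed

text \<open>Up to height \<open>h\<close> the tree is a Galton-Watson tree biased by the size of its level \<open>h\<close>: every node
  of this level may be the end of the spine, and the spine is as likely as its nodes being internal.\<close>

theorem P_ter_inf_trunc:
  assumes s: "ternary_tree s" "trunc h s = s"
  shows "measure P_ter_inf {t \<in> space tree_space. trunc h t = s} = real (card (level h s)) * weight h s"
proof -
  let ?P = "spine_space \<Otimes>\<^sub>M forest_space"
  let ?A = "\<lambda>v. {X \<in> space spine_space. spine X h = v}"
  let ?T = "\<lambda>p. {t \<in> space tree_space. trunc (h - length p) t = subtree_at s p}"
  let ?B = "\<lambda>v. {\<tau> \<in> space forest_space. \<forall>p\<in>siblings v. \<tau> p \<in> ?T p}"
  have Tsets: "?T p \<in> sets galton_watson" for p unfolding sets_galton_watson by measurable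
  have B: "?B v \<in> sets forest_space" for v
    by (intro sets.sets_Collect_finite_All finite_siblings sets_forest_component Tsets)
  have A: "?A v \<in> sets spine_space" for v by measurable
  have "measure P_ter_inf {t \<in> space tree_space. trunc h t = s} =
     measure ?P ((\<lambda>(X, \<tau>). grafted_tree X \<tau>) -` {t \<in> space tree_space. trunc h t = s} \<inter> space ?P)"
    unfolding P_ter_inf_def letters_def[symmetric] by (rule measure_distr) measurable
  \<comment> \<open>The union runs over the node v of the spine at height h; the pieces are
    disjoint, and each is a product event.\<close>
  also have "(\<lambda>(X, \<tau>). grafted_tree X \<tau>) -` {t \<in> space tree_space. trunc h t = s} \<inter> space ?P = (\<Union>v\<in>level h s. ?A v \<times> ?B v)"
  proof (intro set_eqI iffI)
    fix x assume x: "x \<in> (\<lambda>(X, \<tau>). grafted_tree X \<tau>) -` {t \<in> space tree_space. trunc h t = s} \<inter> space ?P"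
    obtain X \<tau> where x': "x = (X, \<tau>)" by (cases x)
    have *: "X \<in> space spine_space" "\<tau> \<in> space forest_space" "trunc h (grafted_tree X \<tau>) = s"
      using x unfolding x' by (simp_all add: space_pair_measure)
    have "spine X h \<in> trunc h (grafted_tree X \<tau>)" using spine_mem_grafted by (simp add: trunc_def)
    then have v: "spine X h \<in> level h s" using *(3) by (simp add: level_def)
    have "\<tau> \<in> ?B (spine X h)"
      using grafted_trunc_iff[OF *(1,2) s v refl] *(3) forest_values[OF *(2)] *(2) by auto
    then show "x \<in> (\<Union>v\<in>level h s. ?A v \<times> ?B v)" using v *(1) x' by blast
  next
    fix x assume "x \<in> (\<Union>v\<in>level h s. ?A v \<times> ?B v)"
    then obtain X \<tau> where x: "x = (X, \<tau>)" "spine X h \<in> level h s" "X \<in> space spine_space" "\<tau> \<in> ?B (spine X h)" by blast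
    then have \<tau>: "\<tau> \<in> space forest_space" by blast
    have "trunc h (grafted_tree X \<tau>) = s"
      using grafted_trunc_iff[OF x(3) \<tau> s x(2) refl] x(4) by auto
    then show "x \<in> (\<lambda>(X, \<tau>). grafted_tree X \<tau>) -` {t \<in> space tree_space. trunc h t = s} \<inter> space ?P"
      using x \<tau> ternary_grafted_tree[OF x(3) \<tau>] by (simp add: space_pair_measure)
  qed
  also have "measure ?P (\<Union>v\<in>level h s. ?A v \<times> ?B v) = (\<Sum>v\<in>level h s. measure ?P (?A v \<times> ?B v))"
  proof (rule spine_forest.P.finite_measure_finite_Union)
    show "finite (level h s)" using finite_level[OF s(1)] .
    show "(\<lambda>v. ?A v \<times> ?B v) ` level h s \<subseteq> sets ?P" using A B by auto
    show "disjoint_family_on (\<lambda>v. ?A v \<times> ?B v) (level h s)" by (auto simp: disjoint_family_on_def)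
  qed
  also have "\<dots> = (\<Sum>v\<in>level h s. weight h s)"
  proof (rule sum.cong[OF refl])
    fix v assume v: "v \<in> level h s"
    then have v': "v \<in> s" "length v = h" by (auto simp: level_def)
    have "measure forest_space (?B v) = (\<Prod>p\<in>siblings v. measure galton_watson (?T p))"
      using finite_siblings Tsets by (intro forest.measure_PiM_Collect) auto
    also have "\<dots> = (\<Prod>p\<in>siblings v. weight (h - length p) (subtree_at s p))"
    proof (rule prod.cong[OF refl])
      fix p assume p: "p \<in> siblings v"
      have ps: "p \<in> s" using siblings_in_tree[OF s(1) v'(1) p] .
      have "w \<in> subtree_at s p \<Longrightarrow> length w \<le> h - length p" for w
      proof -
        assume "w \<in> subtree_at s p"
        then have "p @ w \<in> trunc h s" using s(2) by (simp add: subtree_at_def)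
        then show "length w \<le> h - length p" by (auto simp: trunc_def)
      qed
      then have "trunc (h - length p) (subtree_at s p) = subtree_at s p" by (auto simp: trunc_def)
      then show "measure galton_watson (?T p) = weight (h - length p) (subtree_at s p)"
        by (rule galton_watson_trunc[OF ternary_subtree_at[OF s(1) ps]])
    qed
    finally have "measure ?P (?A v \<times> ?B v) = (1/3) ^ h * (\<Prod>p\<in>siblings v. weight (h - length p) (subtree_at s p))"
      using measure_pair_Times[OF A B] measure_spine[OF tree_lists[OF s(1) v'(1)] v'(2)] by simp
    also have "\<dots> = weight h s" by (rule weight_spine[OF s v])
    finally show "measure ?P (?A v \<times> ?B v) = weight h s" .
  qed
  finally show ?thesis by simp
qed

text \<open>Let n be the length of u. The spine follows u with probability 3^(-n). Otherwise it
  leaves u at some k < n, which costs 3^(-k) for the common part and 3^(-(n - k - 1)) for the rest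
  of u in the grafted tree, hence at most 3 times 3^(-n) for each k.\<close>

lemma P_ter_inf_mem:
  assumes u: "u \<in> lists letters"
  shows "measure P_ter_inf {t \<in> space tree_space. u \<in> t} \<le> (1 + 3 * real (length u)) * (1/3) ^ length u"
proof -
  let ?P = "spine_space \<Otimes>\<^sub>M forest_space" and ?n = "length u"
  let ?A = "\<lambda>k. {X \<in> space spine_space. spine X k = take k u}"
  let ?B = "\<lambda>k. {\<tau> \<in> space forest_space. drop (Suc k) u \<in> \<tau> (take (Suc k) u)}"
  have A: "?A k \<in> sets spine_space" and B: "?B k \<in> sets forest_space" for k by measurable
  have mA: "measure spine_space (?A k) = (1/3) ^ k" if "k \<le> ?n" for k
    by (rule measure_spine) (use u that in \<open>auto dest: in_set_takeD\<close>)
  have mB: "measure forest_space (?B k) = (1/3) ^ (?n - Suc k)" for k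
  proof -
    let ?T = "{t \<in> space tree_space. drop (Suc k) u \<in> t}"
    have "?B k = {\<tau> \<in> space forest_space. \<forall>p\<in>{take (Suc k) u}. \<tau> p \<in> ?T}"
      using forest_values by auto
    also have "measure forest_space \<dots> = (\<Prod>p\<in>{take (Suc k) u}. measure galton_watson ?T)"
      by (rule forest.measure_PiM_Collect) (simp_all del: space_tree_space add: sets_tree_space_mem)
    also have "\<dots> = (1/3) ^ (?n - Suc k)"
      using galton_watson_mem[of "drop (Suc k) u"] u by (simp del: space_tree_space add: in_lists_conv_set) (auto dest: in_set_dropD)
    finally show ?thesis .
  qed
  have "measure P_ter_inf {t \<in> space tree_space. u \<in> t} =
     measure ?P ((\<lambda>(X, \<tau>). grafted_tree X \<tau>) -` {t \<in> space tree_space. u \<in> t} \<inter> space ?P)"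
    unfolding P_ter_inf_def letters_def[symmetric] by (rule measure_distr) measurable
  also have "\<dots> \<le> measure ?P ((?A ?n \<times> space forest_space) \<union> (\<Union>k\<in>{..<?n}. ?A k \<times> ?B k))"
  proof (rule spine_forest.P.finite_measure_mono)
    show "(\<lambda>(X, \<tau>). grafted_tree X \<tau>) -` {t \<in> space tree_space. u \<in> t} \<inter> space ?P
       \<subseteq> (?A ?n \<times> space forest_space) \<union> (\<Union>k\<in>{..<?n}. ?A k \<times> ?B k)"
    proof
      fix x assume x: "x \<in> (\<lambda>(X, \<tau>). grafted_tree X \<tau>) -` {t \<in> space tree_space. u \<in> t} \<inter> space ?P"
      obtain X \<tau> where x': "x = (X, \<tau>)" by (cases x)
      have *: "X \<in> space spine_space" "\<tau> \<in> space forest_space" "u \<in> grafted_tree X \<tau>"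
        using x unfolding x' by (simp_all add: space_pair_measure)
      from *(3) show "x \<in> (?A ?n \<times> space forest_space) \<union> (\<Union>k\<in>{..<?n}. ?A k \<times> ?B k)"
        unfolding mem_grafted_iff x' using *(1,2) by auto
    qed
    show "(?A ?n \<times> space forest_space) \<union> (\<Union>k\<in>{..<?n}. ?A k \<times> ?B k) \<in> sets ?P"
      using A B by (intro sets.Un sets.finite_UN pair_measureI) auto
  qed
  also have "\<dots> \<le> measure ?P (?A ?n \<times> space forest_space) + measure ?P (\<Union>k\<in>{..<?n}. ?A k \<times> ?B k)"
    using A B by (intro measure_Un_le sets.finite_UN pair_measureI) auto
  also have "\<dots> \<le> measure ?P (?A ?n \<times> space forest_space) + (\<Sum>k\<in>{..<?n}. measure ?P (?A k \<times> ?B k))"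
    using A B by (intro add_left_mono measure_UNION_le pair_measureI) auto
  also have "measure ?P (?A ?n \<times> space forest_space) = (1/3) ^ ?n"
    using measure_pair_Times[OF A[of ?n] sets.top] mA[of ?n] forest.P.prob_space by simp
  also have "(\<Sum>k\<in>{..<?n}. measure ?P (?A k \<times> ?B k)) = (\<Sum>k\<in>{..<?n}. 3 * (1/3) ^ ?n)"
  proof (rule sum.cong[OF refl])
    fix k assume "k \<in> {..<?n}"
    then have k: "k < ?n" by simp
    have "measure ?P (?A k \<times> ?B k) = (1/3) ^ k * (1/3) ^ (?n - Suc k)"
      using measure_pair_Times[OF A B] mA[of k] mB[of k] k by simp
    also have "\<dots> = (1/3) ^ (?n - 1)" using k by (simp add: power_add[symmetric])
    also have "\<dots> = 3 * (1/3) ^ ?n" using k by (cases ?n) auto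
    finally show "measure ?P (?A k \<times> ?B k) = 3 * (1/3) ^ ?n" .
  qed
  finally show ?thesis by (simp add: algebra_simps)
qed

section \<open>Local finiteness of the infinite tree\<close>

definition incident_words :: "complex \<Rightarrow> nat \<Rightarrow> word set" where
  "incident_words b n = {v \<in> lists letters. length v = n \<and> b \<in> corners (wt v)}"

lemma finite_incident_words: "finite (incident_words b n)"
  by (rule finite_subset[OF _ finite_words[of n]]) (auto simp: incident_words_def)

text \<open>Once a vertex is a corner of a triangle, it is a corner of two of its three subtriangles.\<close>

lemma card_incident_words: "card (incident_words b n) + 3 \<le> 4 * 2 ^ n"
proof (induction n)
  case 0
  have "incident_words b 0 \<subseteq> {[]}" by (auto simp: incident_words_def)
  then have "card (incident_words b 0) \<le> card {[] :: word}" by (intro card_mono) auto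
  then show ?case by simp
next
  case (Suc n)
  let ?C = "incident_words b n"
  let ?D = "\<Union>v\<in>?C. (\<lambda>i. v @ [i]) ` {i \<in> letters. b \<noteq> vtx (wt v) i}"
  have c2: "card ((\<lambda>i. v @ [i]) ` {i \<in> letters. b \<noteq> vtx (wt v) i}) \<le> 2" if "v \<in> ?C" for v
  proof -
    obtain j where j: "j \<in> letters" "b = vtx (wt v) j" using \<open>v \<in> ?C\<close> by (auto simp: incident_words_def corners_vtx)
    then have "{i \<in> letters. b \<noteq> vtx (wt v) i} \<subseteq> letters - {j}" by blast
    then have "card {i \<in> letters. b \<noteq> vtx (wt v) i} \<le> card (letters - {j})" by (intro card_mono) auto
    also have "\<dots> = 2" using j by (simp add: card_Diff_singleton) (simp add: letters_def)
    finally show ?thesis using card_image_le[of "{i \<in> letters. b \<noteq> vtx (wt v) i}" "\<lambda>i. v @ [i]"] by simp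
  qed
  have cD: "card ?D \<le> 2 * card ?C"
  proof -
    have "card ?D \<le> (\<Sum>v\<in>?C. card ((\<lambda>i. v @ [i]) ` {i \<in> letters. b \<noteq> vtx (wt v) i}))"
      by (rule card_UN_le) (rule finite_incident_words)
    also have "\<dots> \<le> (\<Sum>v\<in>?C. 2)" by (intro sum_mono c2)
    finally show ?thesis by simp
  qed
  \<comment> \<open>Besides \<open>?D\<close> only the three children of a word whose centre is b
    can occur, and by \<open>centre_inj\<close> there is at most one such word.\<close>
  have "\<exists>E. finite E \<and> card E \<le> 3 \<and> incident_words b (Suc n) \<subseteq> ?D \<union> E"
  proof (cases "\<exists>v\<in>lists letters. b = centre (wt v)")
    case True
    then obtain v0 where v0: "v0 \<in> lists letters" "b = centre (wt v0)" by blast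
    have "incident_words b (Suc n) \<subseteq> ?D \<union> (\<lambda>i. v0 @ [i]) ` letters"
    proof
      fix u assume u: "u \<in> incident_words b (Suc n)"
      then obtain v i where vi: "u = v @ [i]" by (cases u rule: rev_cases) (auto simp: incident_words_def)
      have l: "i \<in> letters" "v \<in> lists letters" "length v = n" "b \<in> corners (wt (v @ [i]))"
        using u vi by (auto simp: incident_words_def)
      from l(4) consider "b = centre (wt v)" | m where "m \<in> letters" "m \<noteq> i" "b = vtx (wt v) m"
        unfolding corners_child[OF l(1)] by blast
      then show "u \<in> ?D \<union> (\<lambda>i. v0 @ [i]) ` letters"
      proof cases
        case 1
        then have "v = v0" using centre_inj v0 l(2) by simp
        then show ?thesis using vi l by blast
      next
        case (2 m)
        then have "v \<in> ?C" using l by (simp add: incident_words_def)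
        moreover have "b \<noteq> vtx (wt v) i" using 2 vtx_inj[OF 2(1) l(1), of v] by auto
        ultimately show ?thesis using vi l(1) by blast
      qed
    qed
    moreover have "card ((\<lambda>i. v0 @ [i]) ` letters) \<le> 3" using card_image_le[of letters "\<lambda>i. v0 @ [i]"] by (simp add: letters_def)
    ultimately show ?thesis by (intro exI[of _ "(\<lambda>i. v0 @ [i]) ` letters"]) auto
  next
    case False
    have "incident_words b (Suc n) \<subseteq> ?D"
    proof
      fix u assume u: "u \<in> incident_words b (Suc n)"
      then obtain v i where vi: "u = v @ [i]" by (cases u rule: rev_cases) (auto simp: incident_words_def)
      have l: "i \<in> letters" "v \<in> lists letters" "length v = n" "b \<in> corners (wt (v @ [i]))"
        using u vi by (auto simp: incident_words_def)
      then obtain m where m: "m \<in> letters" "m \<noteq> i" "b = vtx (wt v) m"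
        using False unfolding corners_child[OF l(1)] by blast
      then have "v \<in> ?C" using l by (simp add: incident_words_def)
      moreover have "b \<noteq> vtx (wt v) i" using m vtx_inj[OF m(1) l(1), of v] by auto
      ultimately show "u \<in> ?D" using vi l(1) by blast
    qed
    then show ?thesis by (intro exI[of _ "{}"]) auto
  qed
  then obtain E where E: "finite E" "card E \<le> 3" "incident_words b (Suc n) \<subseteq> ?D \<union> E" by blast
  have "card (incident_words b (Suc n)) \<le> card (?D \<union> E)"
    using E finite_incident_words by (intro card_mono) auto
  also have "\<dots> \<le> card ?D + card E" by (rule card_Un_le)
  \<comment> \<open>So the cardinality plus 3 at most doubles in each step; it starts from at most
    4.\<close>
  finally have "card (incident_words b (Suc n)) \<le> 2 * card ?C + 3" using cD E(2) by simp
  then show ?case using Suc by simp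
qed

interpretation P_ter_inf: prob_space P_ter_inf
  by (rule prob_space_P_ter_inf)

lemma AE_eventually_not_incident:
  "AE t in P_ter_inf. \<forall>\<^sub>F n in sequentially. \<forall>v\<in>incident_words b n. v \<notin> t"
proof -
  let ?A = "\<lambda>n. \<Union>v\<in>incident_words b n. {t \<in> space tree_space. v \<in> t}"
  have A: "?A n \<in> sets P_ter_inf" for n
    unfolding sets_P_ter_inf by (intro sets.finite_UN finite_incident_words sets_tree_space_mem)
  have bound: "measure P_ter_inf (?A n) \<le> 4 * ((1 + 3 * real n) * (2/3) ^ n)" for n
  proof -
    have "measure P_ter_inf (?A n) \<le> (\<Sum>v\<in>incident_words b n. measure P_ter_inf {t \<in> space tree_space. v \<in> t})"
      by (intro measure_UNION_le finite_incident_words) (simp only: sets_P_ter_inf sets_tree_space_mem)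
    also have "\<dots> \<le> (\<Sum>v\<in>incident_words b n. (1 + 3 * real n) * (1/3) ^ n)"
      using P_ter_inf_mem by (intro sum_mono) (auto simp: incident_words_def)
    also have "\<dots> = real (card (incident_words b n)) * ((1 + 3 * real n) * (1/3) ^ n)" by simp
    also have "\<dots> \<le> real (4 * 2 ^ n) * ((1 + 3 * real n) * (1/3) ^ n)"
      using card_incident_words[of b n] by (intro mult_right_mono of_nat_mono) auto
    also have "\<dots> = 4 * ((1 + 3 * real n) * (2 ^ n * (1/3) ^ n))" by simp
    also have "(2 :: real) ^ n * (1/3) ^ n = (2/3) ^ n" by (simp add: power_mult_distrib[symmetric])
    finally show ?thesis .
  qed
  have "summable (\<lambda>n. 4 * ((1 + 3 * real n) * (2/3) ^ n))"
  proof (rule summable_comparison_test_bigo)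
    \<comment> \<open>Any ratio strictly between 2/3 and 1 absorbs the linear factor.\<close>
    show "summable (\<lambda>n. norm ((3/4 :: real) ^ n))" by (simp add: summable_geometric)
    show "(\<lambda>n. 4 * ((1 + 3 * real n) * (2/3) ^ n)) \<in> O(\<lambda>n. (3/4) ^ n)" by real_asymp
  qed
  then have "summable (\<lambda>n. measure P_ter_inf (?A n))"
    by (rule summable_comparison_test') (use bound in auto)
  then have "AE t in P_ter_inf. \<forall>\<^sub>F n in sequentially. t \<in> space P_ter_inf - ?A n"
    by (intro borel_cantelli_AE1 A) (simp_all add: P_ter_inf.emeasure_eq_measure)
  then show ?thesis
    by (rule AE_mp) (auto intro!: AE_I2 elim!: eventually_mono)
qed

text \<open>The exceptional null set depends on the point; only countably many points are corners of
  words, so one null set serves all of them.\<close>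

theorem AE_finite_degrees: "AE t in P_ter_inf. finite_degrees t"
proof -
  have AE: "AE t in P_ter_inf. \<forall>(w :: word) (i :: nat). \<forall>\<^sub>F n in sequentially. \<forall>v\<in>incident_words (vtx (wt w) i) n. v \<notin> t"
    unfolding AE_all_countable using AE_eventually_not_incident by blast
  have fd: "finite_degrees t"
    if t: "t \<in> space P_ter_inf" and a: "\<forall>(w :: word) (i :: nat). \<forall>\<^sub>F n in sequentially. \<forall>v\<in>incident_words (vtx (wt w) i) n. v \<notin> t" for t
  proof -
    have tt: "ternary_tree t" using t by simp
    show ?thesis
      unfolding finite_degrees_iff[OF tt]
    proof (intro allI impI)
      fix w i
      obtain N where N: "\<forall>n\<ge>N. \<forall>v\<in>incident_words (vtx (wt w) i) n. v \<notin> t"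
        using a unfolding eventually_sequentially by blast
      have "v \<notin> internal_nodes t" if "N \<le> length v \<and> v \<in> lists letters \<and> vtx (wt w) i \<in> corners (wt v)" for v
      proof -
        have "v \<in> incident_words (vtx (wt w) i) (length v)" using that by (simp add: incident_words_def)
        then have "v \<notin> t" using N that by blast
        then show ?thesis using internal_subset by blast
      qed
      then show "\<exists>N. \<forall>v. N \<le> length v \<and> v \<in> lists letters \<and> vtx (wt w) i \<in> corners (wt v) \<longrightarrow> v \<notin> internal_nodes t"
        by blast
    qed
  qed
  from AE show ?thesis by (rule AE_mp) (rule AE_I2, rule impI, rule fd)
qed

section \<open>Measurability of the map of the infinite tree\<close>

lemma locally_finite_trees:
  "{t. locally_finite_map (tree_drawing t)} \<inter> space P_ter_inf = {t \<in> space tree_space. finite_degrees t}"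
  using locally_finite_tree_iff by auto

lemma finite_tree_degrees: "finite t \<Longrightarrow> finite_degrees t"
  unfolding finite_degrees_def using finite_internal by auto

definition stack_map :: "word set \<Rightarrow> rooted_map" where
  "stack_map t = map_of_drawing (tree_drawing t)"

lemma stack_map_locally_finite: "ternary_tree t \<Longrightarrow> finite_degrees t \<Longrightarrow> stack_map t \<in> locally_finite_maps"
  unfolding stack_map_def locally_finite_maps_def using locally_finite_tree_iff by blast

lemma d_L_le:
  assumes "balls_agree r m m'" shows "d_L m m' \<le> 1 / (1 + real r)"
proof -
  have "enat r \<le> (SUP r\<in>{r. balls_agree r m m'}. enat r)" using assms by (intro SUP_upper) simp
  then show ?thesis unfolding d_L_def
    by (cases "SUP r\<in>{r. balls_agree r m m'}. enat r") (auto simp: frac_le)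
qed

text \<open>Maps whose balls of radius r > 1 / e agree are closer than e, and by
  \<open>ball_stable\<close> equal tops give equal balls.\<close>

lemma open_stable:
  assumes U: "openin local_topology U" and t: "ternary_tree t" "finite_degrees t" "stack_map t \<in> U"
  shows "\<exists>H. \<forall>t'. ternary_tree t' \<and> finite_degrees t' \<and> trunc H t' = trunc H t \<longrightarrow> stack_map t' \<in> U"
proof -
  obtain e where e: "e > 0" "\<And>m'. m' \<in> locally_finite_maps \<Longrightarrow> d_L (stack_map t) m' < e \<Longrightarrow> m' \<in> U"
    using U t(3) unfolding openin_local_topology by blast
  obtain r where r: "1 / e < real r" using reals_Archimedean2 by blast
  then have r': "1 / (1 + real r) < e" using e(1) by (simp add: field_simps)
  obtain H where H: "\<And>t'. ternary_tree t' \<Longrightarrow> trunc H t' = trunc H t \<Longrightarrow>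
      map_ball (tree_drawing t') r = map_ball (tree_drawing t) r"
    using ball_stable[OF t(1,2), of r] by blast
  have "stack_map t' \<in> U" if t': "ternary_tree t'" "finite_degrees t'" "trunc H t' = trunc H t" for t'
  proof (rule e(2)[OF stack_map_locally_finite[OF t'(1,2)]])
    have "balls_agree r (stack_map t) (stack_map t')"
      unfolding balls_agree_def stack_map_def
      using mem_map_of_drawing H[OF t'(1,3)] same_map_refl by metis
    then show "d_L (stack_map t) (stack_map t') < e" using d_L_le r' by fastforce
  qed
  then show ?thesis by blast
qed

definition truncs :: "nat \<Rightarrow> word set set" where
  "truncs h = {s. ternary_tree s \<and> trunc h s = s}"

lemma truncs_trunc: "ternary_tree t \<Longrightarrow> trunc h t \<in> truncs h"
  unfolding truncs_def using ternary_trunc by simp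

lemma truncs_subset:
  assumes s: "s \<in> truncs h" shows "s \<subseteq> {w. w \<in> lists letters \<and> length w \<le> h}"
proof
  fix w assume "w \<in> s"
  moreover from this have "w \<in> trunc h s" using s by (simp add: truncs_def)
  ultimately show "w \<in> {w. w \<in> lists letters \<and> length w \<le> h}"
    using s tree_lists[of s w] by (simp add: truncs_def trunc_def)
qed

lemma finite_trunc: "s \<in> truncs h \<Longrightarrow> finite s"
  using truncs_subset finite_words finite_subset by blast

lemma finite_truncs: "finite (truncs h)"
proof (rule finite_subset)
  show "truncs h \<subseteq> Pow {w. w \<in> lists letters \<and> length w \<le> h}" using truncs_subset by blast
qed (simp add: finite_words)

text \<open>By \<open>open_stable\<close> the preimage of an open set is a union of cylinders within
  the locally finite trees, and there are only countably many cylinders.\<close>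

lemma measurable_stack_map:
  "stack_map \<in> measurable (restrict_space P_ter_inf {t. locally_finite_map (tree_drawing t)}) (borel_sets_of local_topology)"
  unfolding borel_sets_of_def topspace_local_topology
proof (rule measurable_measure_of)
  let ?L = "{t. locally_finite_map (tree_drawing t)}"
  let ?LF = "{t \<in> space tree_space. finite_degrees t}"
  have sp: "space (restrict_space P_ter_inf ?L) = ?LF"
    using locally_finite_trees by (simp add: space_restrict_space)
  show "{U. openin local_topology U} \<subseteq> Pow locally_finite_maps"
    using openin_subset topspace_local_topology by blast
  show "stack_map \<in> space (restrict_space P_ter_inf ?L) \<rightarrow> locally_finite_maps"
    unfolding sp using stack_map_locally_finite by auto
  fix U assume "U \<in> {U. openin local_topology U}"
  then have U: "openin local_topology U" by simp
  \<comment> \<open>The cylinders all of whose trees with finite degrees are sent into U.\<close>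
  let ?I = "{(H, s). s \<in> truncs H \<and> (\<forall>t'. ternary_tree t' \<and> finite_degrees t' \<and> trunc H t' = s \<longrightarrow> stack_map t' \<in> U)}"
  let ?S = "\<Union>(H, s)\<in>?I. {t \<in> space tree_space. trunc H t = s}"
  have "countable (Sigma UNIV truncs)" using finite_truncs by (intro countable_SIGMA) (auto intro: countable_finite)
  then have "countable ?I" by (rule countable_subset[rotated]) auto
  then have S: "?S \<in> sets tree_space"
  proof (rule sets.countable_UN'')
    show "(case x of (H, s) \<Rightarrow> {t \<in> space tree_space. trunc H t = s}) \<in> sets tree_space" for x
      using pred_trunc[unfolded pred_def] by (cases x) (simp only: prod.case)
  qed
  have "stack_map -` U \<inter> ?LF = ?L \<inter> ?S"
  proof (intro set_eqI iffI)
    fix t assume t: "t \<in> stack_map -` U \<inter> ?LF"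
    then have tt: "ternary_tree t" "finite_degrees t" "stack_map t \<in> U" by auto
    obtain H where "\<forall>t'. ternary_tree t' \<and> finite_degrees t' \<and> trunc H t' = trunc H t \<longrightarrow> stack_map t' \<in> U"
      using open_stable[OF U tt] by blast
    then have "(H, trunc H t) \<in> ?I" using truncs_trunc[OF tt(1)] by simp
    then have "t \<in> ?S" using tt(1) by force
    then show "t \<in> ?L \<inter> ?S" using locally_finite_tree_iff[OF tt(1)] tt(2) by simp
  next
    fix t assume t: "t \<in> ?L \<inter> ?S"
    then obtain H where "ternary_tree t" "\<forall>t'. ternary_tree t' \<and> finite_degrees t' \<and> trunc H t' = trunc H t \<longrightarrow> stack_map t' \<in> U"
      by auto
    then show "t \<in> stack_map -` U \<inter> ?LF" using t locally_finite_tree_iff by auto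
  qed
  then show "stack_map -` U \<inter> space (restrict_space P_ter_inf ?L) \<in> sets (restrict_space P_ter_inf ?L)"
    unfolding sp sets_restrict_space sets_P_ter_inf using S by blast
qed

section \<open>Weak convergence\<close>

lemma continuous_stable:
  fixes f :: "rooted_map \<Rightarrow> real"
  assumes f: "continuous_map local_topology euclideanreal f" and t: "ternary_tree t" "finite_degrees t" and e: "0 < e"
  shows "\<exists>H. \<forall>t'. ternary_tree t' \<and> finite_degrees t' \<and> trunc H t' = trunc H t \<longrightarrow> \<bar>f (stack_map t') - f (stack_map t)\<bar> < e"
proof -
  let ?U = "{m \<in> topspace local_topology. f m \<in> {f (stack_map t) - e <..< f (stack_map t) + e}}"
  have "openin local_topology ?U" using f by (rule openin_continuous_map_preimage) auto
  moreover have "stack_map t \<in> ?U" using stack_map_locally_finite[OF t] e by (simp add: topspace_local_topology)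
  ultimately obtain H where "\<forall>t'. ternary_tree t' \<and> finite_degrees t' \<and> trunc H t' = trunc H t \<longrightarrow> stack_map t' \<in> ?U"
    using open_stable[OF _ t] by blast
  then show ?thesis by (intro exI[of _ H]) (auto simp: abs_less_iff)
qed

lemma continuous_measurable:
  fixes f :: "rooted_map \<Rightarrow> real"
  assumes "continuous_map local_topology euclideanreal f"
  shows "f \<in> borel_measurable (borel_sets_of local_topology)"
proof (rule borel_measurableI)
  fix S :: "real set" assume "open S"
  then have "openin local_topology {m \<in> topspace local_topology. f m \<in> S}"
    using assms by (intro openin_continuous_map_preimage) auto
  moreover have sp: "space (borel_sets_of local_topology) = topspace local_topology"
    by (simp add: borel_sets_of_def space_measure_of_conv)
  moreover have "f -` S \<inter> topspace local_topology = {m \<in> topspace local_topology. f m \<in> S}" by blast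
  moreover have "U \<in> sets (borel_sets_of local_topology)" if "openin local_topology U" for U
    unfolding borel_sets_of_def using that openin_subset by (intro in_measure_of) auto
  ultimately show "f -` S \<inter> space (borel_sets_of local_topology) \<in> sets (borel_sets_of local_topology)" by simp
qed

lemma uniform_stack_integral:
  fixes f :: "rooted_map \<Rightarrow> real"
  assumes "continuous_map local_topology euclideanreal f"
  shows "(\<integral>m. f m \<partial>(uniform_stack (Suc N))) = (\<Sum>t\<in>finite_trees N. f (stack_map t)) / real (card (finite_trees N))"
proof -
  let ?S = "stack_triangulations (Suc N)"
  have S: "?S = stack_map ` finite_trees N" unfolding stack_map_def[abs_def] by (rule stack_triangulations_trees)
  have inj: "inj_on stack_map (finite_trees N)"
    unfolding stack_map_def[abs_def] by (rule inj_on_subset[OF tree_drawing_inj]) (auto simp: finite_trees_def)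
  have fin: "finite ?S" unfolding S using finite_finite_trees by simp
  have sub: "?S \<subseteq> locally_finite_maps"
    unfolding S using stack_map_locally_finite finite_tree_degrees by (auto simp: finite_trees_def)
  have "(\<lambda>m. m) \<in> measurable (uniform_count_measure ?S) (borel_sets_of local_topology)"
    unfolding measurable_def using sub
    by (auto simp: borel_sets_of_def space_measure_of_conv topspace_local_topology space_uniform_count_measure sets_uniform_count_measure)
  then have "(\<integral>m. f m \<partial>(uniform_stack (Suc N))) = (\<integral>m. f m \<partial>(uniform_count_measure ?S))"
    unfolding uniform_stack_def by (rule integral_distr[OF _ continuous_measurable[OF assms]])
  also have "\<dots> = sum f ?S / real (card ?S)" by (rule integral_uniform_count_measure[OF fin])
  also have "\<dots> = (\<Sum>t\<in>finite_trees N. f (stack_map t)) / real (card (finite_trees N))"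
    unfolding S by (simp add: sum.reindex[OF inj] card_image[OF inj])
  finally show ?thesis .
qed

text \<open>The restriction to locally finite trees becomes an indicator, so that all estimates can
  be made on the probability space \<open>P_ter_inf\<close>.\<close>

lemma P_stack_inf_integral:
  fixes f :: "rooted_map \<Rightarrow> real"
  assumes f: "continuous_map local_topology euclideanreal f"
  defines "F \<equiv> \<lambda>t. indicator {t. locally_finite_map (tree_drawing t)} t * f (stack_map t)"
  shows "(\<integral>m. f m \<partial>P_stack_inf) = (\<integral>t. F t \<partial>P_ter_inf)" "F \<in> borel_measurable P_ter_inf"
proof -
  let ?L = "{t. locally_finite_map (tree_drawing t)}"
  have L: "?L \<inter> space P_ter_inf \<in> sets P_ter_inf"
    unfolding locally_finite_trees sets_P_ter_inf by (rule sets_finite_degrees)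
  have m: "(\<lambda>t. f (stack_map t)) \<in> borel_measurable (restrict_space P_ter_inf ?L)"
    using measurable_compose[OF measurable_stack_map continuous_measurable[OF f]] .
  have "(\<integral>m. f m \<partial>P_stack_inf) = (\<integral>t. f (stack_map t) \<partial>(restrict_space P_ter_inf ?L))"
    unfolding P_stack_inf_def stack_map_def[symmetric]
    by (rule integral_distr[OF measurable_stack_map[unfolded stack_map_def[abs_def], folded stack_map_def] continuous_measurable[OF f]])
  also have "\<dots> = (\<integral>t. F t \<partial>P_ter_inf)" unfolding F_def integral_restrict_space[OF L] by simp
  finally show "(\<integral>m. f m \<partial>P_stack_inf) = (\<integral>t. F t \<partial>P_ter_inf)" .
  show "F \<in> borel_measurable P_ter_inf"
    using m unfolding borel_measurable_restrict_space_iff[OF L] F_def by simp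
qed

lemma card_finite_trees_pos: "0 < card (finite_trees N)"
proof -
  have "0 < tree_series $ N" using tree_series_pos[of 1 N] by simp
  then show ?thesis by (simp add: tree_gf_def)
qed

section \<open>Functions of the top of the tree\<close>

lemma P_ter_inf_step_integral:
  fixes c :: "word set \<Rightarrow> real"
  shows "(\<integral>t. c (trunc h t) \<partial>P_ter_inf) = (\<Sum>s\<in>truncs h. c s * (real (card (level h s)) * weight h s))"
    and "(\<lambda>t. c (trunc h t)) \<in> borel_measurable P_ter_inf"
    and "integrable P_ter_inf (\<lambda>t. c (trunc h t))"
proof -
  let ?E = "\<lambda>s. {t \<in> space tree_space. trunc h t = s}"
  have E: "?E s \<in> sets P_ter_inf" for s using pred_trunc[unfolded pred_def] by (simp only: sets_P_ter_inf)
  have eq: "c (trunc h t) = (\<Sum>s\<in>truncs h. c s * indicator (?E s) t)" if "t \<in> space P_ter_inf" for t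
  proof -
    have t: "trunc h t \<in> truncs h" using that truncs_trunc by simp
    have "(\<Sum>s\<in>truncs h. c s * indicator (?E s) t) = (\<Sum>s\<in>truncs h. if s = trunc h t then c s else 0)"
      using that by (intro sum.cong refl) (auto simp: indicator_def)
    then show ?thesis using t finite_truncs by simp
  qed
  have int: "integrable P_ter_inf (\<lambda>t. c s * indicator (?E s) t)" for s
    using E by (intro integrable_mult_right integrable_real_indicator) (auto simp: P_ter_inf.emeasure_eq_measure)
  have "(\<integral>t. c (trunc h t) \<partial>P_ter_inf) = (\<integral>t. (\<Sum>s\<in>truncs h. c s * indicator (?E s) t) \<partial>P_ter_inf)"
    by (rule Bochner_Integration.integral_cong[OF refl eq])
  also have "\<dots> = (\<Sum>s\<in>truncs h. \<integral>t. c s * indicator (?E s) t \<partial>P_ter_inf)"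
    by (rule Bochner_Integration.integral_sum) (rule int)
  also have "\<dots> = (\<Sum>s\<in>truncs h. c s * (real (card (level h s)) * weight h s))"
  proof (rule sum.cong[OF refl])
    fix s assume s: "s \<in> truncs h"
    have "?E s \<inter> space P_ter_inf = ?E s" by auto
    then have "(\<integral>t. c s * indicator (?E s) t \<partial>P_ter_inf) = c s * measure P_ter_inf (?E s)" by simp
    then show "(\<integral>t. c s * indicator (?E s) t \<partial>P_ter_inf) = c s * (real (card (level h s)) * weight h s)"
      using P_ter_inf_trunc[of s h] s by (simp add: truncs_def)
  qed
  finally show "(\<integral>t. c (trunc h t) \<partial>P_ter_inf) = (\<Sum>s\<in>truncs h. c s * (real (card (level h s)) * weight h s))" .
  have cong: "integrable P_ter_inf (\<lambda>t. c (trunc h t)) \<longleftrightarrow> integrable P_ter_inf (\<lambda>t. \<Sum>s\<in>truncs h. c s * indicator (?E s) t)"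
    by (rule Bochner_Integration.integrable_cong[OF refl eq])
  have "integrable P_ter_inf (\<lambda>t. \<Sum>s\<in>truncs h. c s * indicator (?E s) t)" by (intro Bochner_Integration.integrable_sum int)
  then show i: "integrable P_ter_inf (\<lambda>t. c (trunc h t))"
    unfolding cong .
  then show "(\<lambda>t. c (trunc h t)) \<in> borel_measurable P_ter_inf" by simp
qed

text \<open>The average is a finite linear combination of cylinder frequencies, and
  \<open>cylinder_limit\<close> identifies their limits with the cylinder probabilities of the
  infinite tree.\<close>

lemma finite_trees_step_average:
  fixes c :: "word set \<Rightarrow> real"
  shows "(\<lambda>N. (\<Sum>t\<in>finite_trees N. c (trunc h t)) / real (card (finite_trees N)))
    \<longlonglongrightarrow> (\<integral>t. c (trunc h t) \<partial>P_ter_inf)"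
proof -
  have "(\<Sum>t\<in>finite_trees N. c (trunc h t)) / real (card (finite_trees N)) =
     (\<Sum>s\<in>truncs h. c s * (real (card {t \<in> finite_trees N. trunc h t = s}) / real (card (finite_trees N))))" for N
  proof -
    have "(\<Sum>t\<in>finite_trees N. c (trunc h t)) = (\<Sum>s\<in>truncs h. \<Sum>t\<in>{t \<in> finite_trees N. trunc h t = s}. c (trunc h t))"
      using truncs_trunc by (intro sum.group[symmetric] finite_finite_trees finite_truncs) (auto simp: finite_trees_def)
    also have "\<dots> = (\<Sum>s\<in>truncs h. c s * real (card {t \<in> finite_trees N. trunc h t = s}))"
      by (intro sum.cong refl) (simp add: mult.commute)
    finally show ?thesis by (simp add: sum_divide_distrib)
  qed
  moreover have "(\<lambda>N. \<Sum>s\<in>truncs h. c s * (real (card {t \<in> finite_trees N. trunc h t = s}) / real (card (finite_trees N))))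
     \<longlonglongrightarrow> (\<Sum>s\<in>truncs h. c s * (real (card (level h s)) * weight h s))"
    by (intro tendsto_sum tendsto_mult tendsto_const cylinder_limit) (auto simp: truncs_def)
  ultimately show ?thesis unfolding P_ter_inf_step_integral(1) by simp
qed

text \<open>A cylinder is good if f oscillates by at most e on it. Almost every tree has a good top
  at some height, and good tops stay good at larger heights, so at some height the bad ones have
  probability less than e. Each cylinder is represented by the truncated tree, which is finite and
  hence locally finite.\<close>

lemma truncated_approximation:
  fixes f :: "rooted_map \<Rightarrow> real"
  assumes f: "continuous_map local_topology euclideanreal f" and B: "\<And>m. m \<in> locally_finite_maps \<Longrightarrow> \<bar>f m\<bar> \<le> B" and e: "0 < e"
  shows "\<exists>h bad. (\<forall>t. ternary_tree t \<and> finite_degrees t \<longrightarrow>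
        \<bar>f (stack_map t) - f (stack_map (trunc h t))\<bar> \<le> e + 2 * B * (if bad (trunc h t) then 1 else 0))
     \<and> (\<integral>t. (if bad (trunc h t) then 1 else 0) \<partial>P_ter_inf) < e"
proof -
  define good where "good = (\<lambda>h s. \<forall>t t'. ternary_tree t \<and> finite_degrees t \<and> ternary_tree t' \<and> finite_degrees t' \<and>
     trunc h t = s \<and> trunc h t' = s \<longrightarrow> \<bar>f (stack_map t) - f (stack_map t')\<bar> \<le> e)"
  let ?G = "\<lambda>h. {t \<in> space tree_space. good h (trunc h t)}"
  have trunc_le: "trunc h (trunc h' t) = trunc h t" if "h \<le> h'" for h h' t
    using that by (auto simp: trunc_def)
  have G: "?G h \<in> sets P_ter_inf" for h
  proof -
    have "(\<lambda>t. if good h (trunc h t) then 1 else 0 :: real) \<in> borel_measurable P_ter_inf"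
      by (rule P_ter_inf_step_integral(2)[of "\<lambda>s. if good h s then 1 else 0"])
    then have "(\<lambda>t. if good h (trunc h t) then 1 else 0 :: real) -` {1} \<inter> space P_ter_inf \<in> sets P_ter_inf"
      by (rule measurable_sets) simp
    moreover have "(\<lambda>t. if good h (trunc h t) then 1 else 0 :: real) -` {1} \<inter> space P_ter_inf = ?G h"
      by (auto split: if_splits)
    ultimately show ?thesis by (simp only:)
  qed
  have inc: "incseq ?G"
  proof (rule incseq_SucI, rule subsetI)
    fix h t assume t: "t \<in> ?G h"
    have "good (Suc h) (trunc (Suc h) t)" unfolding good_def
    proof (intro allI impI)
      fix t1 t2 assume a: "ternary_tree t1 \<and> finite_degrees t1 \<and> ternary_tree t2 \<and> finite_degrees t2 \<and>
        trunc (Suc h) t1 = trunc (Suc h) t \<and> trunc (Suc h) t2 = trunc (Suc h) t"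
      then have "trunc h t1 = trunc h t" "trunc h t2 = trunc h t"
        using trunc_le[of h "Suc h"] by (metis le_SucI order_refl)+
      then show "\<bar>f (stack_map t1) - f (stack_map t2)\<bar> \<le> e" using t a unfolding good_def by blast
    qed
    then show "t \<in> ?G (Suc h)" using t by simp
  qed
  have union: "AE t in P_ter_inf. t \<in> (\<Union>h. ?G h)"
    using AE_finite_degrees
  proof (rule AE_mp, intro AE_I2 impI)
    fix t assume t: "t \<in> space P_ter_inf" "finite_degrees t"
    then have tt: "ternary_tree t" by simp
    \<comment> \<open>Half of e for the distance to the value at t, since \<open>good\<close>
      compares two arbitrary trees of the cylinder.\<close>
    obtain h where h: "\<forall>t'. ternary_tree t' \<and> finite_degrees t' \<and> trunc h t' = trunc h t \<longrightarrow> \<bar>f (stack_map t') - f (stack_map t)\<bar> < e / 2"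
      using continuous_stable[OF f tt t(2), of "e / 2"] e by auto
    have "good h (trunc h t)" unfolding good_def
    proof (intro allI impI)
      fix t1 t2 assume a: "ternary_tree t1 \<and> finite_degrees t1 \<and> ternary_tree t2 \<and> finite_degrees t2 \<and>
        trunc h t1 = trunc h t \<and> trunc h t2 = trunc h t"
      then have "\<bar>f (stack_map t1) - f (stack_map t)\<bar> < e / 2" "\<bar>f (stack_map t2) - f (stack_map t)\<bar> < e / 2"
        using h by blast+
      then show "\<bar>f (stack_map t1) - f (stack_map t2)\<bar> \<le> e" by linarith
    qed
    then show "t \<in> (\<Union>h. ?G h)" using tt by auto
  qed
  have "(\<lambda>h. measure P_ter_inf (?G h)) \<longlonglongrightarrow> measure P_ter_inf (\<Union>h. ?G h)"
    using G inc by (intro P_ter_inf.finite_Lim_measure_incseq) auto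
  moreover have "measure P_ter_inf (\<Union>h. ?G h) = 1"
    using P_ter_inf.prob_eq_1[of "\<Union>h. ?G h"] G union by auto
  ultimately have "(\<lambda>h. measure P_ter_inf (?G h)) \<longlonglongrightarrow> 1" by simp
  then obtain h where h: "1 - e < measure P_ter_inf (?G h)"
    using e by (metis (no_types, lifting) eventually_sequentially order_refl order_tendstoD(1) diff_gt_0_iff_gt diff_strict_left_mono diff_zero)
  define bad where "bad = (\<lambda>s. \<not> good h s)"
  have "\<bar>f (stack_map t) - f (stack_map (trunc h t))\<bar> \<le> e + 2 * B * (if bad (trunc h t) then 1 else 0)"
    if t: "ternary_tree t" "finite_degrees t" for t
  proof -
    have s: "ternary_tree (trunc h t)" "finite_degrees (trunc h t)"
      using ternary_trunc[OF t(1)] finite_tree_degrees[OF finite_trunc[OF truncs_trunc[OF t(1)]]] by auto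
    show ?thesis
    proof (cases "bad (trunc h t)")
      case False
      then have "good h (trunc h t)" by (simp add: bad_def)
      then have "\<bar>f (stack_map t) - f (stack_map (trunc h t))\<bar> \<le> e"
        unfolding good_def using t s trunc_trunc by blast
      then show ?thesis using False by simp
    next
      case True
      have "\<bar>f (stack_map t)\<bar> \<le> B" "\<bar>f (stack_map (trunc h t))\<bar> \<le> B"
        using B stack_map_locally_finite t s by blast+
      then have "\<bar>f (stack_map t) - f (stack_map (trunc h t))\<bar> \<le> 2 * B" by linarith
      then show ?thesis using True e by simp
    qed
  qed
  moreover have "(\<integral>t. (if bad (trunc h t) then 1 else 0) \<partial>P_ter_inf) < e"
  proof -
    have "(\<integral>t. (if bad (trunc h t) then 1 else 0 :: real) \<partial>P_ter_inf) = (\<integral>t. indicator (space P_ter_inf - ?G h) t \<partial>P_ter_inf)"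
      by (rule Bochner_Integration.integral_cong) (auto simp: bad_def indicator_def)
    also have "\<dots> = measure P_ter_inf ((space P_ter_inf - ?G h) \<inter> space P_ter_inf)"
      by (rule Bochner_Integration.integral_indicator)
    also have "(space P_ter_inf - ?G h) \<inter> space P_ter_inf = space P_ter_inf - ?G h" by blast
    also have "measure P_ter_inf (space P_ter_inf - ?G h) = 1 - measure P_ter_inf (?G h)" by (rule P_ter_inf.prob_compl[OF G])
    finally show ?thesis using h by simp
  qed
  ultimately show ?thesis by blast
qed

text \<open>f is compared with a step function c, with an error d that is a step function too. The
  averages of both converge by \<open>finite_trees_step_average\<close>; convergence for d bounds
  the mass of the bad cylinders under the finite laws, which takes the place of a tightness
  argument.\<close>

theorem theorem12:
  shows "converges_weakly local_topology uniform_stack P_stack_inf"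
  unfolding converges_weakly_def
proof (intro allI impI)
  fix f :: "rooted_map \<Rightarrow> real"
  assume "continuous_map local_topology euclideanreal f \<and> bounded (f ` topspace local_topology)"
  then have f: "continuous_map local_topology euclideanreal f" and bd: "bounded (f ` topspace local_topology)" by auto
  obtain B where B: "0 < B" "\<And>m. m \<in> locally_finite_maps \<Longrightarrow> \<bar>f m\<bar> \<le> B"
    using bd unfolding bounded_pos topspace_local_topology by auto
  let ?L = "{t. locally_finite_map (tree_drawing t)}"
  define F where "F = (\<lambda>t. indicator ?L t * f (stack_map t))"
  define EN where "EN = (\<lambda>N (g :: word set \<Rightarrow> real). (\<Sum>t\<in>finite_trees N. g t) / real (card (finite_trees N)))"
  define E where "E = (\<lambda>g :: word set \<Rightarrow> real. \<integral>t. g t \<partial>P_ter_inf)"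
  have F: "(\<integral>m. f m \<partial>P_stack_inf) = E F" "F \<in> borel_measurable P_ter_inf"
    unfolding E_def F_def using P_stack_inf_integral[OF f] by auto
  have lim: "(\<lambda>N. EN N (\<lambda>t. f (stack_map t))) \<longlonglongrightarrow> E F"
  proof (rule LIMSEQ_I)
    fix r :: real assume r: "0 < r"
    \<comment> \<open>The two approximation errors, each below e (1 + 2 B), then add up to r /
      2.\<close>
    define e where "e = r / 2 / (2 + 4 * B)"
    have e: "0 < e" using r B by (simp add: e_def)
    have "2 + 4 * B \<noteq> 0" using B(1) by simp
    then have e2: "e * (2 + 4 * B) = r / 2" unfolding e_def by (metis nonzero_divide_eq_eq)
    obtain h bad where approx: "\<And>t. ternary_tree t \<Longrightarrow> finite_degrees t \<Longrightarrow>
        \<bar>f (stack_map t) - f (stack_map (trunc h t))\<bar> \<le> e + 2 * B * (if bad (trunc h t) then 1 else 0)"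
      and small: "(\<integral>t. (if bad (trunc h t) then 1 else 0) \<partial>P_ter_inf) < e"
      using truncated_approximation[OF f B(2) e] by blast
    define c where "c = (\<lambda>s. f (stack_map s))"
    define d where "d = (\<lambda>s. e + 2 * B * (if bad s then 1 else 0 :: real))"
    have c: "(\<lambda>N. EN N (\<lambda>t. c (trunc h t))) \<longlonglongrightarrow> E (\<lambda>t. c (trunc h t))"
      unfolding EN_def E_def by (rule finite_trees_step_average)
    have d: "(\<lambda>N. EN N (\<lambda>t. d (trunc h t))) \<longlonglongrightarrow> E (\<lambda>t. d (trunc h t))"
      unfolding EN_def E_def by (rule finite_trees_step_average)
    have "E (\<lambda>t. d (trunc h t)) = e + 2 * B * (\<integral>t. (if bad (trunc h t) then 1 else 0) \<partial>P_ter_inf)"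
      unfolding E_def d_def
      using P_ter_inf_step_integral(3)[of "\<lambda>s. if bad s then 1 else 0" h]
        P_ter_inf.prob_space by simp
    also have "\<dots> < e + 2 * B * e" using small B by simp
    finally have dE: "E (\<lambda>t. d (trunc h t)) < e * (1 + 2 * B)" by (simp add: algebra_simps)
    have EN_approx: "\<bar>EN N (\<lambda>t. f (stack_map t)) - EN N (\<lambda>t. c (trunc h t))\<bar> \<le> EN N (\<lambda>t. d (trunc h t))" for N
    proof -
      have "EN N (\<lambda>t. f (stack_map t)) - EN N (\<lambda>t. c (trunc h t)) = EN N (\<lambda>t. f (stack_map t) - c (trunc h t))"
        by (simp add: EN_def sum_subtractf diff_divide_distrib)
      also have "\<bar>\<dots>\<bar> \<le> EN N (\<lambda>t. \<bar>f (stack_map t) - c (trunc h t)\<bar>)"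
        unfolding EN_def abs_divide by (intro divide_mono sum_abs) (auto simp: card_finite_trees_pos)
      also have "\<dots> \<le> EN N (\<lambda>t. d (trunc h t))"
        unfolding EN_def using approx finite_tree_degrees
        by (intro divide_right_mono sum_mono) (auto simp: c_def d_def finite_trees_def)
      finally show ?thesis .
    qed
    have int_c: "integrable P_ter_inf (\<lambda>t. c (trunc h t))" and int_d: "integrable P_ter_inf (\<lambda>t. d (trunc h t))"
      by (rule P_ter_inf_step_integral(3))+
    have F_approx: "AE t in P_ter_inf. \<bar>F t - c (trunc h t)\<bar> \<le> d (trunc h t)"
      using AE_finite_degrees
    proof (rule AE_mp, intro AE_I2 impI)
      fix t assume "t \<in> space P_ter_inf" "finite_degrees t"
      then have t: "ternary_tree t" "finite_degrees t" by auto
      then have "t \<in> ?L" using locally_finite_tree_iff by simp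
      then show "\<bar>F t - c (trunc h t)\<bar> \<le> d (trunc h t)" using approx[OF t] by (simp add: F_def c_def d_def)
    qed
    have int_Fc: "integrable P_ter_inf (\<lambda>t. F t - c (trunc h t))"
    proof (rule Bochner_Integration.integrable_bound[OF int_d])
      show "(\<lambda>t. F t - c (trunc h t)) \<in> borel_measurable P_ter_inf"
        using F(2) int_c by (intro borel_measurable_diff) auto
      show "AE t in P_ter_inf. norm (F t - c (trunc h t)) \<le> norm (d (trunc h t))"
        using F_approx by (rule AE_mp) (intro AE_I2, auto)
    qed
    then have int_F: "integrable P_ter_inf F"
      using Bochner_Integration.integrable_add[OF int_Fc int_c] by simp
    have E_approx: "\<bar>E F - E (\<lambda>t. c (trunc h t))\<bar> \<le> E (\<lambda>t. d (trunc h t))"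
    proof -
      have "E F - E (\<lambda>t. c (trunc h t)) = (\<integral>t. F t - c (trunc h t) \<partial>P_ter_inf)"
        unfolding E_def using Bochner_Integration.integral_diff[OF int_F int_c] by simp
      also have "\<bar>\<dots>\<bar> \<le> (\<integral>t. \<bar>F t - c (trunc h t)\<bar> \<partial>P_ter_inf)" by (rule integral_abs_bound)
      also have "\<dots> \<le> E (\<lambda>t. d (trunc h t))"
        unfolding E_def using int_Fc int_d F_approx by (intro integral_mono_AE integrable_abs)
      finally show ?thesis .
    qed
    have "(\<lambda>N. \<bar>EN N (\<lambda>t. c (trunc h t)) - E (\<lambda>t. c (trunc h t))\<bar> + EN N (\<lambda>t. d (trunc h t)))
       \<longlonglongrightarrow> \<bar>E (\<lambda>t. c (trunc h t)) - E (\<lambda>t. c (trunc h t))\<bar> + E (\<lambda>t. d (trunc h t))"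
      by (intro tendsto_intros c d)
    then have "(\<lambda>N. \<bar>EN N (\<lambda>t. c (trunc h t)) - E (\<lambda>t. c (trunc h t))\<bar> + EN N (\<lambda>t. d (trunc h t)))
       \<longlonglongrightarrow> E (\<lambda>t. d (trunc h t))" by simp
    then have "\<forall>\<^sub>F N in sequentially. \<bar>EN N (\<lambda>t. c (trunc h t)) - E (\<lambda>t. c (trunc h t))\<bar> + EN N (\<lambda>t. d (trunc h t)) < e * (1 + 2 * B)"
      using dE by (rule order_tendstoD(2))
    then obtain N0 where N0: "\<And>N. N \<ge> N0 \<Longrightarrow>
        \<bar>EN N (\<lambda>t. c (trunc h t)) - E (\<lambda>t. c (trunc h t))\<bar> + EN N (\<lambda>t. d (trunc h t)) < e * (1 + 2 * B)"
      unfolding eventually_sequentially by blast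
    have "norm (EN N (\<lambda>t. f (stack_map t)) - E F) < r" if "N \<ge> N0" for N
    proof -
      have "\<bar>EN N (\<lambda>t. f (stack_map t)) - E F\<bar> < e * (1 + 2 * B) + e * (1 + 2 * B)"
        using N0[OF that] EN_approx[of N] E_approx dE by linarith
      also have "\<dots> = r / 2" using e2 by (simp add: algebra_simps)
      finally show ?thesis using r by simp
    qed
    then show "\<exists>N0. \<forall>N\<ge>N0. norm (EN N (\<lambda>t. f (stack_map t)) - E F) < r" by blast
  qed
  have "(\<lambda>N. \<integral>m. f m \<partial>(uniform_stack (Suc N))) \<longlonglongrightarrow> (\<integral>m. f m \<partial>P_stack_inf)"
    unfolding uniform_stack_integral[OF f] F(1) using lim unfolding EN_def .
  \<comment> \<open>Undoes the shift between N internal nodes and the index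
    \<open>Suc N\<close>.\<close>
  then show "(\<lambda>n. \<integral>m. f m \<partial>(uniform_stack n)) \<longlonglongrightarrow> (\<integral>m. f m \<partial>P_stack_inf)"
    by (rule LIMSEQ_imp_Suc)
qed

end
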